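(* Let $p$ be a prime, $F$ a field of characteristic $p$, and $(D,v)$ a valued division algebra, finite-dimensional with center $F$, which is semi-ramified with $\overline D/\overline F$ a separable extension. Assume that $G=\mathrm{Gal}(\overline D/\overline F)$ is a noncyclic $p$-group and that $D$ is not strongly degenerate. Then $D$ has no non-central $p$-power central elements; that is, if $a\in D$ and $a^p\in F$, then $a\in F$.
   Context: A valued division algebra $(D,v)$ over $F$ is a division algebra $D$, finite-dimensional with center $F$, with a valuation $v$ on $D$ (values in a totally ordered abelian group); $\Gamma_D,\Gamma_F$ are the value groups and $\overline D,\overline F$ the residue division rings. $D$ is semi-ramified if $\overline D$ is a field and $[\overline D:\overline F]=|\Gamma_D:\Gamma_F|=\sqrt{[D:F]}$. If moreover $\overline D/\overline F$ is separable, then the homomorphism $\theta_D:\Gamma_D/\Gamma_F\to\mathrm{Gal}(\overline D/\overline F)$, sending $v(\pi)+\Gamma_F$ to the automorphism of $\overline D$ induced by conjugation by $\pi\in D^*$ on the valuation ring, is an isomorphism and $\overline D/\overline F$ is abelian Galois. Strong degeneracy: let $D$ be semi-ramified with $\overline D/\overline F$ separable and $G=\mathrm{Gal}(\overline D/\overline F)=\langle\sigma_1\rangle\times\cdots\times\langle\sigma_r\rangle$ noncyclic. Choose $\pi_i\in D^*$ with $\theta_D(v(\pi_i)+\Gamma_F)=\sigma_i$. For $\overline m\in\mathbb{N}^r$ put $\sigma^{\overline m}=\prod\sigma_i^{m_i}$, $\pi^{\overline m}=\pi_1^{m_1}\cdots\pi_r^{m_r}$, and let $\overline u_{i,\overline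 m}\in\overline D^*$ be the residue of the unit $\pi_i\pi^{\overline m}\pi_i^{-1}(\pi^{\overline m})^{-1}$. $D$ is strongly degenerate if there are $\overline m\in\mathbb{N}^r$ with $\sigma^{\overline m}$ of prime order and $l,y_1,\ldots,y_r\in\overline D^*$ with $\overline u_{i,\overline m}=\frac{\sigma^{\overline m}(y_i)}{y_i}\frac{l}{\sigma_i(l)}$ for all $1\le i\le r$. This does not depend on the choice of the $\pi_i$. (Equivalently: the associated graded division algebra of $D$ has a nonzero homogeneous element of degree $\gamma\in\Gamma_D-\Gamma_F$ whose $q$-th power is central for some prime $q$.) *)

theory Defs
  imports Complex_Main "HOL-Algebra.Algebra" "HOL-Computational_Algebra.Primes"
begin

definition has_characteristic :: "('a, 'b) ring_scheme \<Rightarrow> nat \<Rightarrow> bool" where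
  "has_characteristic R p \<longleftrightarrow>
     (\<forall>n::nat. add_pow R n \<one>\<^bsub>R\<^esub> = \<zero>\<^bsub>R\<^esub> \<longleftrightarrow> p dvd n)"

definition ring_center :: "('a, 'b) ring_scheme \<Rightarrow> 'a set" where
  "ring_center R = {z \<in> carrier R. \<forall>x\<in>carrier R. z \<otimes>\<^bsub>R\<^esub> x = x \<otimes>\<^bsub>R\<^esub> z}"

definition division_algebra :: "('a, 'b) ring_scheme \<Rightarrow> 'a set \<Rightarrow> bool" where
  "division_algebra D F \<longleftrightarrow>
     ring D \<and> \<one>\<^bsub>D\<^esub> \<noteq> \<zero>\<^bsub>D\<^esub> \<and> Units D = carrier D - {\<zero>\<^bsub>D\<^esub>} \<and>
     F = ring_center D \<and> ring.finite_dimension D F (carrier D)"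

text \<open>Separability of a field extension \<open>L / K\<close>, for a subfield \<open>K\<close> of \<open>L\<close>: every minimal
  polynomial is coprime to its derivative.  Polynomials are lists with the leading
  coefficient first, so the entry \<open>p ! i\<close> belongs to the power \<open>degree p - i\<close>.\<close>

definition poly_derivative :: "('a, 'b) ring_scheme \<Rightarrow> 'a list \<Rightarrow> 'a list" where
  "poly_derivative R p =
     ring.normalize R (map (\<lambda>i. add_pow R (degree p - i) (p ! i)) [0..<degree p])"

definition separable_poly :: "('a, 'b) ring_scheme \<Rightarrow> 'a set \<Rightarrow> 'a list \<Rightarrow> bool" where
  "separable_poly L K p \<longleftrightarrow>
     (\<exists>s \<in> carrier (K[X]\<^bsub>L\<^esub>). \<exists>t \<in> carrier (K[X]\<^bsub>L\<^esub>).
        (s \<otimes>\<^bsub>K[X]\<^bsub>L\<^esub>\<^esub> p) \<oplus>\<^bsub>K[X]\<^bsub>L\<^esub>\<^esub> (t \<otimes>\<^bsub>K[X]\<^bsub>L\<^esub>\<^esub> poly_derivative L p) = \<one>\<^bsub>K[X]\<^bsub>L\<^esub>\<^esub>)"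

definition separable_extension :: "('a, 'b) ring_scheme \<Rightarrow> 'a set \<Rightarrow> bool" where
  "separable_extension L K \<longleftrightarrow>
     (\<forall>x\<in>carrier L. ring.algebraic L K x \<and> separable_poly L K (ring.Irr L K x))"

text \<open>As in \<^const>\<open>AutoGroup\<close>, automorphisms are extensional functions on the carrier.\<close>

definition galois_group :: "('a, 'b) ring_scheme \<Rightarrow> 'a set \<Rightarrow> ('a \<Rightarrow> 'a) monoid" where
  "galois_group L K =
     BijGroup (carrier L)
       \<lparr>carrier := {f \<in> ring_iso L L \<inter> extensional (carrier L). \<forall>x\<in>K. f x = x}\<rparr>"

text \<open>Valuations are only constrained on nonzero elements; the value at zero (conventionally
  infinity) is irrelevant and treated separately below.\<close>

definition valuation ::
    "('a, 'b) ring_scheme \<Rightarrow> ('a \<Rightarrow> 'g::linordered_ab_group_add) \<Rightarrow> bool" where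
  "valuation D v \<longleftrightarrow>
     (\<forall>x \<in> carrier D - {\<zero>\<^bsub>D\<^esub>}. \<forall>y \<in> carrier D - {\<zero>\<^bsub>D\<^esub>}.
        v (x \<otimes>\<^bsub>D\<^esub> y) = v x + v y \<and>
        (x \<oplus>\<^bsub>D\<^esub> y \<noteq> \<zero>\<^bsub>D\<^esub> \<longrightarrow> min (v x) (v y) \<le> v (x \<oplus>\<^bsub>D\<^esub> y)))"

definition valued_division_algebra ::
    "('a, 'b) ring_scheme \<Rightarrow> 'a set \<Rightarrow> ('a \<Rightarrow> 'g::linordered_ab_group_add) \<Rightarrow> bool" where
  "valued_division_algebra D F v \<longleftrightarrow> division_algebra D F \<and> valuation D v"

definition value_group ::
    "('a, 'b) ring_scheme \<Rightarrow> ('a \<Rightarrow> 'g::linordered_ab_group_add) \<Rightarrow> 'a set \<Rightarrow> 'g monoid" where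
  "value_group D v S =
     \<lparr>carrier = v ` (S - {\<zero>\<^bsub>D\<^esub>}), monoid.mult = (+), one = 0\<rparr>"

definition valuation_ring ::
    "('a, 'b) ring_scheme \<Rightarrow> ('a \<Rightarrow> 'g::linordered_ab_group_add) \<Rightarrow> 'a set" where
  "valuation_ring D v = {x \<in> carrier D. x = \<zero>\<^bsub>D\<^esub> \<or> 0 \<le> v x}"

definition valuation_ideal ::
    "('a, 'b) ring_scheme \<Rightarrow> ('a \<Rightarrow> 'g::linordered_ab_group_add) \<Rightarrow> 'a set" where
  "valuation_ideal D v = {x \<in> carrier D. x = \<zero>\<^bsub>D\<^esub> \<or> 0 < v x}"

definition residue_ring ::
    "('a, 'b) ring_scheme \<Rightarrow> ('a \<Rightarrow> 'g::linordered_ab_group_add) \<Rightarrow> 'a set ring" where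
  "residue_ring D v = (D\<lparr>carrier := valuation_ring D v\<rparr>) Quot (valuation_ideal D v)"

definition residue ::
    "('a, 'b) ring_scheme \<Rightarrow> ('a \<Rightarrow> 'g::linordered_ab_group_add) \<Rightarrow> 'a \<Rightarrow> 'a set" where
  "residue D v x = valuation_ideal D v +>\<^bsub>D\<^esub> x"

text \<open>The residue field of \<open>F\<close>, as usual identified with its image in the residue ring of \<open>D\<close>.\<close>

definition residue_subfield ::
    "('a, 'b) ring_scheme \<Rightarrow> ('a \<Rightarrow> 'g::linordered_ab_group_add) \<Rightarrow> 'a set \<Rightarrow> 'a set set" where
  "residue_subfield D v F = residue D v ` (F \<inter> valuation_ring D v)"

text \<open>In the second condition an infinite index has \<^const>\<open>order\<close> zero, so the equation also
  forces the index to be finite.\<close>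

definition semi_ramified ::
    "('a, 'b) ring_scheme \<Rightarrow> 'a set \<Rightarrow> ('a \<Rightarrow> 'g::linordered_ab_group_add) \<Rightarrow> bool" where
  "semi_ramified D F v \<longleftrightarrow>
     (let E = residue_ring D v; K = residue_subfield D v F;
          root_deg = sqrt (real (ring.dim D F (carrier D)))
      in field E \<and>
         ring.finite_dimension E K (carrier E) \<and> real (ring.dim E K (carrier E)) = root_deg \<and>
         real (order (value_group D v (carrier D) Mod carrier (value_group D v F))) = root_deg)"

abbreviation residue_galois_group ::
    "('a, 'b) ring_scheme \<Rightarrow> 'a set \<Rightarrow> ('a \<Rightarrow> 'g::linordered_ab_group_add) \<Rightarrow>
       ('a set \<Rightarrow> 'a set) monoid" where
  "residue_galois_group D F v \<equiv> galois_group (residue_ring D v) (residue_subfield D v F)"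

text \<open>\<open>theta D v a\<close> is \<open>\<theta>\<^sub>D(v(a) + \<Gamma>\<^sub>F)\<close>: conjugation by \<open>a\<close>, acting on residue classes, i.e. on
  cosets of the valuation ideal.\<close>

definition theta ::
    "('a, 'b) ring_scheme \<Rightarrow> ('a \<Rightarrow> 'g::linordered_ab_group_add) \<Rightarrow> 'a \<Rightarrow> 'a set \<Rightarrow> 'a set" where
  "theta D v a =
     (\<lambda>C \<in> carrier (residue_ring D v). (\<lambda>x. a \<otimes>\<^bsub>D\<^esub> x \<otimes>\<^bsub>D\<^esub> inv\<^bsub>D\<^esub> a) ` C)"

text \<open>The ordered product \<open>x\<^sub>1 \<cdots> x\<^sub>r\<close>.\<close>

definition ordered_prod :: "('a, 'b) monoid_scheme \<Rightarrow> nat \<Rightarrow> (nat \<Rightarrow> 'a) \<Rightarrow> 'a" where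
  "ordered_prod M r x = foldr (\<lambda>i y. x i \<otimes>\<^bsub>M\<^esub> y) [1..<Suc r] \<one>\<^bsub>M\<^esub>"

text \<open>\<open>G = \<langle>\<sigma>\<^sub>1\<rangle> \<times> \<cdots> \<times> \<langle>\<sigma>\<^sub>r\<rangle>\<close> (internal direct product).\<close>

definition cyclic_decomposition :: "('a, 'b) monoid_scheme \<Rightarrow> nat \<Rightarrow> (nat \<Rightarrow> 'a) \<Rightarrow> bool" where
  "cyclic_decomposition G r \<sigma> \<longleftrightarrow>
     (\<forall>i\<in>{1..r}. \<sigma> i \<in> carrier G) \<and>
     ordered_prod G r \<in> iso (product_group {1..r} (\<lambda>i. subgroup_generated G {\<sigma> i})) G"

text \<open>The notion does not depend on the choice of the decomposition of the Galois group nor on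
  that of the \<open>\<pi>\<^sub>i\<close>, so the choices are quantified existentially.\<close>

definition strongly_degenerate ::
    "('a, 'b) ring_scheme \<Rightarrow> 'a set \<Rightarrow> ('a \<Rightarrow> 'g::linordered_ab_group_add) \<Rightarrow> bool" where
  "strongly_degenerate D F v \<longleftrightarrow>
     (let E = residue_ring D v; G = residue_galois_group D F v in
      \<exists>r \<sigma> \<pi>.
        cyclic_decomposition G r \<sigma> \<and>
        (\<forall>i\<in>{1..r}. \<pi> i \<in> carrier D - {\<zero>\<^bsub>D\<^esub>} \<and> theta D v (\<pi> i) = \<sigma> i) \<and>
        (\<exists>m :: nat \<Rightarrow> nat.
           let \<sigma>m = ordered_prod G r (\<lambda>i. \<sigma> i [^]\<^bsub>G\<^esub> m i);
               \<pi>m = ordered_prod D r (\<lambda>i. \<pi> i [^]\<^bsub>D\<^esub> m i);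
               u = (\<lambda>i. residue D v (\<pi> i \<otimes>\<^bsub>D\<^esub> \<pi>m \<otimes>\<^bsub>D\<^esub> inv\<^bsub>D\<^esub> (\<pi> i) \<otimes>\<^bsub>D\<^esub> inv\<^bsub>D\<^esub> \<pi>m))
           in Factorial_Ring.prime (group.ord G \<sigma>m) \<and>
              (\<exists>l \<in> carrier E - {\<zero>\<^bsub>E\<^esub>}. \<exists>y \<in> {1..r} \<rightarrow> carrier E - {\<zero>\<^bsub>E\<^esub>}. \<forall>i\<in>{1..r}.
                 u i = (\<sigma>m (y i) \<otimes>\<^bsub>E\<^esub> inv\<^bsub>E\<^esub> (y i)) \<otimes>\<^bsub>E\<^esub> (l \<otimes>\<^bsub>E\<^esub> inv\<^bsub>E\<^esub> (\<sigma> i l)))))"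

end

theory Submission
  imports Defs "HOL-Number_Theory.Cong"
begin

text \<open>
  Because \<open>D\<close> is semi-ramified, lifts of a basis of the residue field, multiplied by representatives
  of \<open>\<Gamma>\<^sub>D / \<Gamma>\<^sub>F\<close>, form a basis of \<open>D\<close> over \<open>F\<close> that splits the valuation. Hence among the translates
  \<open>a - f\<close> with \<open>f \<in> F\<close> of an element \<open>a\<close> there is a best one, \<open>b\<close>: either \<open>b = 0\<close>, or \<open>v(b) \<notin> \<Gamma>\<^sub>F\<close>, or
  \<open>b\<close> is an element of \<open>F\<close> times a unit whose residue \<open>x\<close> is not in the residue field of \<open>F\<close>. In
  characteristic \<open>p\<close> the power \<open>b\<^sup>p = a\<^sup>p - f\<^sup>p\<close> is again central. The last case is impossible, since
  \<open>x\<close> is separable and \<open>x\<^sup>p\<close> lies in the residue field of \<open>F\<close>. In the middle case \<open>\<theta>\<^sub>D(b)\<close> has order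
  \<open>p\<close>, and Hilbert's Theorem 90, applied to the residues of \<open>\<pi>\<^sub>i b \<pi>\<^sub>i\<^sup>-\<^sup>1 b\<^sup>-\<^sup>1\<close>, whose norms are one
  because \<open>b\<^sup>p\<close> is central, gives strong degeneracy.

  That \<open>\<theta>\<^sub>D\<close> is an isomorphism onto the Galois group follows from Artin's theorem once the fixed field
  of its image is the residue field of \<open>F\<close>. If \<open>x\<close> is fixed by the image of \<open>\<theta>\<^sub>D\<close> and \<open>a\<close> lifts \<open>x\<close>,
  then by Wedderburn the minimal polynomial of \<open>a\<close> over \<open>F\<close> is a product of factors \<open>X - w a w\<^sup>-\<^sup>1\<close>,
  which all reduce to \<open>X - x\<close>; thus a power of \<open>X - x\<close> has coefficients in the residue field of \<open>F\<close>,
  and separability puts \<open>x\<close> there.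
\<close>

section \<open>Cyclic decompositions of finite abelian p-groups\<close>

text \<open>The valuation is not assumed Henselian, so factorizations of polynomials cannot be
  lifted from the residue field. Wedderburn's factorization takes their place: its factors come from
  conjugates of a single lift, and conjugation is exactly what \<theta> sees. Strong degeneracy is
  phrased with a cyclic decomposition of the Galois group and representatives \<pi>_i, while the
  argument produces a single element b. A decomposition is therefore constructed, which is where the
  p-group hypothesis enters, and b is compared with a monomial \<pi>^m that has the same image under
  \<theta>. By injectivity of \<theta> the two differ by a factor from F and a unit. Characteristic
  p enters through additivity of the p-th power on commuting elements: in \<open>D\<close> for b and
  f, and in the residue field, where it shows that an x whose p-th power is fixed by the image of
  \<theta> is itself fixed.\<close>

context comm_group
begin

lemma foldr_mult_eq_finprod:
  assumes "distinct xs" "x \<in> set xs \<rightarrow> carrier G"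
  shows "foldr (\<lambda>i y. x i \<otimes> y) xs \<one> = finprod G x (set xs)"
  using assms by (induction xs) (auto simp: Pi_iff)

lemma ordered_prod_eq_finprod:
  assumes "x \<in> {1..r} \<rightarrow> carrier G"
  shows "ordered_prod G r x = finprod G x {1..r}"
proof -
  have "set [1..<Suc r] = {1..r}" by auto
  then show ?thesis
    unfolding ordered_prod_def using foldr_mult_eq_finprod[of "[1..<Suc r]" x] assms by simp
qed

lemma subgroup_finprod_closed:
  assumes "subgroup H G" "finite A" "\<And>j. j \<in> A \<Longrightarrow> f j \<in> H"
  shows "finprod G f A \<in> H"
  using assms(2,3)
proof (induction A)
  case empty
  then show ?case using subgroup.one_closed[OF assms(1)] by simp
next
  case (insert a A)
  have "f \<in> A \<rightarrow> carrier G" "f a \<in> carrier G"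
    using insert.prems subgroup.mem_carrier[OF assms(1)] by auto
  then show ?case
    using insert subgroup.m_closed[OF assms(1)] by simp
qed

lemma subgroup_nat_pow_closed:
  assumes "subgroup H G" "x \<in> H"
  shows "x [^] (n::nat) \<in> H"
proof (induction n)
  case 0
  then show ?case using subgroup.one_closed[OF assms(1)] by simp
next
  case (Suc n)
  then show ?case using subgroup.m_closed[OF assms(1)] assms(2) by simp
qed

lemma finprod_pow:
  assumes "f \<in> A \<rightarrow> carrier G" "finite A"
  shows "finprod G f A [^] (n::nat) = finprod G (\<lambda>j. f j [^] n) A"
  using assms(2,1)
  by (induction A) (auto simp: Pi_iff nat_pow_distrib)

text \<open>If u inverts c modulo the order of x, then x is the u-th power of
  \<open>x [^] c\<close>.\<close>

lemma pow_coprime_in_subgroup: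
  assumes H: "subgroup H G" and x: "x \<in> carrier G" and xc: "x [^] (c::nat) \<in> H"
    and co: "coprime c (ord x)"
  shows "x \<in> H"
proof -
  obtain u where u: "[c * u = 1] (mod ord x)"
    using cong_solve_coprime_nat[OF co] by auto
  have "x [^] (c * u) \<in> H"
    unfolding nat_pow_pow[OF x, symmetric] by (rule subgroup_nat_pow_closed[OF H xc])
  moreover have "x [^] (c * u) = x"
  \<comment> \<open>Zero is congruent to one only modulo one. Otherwise the natural subtraction in c
    * u - 1 is exact.\<close>
  proof (cases "c * u = 0")
    case True
    then have "ord x = 1" using u by (metis cong_def mod_0 mod_eq_0_iff_dvd nat_dvd_1_iff_1)
    then show ?thesis using ord_eq_1[OF x] by simp
  next
    case False
    then have "ord x dvd c * u - 1" using u mod_eq_dvd_iff_nat[of 1 "c * u" "ord x"] by (simp add: cong_def)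
    then have "x [^] (c * u - 1) = \<one>" using pow_eq_id[OF x] by blast
    moreover have "x [^] (c * u) = x [^] (c * u - 1) \<otimes> x"
      using nat_pow_Suc[of x "c * u - 1"] False by (metis Suc_pred' bot_nat_0.not_eq_extremum)
    ultimately show ?thesis using x by simp
  qed
  ultimately show ?thesis by simp
qed

text \<open>In a p-group all orders are powers of p, so an order that does not divide p^s exceeds
  it.\<close>

lemma pow_p_imp_ord_less:
  assumes p: "Factorial_Ring.prime p" and "order G = p ^ k" and fin: "finite (carrier G)"
    and x: "x \<in> carrier G" "x [^] (p ^ s) \<noteq> \<one>"
  shows "p ^ s < ord x"
proof -
  have "ord x dvd p ^ k" using ord_dvd_group_order[OF x(1)] assms(2) by simp
  then obtain t where t: "ord x = p ^ t" using p by (auto simp: divides_primepow_nat)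
  have "\<not> t \<le> s"
  proof
    assume "t \<le> s"
    then have "ord x dvd p ^ s" using t by (simp add: le_imp_power_dvd)
    then show False using x pow_eq_id by blast
  qed
  then show ?thesis using t prime_gt_1_nat[OF p] by simp
qed

text \<open>The size of a generating family is measured by the sum of the orders: a nontrivial relation
  allows one to replace a generator by one of smaller order.\<close>

lemma relation_imp_smaller_generators:
  fixes \<sigma> :: "nat \<Rightarrow> 'a"
  assumes p: "Factorial_Ring.prime p" and ord: "order G = p ^ k" and fin: "finite (carrier G)"
    and \<sigma>: "\<sigma> \<in> {1..r} \<rightarrow> carrier G" and gen: "generate G (\<sigma> ` {1..r}) = carrier G"
    and rel: "finprod G (\<lambda>j. \<sigma> j [^] (a j :: nat)) {1..r} = \<one>"
    and nt: "j0 \<in> {1..r}" "\<sigma> j0 [^] a j0 \<noteq> \<one>"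
  shows "\<exists>\<tau> \<in> {1..r} \<rightarrow> carrier G. generate G (\<tau> ` {1..r}) = carrier G \<and>
           (\<Sum>j\<in>{1..r}. local.ord (\<tau> j)) < (\<Sum>j\<in>{1..r}. local.ord (\<sigma> j))"
proof -
  have \<sigma>c: "\<And>j. j \<in> {1..r} \<Longrightarrow> \<sigma> j \<in> carrier G" using \<sigma> by auto
  \<comment> \<open>Trivial factors are dropped: their exponents are arbitrary, and an exponent zero
    would have multiplicity zero and spoil the minimum taken next.\<close>
  define B where "B = {j \<in> {1..r}. \<sigma> j [^] a j \<noteq> \<one>}"
  have B: "finite B" "B \<subseteq> {1..r}" "j0 \<in> B"
    using nt by (auto simp: B_def)
  \<comment> \<open>The exponent of least p-adic valuation: p^s then divides all exponents on
    \<open>B\<close>, and the cofactor \<open>c i\<close> is prime to p.\<close>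
  define i where "i = arg_min_on (\<lambda>j. multiplicity p (a j)) B"
  have i: "i \<in> B" "\<And>j. j \<in> B \<Longrightarrow> multiplicity p (a i) \<le> multiplicity p (a j)"
    unfolding i_def using B arg_min_if_finite(1)[of B] arg_min_least[of B] by fastforce+
  define s where "s = multiplicity p (a i)"
  define c where "c j = a j div p ^ s" for j
  have a_nz: "a j \<noteq> 0" if "j \<in> B" for j using that unfolding B_def by (auto intro: ccontr)
  have ac: "a j = c j * p ^ s" if "j \<in> B" for j
    using i(2)[OF that] a_nz[OF that] multiplicity_dvd'[of s p "a j"]
    unfolding c_def s_def by (simp add: multiplicity_dvd')
  have "\<not> p dvd c i"
    unfolding c_def s_def
    using multiplicity_decompose[of "a i" p] a_nz[OF i(1)] p by (simp add: prime_nat_iff)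
  then have cop: "coprime (c i) p" using p by (simp add: prime_imp_coprime coprime_commute)
  have iB: "i \<in> {1..r}" using i(1) B by auto
  have pc: "(\<lambda>j. \<sigma> j [^] c j) \<in> B \<rightarrow> carrier G" using \<sigma>c B by auto
  \<comment> \<open>The p^s-th power of t is the given relation, so t has order at most p^s, whereas
    the order of \<sigma>_i is larger. Since \<open>c i\<close> is prime to p, \<sigma>_i is
    recovered from t and the other generators, so t may replace it.\<close>
  define t where "t = finprod G (\<lambda>j. \<sigma> j [^] c j) B"
  have tc: "t \<in> carrier G" unfolding t_def using pc by (rule finprod_closed)
  have "t [^] (p ^ s) = finprod G (\<lambda>j. (\<sigma> j [^] c j) [^] (p ^ s)) B"
    unfolding t_def using pc B(1) by (rule finprod_pow)
  also have "\<dots> = finprod G (\<lambda>j. \<sigma> j [^] a j) B"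
    by (rule finprod_cong') (use ac \<sigma>c B in \<open>auto simp: nat_pow_pow\<close>)
  also have "\<dots> = finprod G (\<lambda>j. \<sigma> j [^] a j) {1..r}"
    by (rule finprod_mono_neutral_cong_left) (use \<sigma>c B in \<open>auto simp: B_def\<close>)
  finally have "t [^] (p ^ s) = \<one>" using rel by simp
  then have "local.ord t dvd p ^ s" using pow_eq_id[OF tc] by blast
  then have t_le: "local.ord t \<le> p ^ s"
    using prime_gt_0_nat[OF p] by (intro dvd_imp_le) auto
  have "\<sigma> i [^] a i = (\<sigma> i [^] (p ^ s)) [^] c i"
    using ac[OF i(1)] \<sigma>c[OF iB] by (simp add: nat_pow_pow mult.commute)
  then have "\<sigma> i [^] (p ^ s) \<noteq> \<one>" using i(1) unfolding B_def by auto
  then have less: "local.ord t < local.ord (\<sigma> i)"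
    using pow_p_imp_ord_less[OF p ord fin \<sigma>c[OF iB]] t_le by force
  define \<tau> where "\<tau> = \<sigma>(i := t)"
  have \<tau>: "\<tau> \<in> {1..r} \<rightarrow> carrier G" unfolding \<tau>_def using \<sigma> tc by auto
  define S where "S = generate G (\<tau> ` {1..r})"
  have S: "subgroup S G" unfolding S_def using \<tau> by (intro generate_is_subgroup) auto
  have \<tau>S: "\<tau> j \<in> S" if "j \<in> {1..r}" for j unfolding S_def using that by (auto intro: generate.incl)
  have \<sigma>S: "\<sigma> j \<in> S" if "j \<in> {1..r}" "j \<noteq> i" for j
    using \<tau>S[OF that(1)] that unfolding \<tau>_def by simp
  define q where "q = finprod G (\<lambda>j. \<sigma> j [^] c j) (B - {i})"
  have qS: "q \<in> S" unfolding q_def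
    by (rule subgroup_finprod_closed[OF S])
      (use B \<sigma>S subgroup_nat_pow_closed[OF S] in \<open>auto simp: subset_iff\<close>)
  then have qc: "q \<in> carrier G" using subgroup.mem_carrier[OF S] by simp
  have "t = \<sigma> i [^] c i \<otimes> q"
  proof -
    have "B = insert i (B - {i})" using i(1) by auto
    then show ?thesis unfolding t_def q_def
      using finprod_insert[of "B - {i}" i "\<lambda>j. \<sigma> j [^] c j"] B(1) pc \<sigma>c[OF iB] by auto
  qed
  then have "\<sigma> i [^] c i = t \<otimes> inv q" using qc \<sigma>c[OF iB] tc by (simp add: m_assoc)
  moreover have "t \<in> S" using \<tau>S[OF iB] unfolding \<tau>_def by simp
  ultimately have "\<sigma> i [^] c i \<in> S"
    using qS subgroup.m_closed[OF S] subgroup.m_inv_closed[OF S] by simp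
  moreover have "coprime (c i) (local.ord (\<sigma> i))"
  proof -
    have "local.ord (\<sigma> i) dvd p ^ k" using ord_dvd_group_order[OF \<sigma>c[OF iB]] ord by simp
    moreover have "coprime (c i) (p ^ k)" using cop by simp
    ultimately show ?thesis using coprime_divisors dvd_refl by blast
  qed
  ultimately have "\<sigma> i \<in> S" using pow_coprime_in_subgroup[OF S \<sigma>c[OF iB]] by blast
  then have "\<sigma> ` {1..r} \<subseteq> S" using \<sigma>S by blast
  then have "carrier G \<subseteq> S" using generate_subgroup_incl[OF _ S] gen by blast
  then have "S = carrier G" using subgroup.subset[OF S] by auto
  moreover have "(\<Sum>j\<in>{1..r}. local.ord (\<tau> j)) < (\<Sum>j\<in>{1..r}. local.ord (\<sigma> j))"
    by (rule sum_strict_mono_ex1) (use less iB in \<open>auto simp: \<tau>_def\<close>)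
  ultimately show ?thesis using \<tau> unfolding S_def by blast
qed

lemma cyclic_decomposition_exists:
  assumes p: "Factorial_Ring.prime p" and ord: "order G = p ^ k" and fin: "finite (carrier G)"
  shows "\<exists>r \<sigma>. cyclic_decomposition G r \<sigma>"
proof -
  define r where "r = card (carrier G)"
  define gens where "gens \<tau> \<longleftrightarrow> \<tau> \<in> {1..r} \<rightarrow> carrier G \<and> generate G (\<tau> ` {1..r}) = carrier G" for \<tau>
  obtain \<sigma>0 where "bij_betw \<sigma>0 {1..r} (carrier G)"
    using ex_bij_betw_nat_finite_1[OF fin] unfolding r_def by auto
  then have \<sigma>0: "\<sigma>0 ` {1..r} = carrier G" by (auto simp: bij_betw_def)
  have "generate G (carrier G) = carrier G"
    using generate_incl[of "carrier G"] generate.incl[of _ "carrier G" G] by auto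
  then have "gens \<sigma>0" unfolding gens_def \<sigma>0 using \<sigma>0 by auto
  then obtain \<sigma> where \<sigma>: "gens \<sigma>"
    and min: "\<And>\<tau>. gens \<tau> \<Longrightarrow> (\<Sum>j\<in>{1..r}. local.ord (\<sigma> j)) \<le> (\<Sum>j\<in>{1..r}. local.ord (\<tau> j))"
    using ex_has_least_nat[of gens \<sigma>0 "\<lambda>\<tau>. \<Sum>j\<in>{1..r}. local.ord (\<tau> j)"] by blast
  have \<sigma>c: "\<And>j. j \<in> {1..r} \<Longrightarrow> \<sigma> j \<in> carrier G" using \<sigma> unfolding gens_def by auto
  let ?C = "\<lambda>i. subgroup_generated G {\<sigma> i}"
  have Cc: "carrier (?C i) = {\<sigma> i [^] m |m. m \<in> (UNIV::nat set)}" if "i \<in> {1..r}" for i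
    using generate_pow_on_finite_carrier[OF fin \<sigma>c[OF that]] \<sigma>c[OF that]
    by (simp add: carrier_subgroup_generated)
  have Cs: "carrier (?C i) \<subseteq> carrier G" for i by (rule carrier_subgroup_generated_subset)
  let ?P = "product_group {1..r} ?C"
  have gP: "group ?P" by (rule product_group) simp
  have op: "ordered_prod G r x = finprod G x {1..r}" "x \<in> {1..r} \<rightarrow> carrier G"
    if "x \<in> carrier ?P" for x
  proof -
    show "x \<in> {1..r} \<rightarrow> carrier G" using that Cs by auto
    then show "ordered_prod G r x = finprod G x {1..r}" by (rule ordered_prod_eq_finprod)
  qed
  have hom: "ordered_prod G r \<in> hom ?P G"
  proof (rule homI)
    fix x y assume xy: "x \<in> carrier ?P" "y \<in> carrier ?P"
    have "x \<otimes>\<^bsub>?P\<^esub> y \<in> carrier ?P" using group.is_monoid[OF gP] xy by (rule monoid.m_closed)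
    then have "ordered_prod G r (x \<otimes>\<^bsub>?P\<^esub> y) = finprod G (x \<otimes>\<^bsub>?P\<^esub> y) {1..r}" by (rule op)
    also have "\<dots> = finprod G (\<lambda>i. x i \<otimes> y i) {1..r}"
      by (rule finprod_cong') (use op(2)[OF xy(1)] op(2)[OF xy(2)] in auto)
    also have "\<dots> = ordered_prod G r x \<otimes> ordered_prod G r y"
      using op xy by (simp add: finprod_multf)
    finally show "ordered_prod G r (x \<otimes>\<^bsub>?P\<^esub> y) = ordered_prod G r x \<otimes> ordered_prod G r y" .
  qed (use op finprod_closed in auto)
  then interpret h: group_hom ?P G "ordered_prod G r"
    using gP is_group by (simp add: group_hom_def group_hom_axioms_def)
  have "x = \<one>\<^bsub>?P\<^esub>" if x: "x \<in> carrier ?P" "ordered_prod G r x = \<one>" for x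
  proof -
    have "\<forall>i\<in>{1..r}. \<exists>m::nat. x i = \<sigma> i [^] m" using x(1) Cc by fastforce
    then obtain a :: "nat \<Rightarrow> nat" where a: "\<And>i. i \<in> {1..r} \<Longrightarrow> x i = \<sigma> i [^] a i" by metis
    have "finprod G (\<lambda>i. \<sigma> i [^] a i) {1..r} = finprod G x {1..r}"
      by (rule finprod_cong') (use a op(2)[OF x(1)] in auto)
    also have "\<dots> = \<one>" using op(1)[OF x(1)] x(2) by simp
    finally have rel: "finprod G (\<lambda>i. \<sigma> i [^] a i) {1..r} = \<one>" .
    have "\<sigma> i [^] a i = \<one>" if i: "i \<in> {1..r}" for i
    proof (rule ccontr)
      assume "\<sigma> i [^] a i \<noteq> \<one>"
      from relation_imp_smaller_generators[OF p ord fin _ _ rel i this] \<sigma>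
      obtain \<tau> where "gens \<tau>" "(\<Sum>j\<in>{1..r}. local.ord (\<tau> j)) < (\<Sum>j\<in>{1..r}. local.ord (\<sigma> j))"
        unfolding gens_def by blast
      then show False using min[of \<tau>] by simp
    qed
    then show ?thesis using x(1) a by (intro ext) (auto simp: PiE_def extensional_def)
  qed
  then have inj: "inj_on (ordered_prod G r) (carrier ?P)"
    by (subst h.inj_on_one_iff) auto
  have sub: "subgroup (ordered_prod G r ` carrier ?P) G" by (rule h.img_is_subgroup)
  have "\<sigma> i \<in> ordered_prod G r ` carrier ?P" if i: "i \<in> {1..r}" for i
  proof -
    define x where "x = (\<lambda>j\<in>{1..r}. if j = i then \<sigma> i else \<one>)"
    have "x \<in> carrier ?P"
      unfolding x_def using i \<sigma>c[OF i] group.is_monoid[OF group_subgroup_generated]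
      by (auto simp: carrier_subgroup_generated intro: generate.incl generate.one)
    moreover have "finprod G x {1..r} = finprod G (\<lambda>j. if i = j then \<sigma> j else \<one>) {1..r}"
      by (rule finprod_cong') (use \<sigma>c in \<open>auto simp: x_def\<close>)
    moreover have "\<dots> = \<sigma> i" using i \<sigma>c by (intro finprod_singleton) auto
    ultimately show ?thesis using op(1)[of x] by (metis imageI)
  qed
  then have "carrier G \<subseteq> ordered_prod G r ` carrier ?P"
    using generate_subgroup_incl[OF _ sub, of "\<sigma> ` {1..r}"] \<sigma> unfolding gens_def by blast
  then have "ordered_prod G r ` carrier ?P = carrier G" using subgroup.subset[OF sub] by blast
  then have "ordered_prod G r \<in> iso ?P G" using hom inj by (simp add: iso_def bij_betw_def)
  then show ?thesis unfolding cyclic_decomposition_def using \<sigma>c by blast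
qed

end

section \<open>Independence of automorphisms, Artin's theorem and Hilbert 90\<close>

context field
begin

text \<open>To eliminate the index k, the relation at \<open>y \<otimes> x\<close> is compared with
  \<open>\<phi> k y\<close> times the relation at x. The difference has no k-th term and
  coefficients \<open>c i \<otimes> (\<phi> i y \<ominus> \<phi> k y)\<close>, so the induction
  hypothesis applies; a y that separates i from k then gives \<open>c i = \<zero>\<close>.\<close>

lemma dedekind_independence:
  assumes "finite I" "\<And>i. i \<in> I \<Longrightarrow> \<phi> i \<in> ring_hom R R"
    and "\<And>i j. \<lbrakk>i \<in> I; j \<in> I; i \<noteq> j\<rbrakk> \<Longrightarrow> \<exists>x\<in>carrier R. \<phi> i x \<noteq> \<phi> j x"
    and "c \<in> I \<rightarrow> carrier R" "\<And>x. x \<in> carrier R \<Longrightarrow> (\<Oplus>i\<in>I. c i \<otimes> \<phi> i x) = \<zero>"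
  shows "\<forall>i\<in>I. c i = \<zero>"
  using assms
proof (induction I arbitrary: c rule: finite_induct)
  case (insert k I)
  note hom = insert.prems(1) and dist = insert.prems(2) and rel = insert.prems(4)
  have c: "\<And>i. i \<in> insert k I \<Longrightarrow> c i \<in> carrier R" using insert.prems(3) by auto
  have \<phi>c: "\<And>i x. \<lbrakk>i \<in> insert k I; x \<in> carrier R\<rbrakk> \<Longrightarrow> \<phi> i x \<in> carrier R"
    using hom ring_hom_closed by metis
  have split: "(\<Oplus>i\<in>insert k I. c i \<otimes> \<phi> i x) = c k \<otimes> \<phi> k x \<oplus> (\<Oplus>i\<in>I. c i \<otimes> \<phi> i x)"
    if "x \<in> carrier R" for x
    using insert.hyps c \<phi>c that by (intro finsum_insert) auto
  have cI: "c i \<otimes> (\<phi> i y \<ominus> \<phi> k y) = \<zero>" if i: "i \<in> I" and y: "y \<in> carrier R" for i y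
  proof -
    have "\<forall>i\<in>I. c i \<otimes> (\<phi> i y \<ominus> \<phi> k y) = \<zero>"
    proof (rule insert.IH)
      show "(\<lambda>i. c i \<otimes> (\<phi> i y \<ominus> \<phi> k y)) \<in> I \<rightarrow> carrier R" using c \<phi>c y by auto
      fix x assume x: "x \<in> carrier R"
      have "(\<Oplus>i\<in>I. c i \<otimes> (\<phi> i y \<ominus> \<phi> k y) \<otimes> \<phi> i x) =
            (\<Oplus>i\<in>I. c i \<otimes> \<phi> i (y \<otimes> x) \<oplus> (\<ominus> \<phi> k y) \<otimes> (c i \<otimes> \<phi> i x))"
      proof (rule finsum_cong')
        fix i assume i: "i \<in> I"
        have "\<phi> i (y \<otimes> x) = \<phi> i y \<otimes> \<phi> i x" using hom[of i] i x y by (simp add: ring_hom_mult)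
        then show "c i \<otimes> (\<phi> i y \<ominus> \<phi> k y) \<otimes> \<phi> i x =
            c i \<otimes> \<phi> i (y \<otimes> x) \<oplus> (\<ominus> \<phi> k y) \<otimes> (c i \<otimes> \<phi> i x)"
          using c[of i] \<phi>c[of i y] \<phi>c[of i x] \<phi>c[of k y] i x y by (simp, algebra)
      qed (use c \<phi>c x y in auto)
      also have "\<dots> = (\<Oplus>i\<in>I. c i \<otimes> \<phi> i (y \<otimes> x)) \<oplus> (\<ominus> \<phi> k y) \<otimes> (\<Oplus>i\<in>I. c i \<otimes> \<phi> i x)"
        using c \<phi>c x y insert.hyps(1) by (subst finsum_addf) (auto simp: finsum_rdistr)
      also have "\<dots> = \<zero>"
      proof -
        define A where "A = (\<Oplus>i\<in>I. c i \<otimes> \<phi> i (y \<otimes> x))"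
        define B where "B = (\<Oplus>i\<in>I. c i \<otimes> \<phi> i x)"
        have cl: "A \<in> carrier R" "B \<in> carrier R" "c k \<in> carrier R" "\<phi> k y \<in> carrier R" "\<phi> k x \<in> carrier R"
          unfolding A_def B_def using c \<phi>c x y by (auto intro!: finsum_closed)
        have "\<phi> k (y \<otimes> x) = \<phi> k y \<otimes> \<phi> k x" using hom[of k] x y by (simp add: ring_hom_mult)
        then have "c k \<otimes> (\<phi> k y \<otimes> \<phi> k x) \<oplus> A = \<zero>"
          using rel[of "y \<otimes> x"] split[of "y \<otimes> x"] x y unfolding A_def by simp
        moreover have "c k \<otimes> \<phi> k x \<oplus> B = \<zero>" using rel[OF x] split[OF x] unfolding B_def by simp
        ultimately have "A = \<ominus> (c k \<otimes> (\<phi> k y \<otimes> \<phi> k x))" "B = \<ominus> (c k \<otimes> \<phi> k x)"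
          using cl by (metis add.m_closed m_closed minus_equality a_comm)+
        then show ?thesis unfolding A_def[symmetric] B_def[symmetric] using cl by (simp, algebra)
      qed
      finally show "(\<Oplus>i\<in>I. c i \<otimes> (\<phi> i y \<ominus> \<phi> k y) \<otimes> \<phi> i x) = \<zero>" .
    qed (use hom dist in auto)
    then show ?thesis using i by blast
  qed
  have c0: "c i = \<zero>" if i: "i \<in> I" for i
  proof -
    obtain y where y: "y \<in> carrier R" "\<phi> i y \<noteq> \<phi> k y" using dist[of i k] i insert.hyps by blast
    then have "\<phi> i y \<ominus> \<phi> k y \<noteq> \<zero>" using \<phi>c[of i y] \<phi>c[of k y] i by (simp add: r_right_minus_eq)
    then show ?thesis using cI[OF i y(1)] c[of i] \<phi>c[of i y] \<phi>c[of k y] i y integral_iff by simp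
  qed
  have "(\<Oplus>i\<in>I. c i \<otimes> \<phi> i \<one>) = \<zero>"
    using c0 \<phi>c by (intro add.finprod_one_eqI) auto
  then have "c k \<otimes> \<phi> k \<one> = \<zero>" using rel[of \<one>] split[of \<one>] c[of k] \<phi>c[of k \<one>] by simp
  moreover have "\<phi> k \<one> = \<one>" using hom[of k] by (simp add: ring_hom_one)
  ultimately have "c k = \<zero>" using c[of k] by simp
  then show ?case using c0 by blast
qed simp

text \<open>Gaussian elimination by induction on the equations: a nonzero entry of the new row is
  the pivot and removes one unknown together with one equation.\<close>

lemma homogeneous_system_nontrivial_solution:
  assumes "finite I" "finite J" "card I < card J" "\<And>i j. \<lbrakk>i \<in> I; j \<in> J\<rbrakk> \<Longrightarrow> a i j \<in> carrier R"
  shows "\<exists>z\<in>J \<rightarrow> carrier R. (\<exists>j\<in>J. z j \<noteq> \<zero>) \<and> (\<forall>i\<in>I. (\<Oplus>j\<in>J. a i j \<otimes> z j) = \<zero>)"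
  using assms
proof (induction I arbitrary: J a rule: finite_induct)
  case empty
  then have "J \<noteq> {}" by auto
  then show ?case by (intro bexI[of _ "\<lambda>_. \<one>"]) auto
next
  case (insert k I)
  note a = insert.prems(3)
  show ?case
  proof (cases "\<forall>j\<in>J. a k j = \<zero>")
    case True
    obtain z where z: "z \<in> J \<rightarrow> carrier R" "\<exists>j\<in>J. z j \<noteq> \<zero>" "\<forall>i\<in>I. (\<Oplus>j\<in>J. a i j \<otimes> z j) = \<zero>"
      using insert.IH[of J a] insert.prems insert.hyps by auto
    have "(\<Oplus>j\<in>J. a k j \<otimes> z j) = \<zero>" using True z(1) by (intro add.finprod_one_eqI) (auto simp: Pi_iff)
    then show ?thesis using z by blast
  next
    case False
    then obtain l where l: "l \<in> J" "a k l \<noteq> \<zero>" by blast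
    have u: "a k l \<in> Units R" using l a by (simp add: field_Units)
    define q where "q = inv (a k l)"
    have q: "q \<in> carrier R" "q \<otimes> a k l = \<one>" "a k l \<in> carrier R" using u unfolding q_def by auto
    define J' where "J' = J - {l}"
    have J': "finite J'" "l \<notin> J'" "J = insert l J'" "card J = Suc (card J')"
      using insert.prems(1) l card_Suc_Diff1[of J l] unfolding J'_def by auto
    \<comment> \<open>Row i after subtracting the multiple of row k that clears column l;
      \<open>q\<close> is the inverse of the pivot.\<close>
    define b where "b i j = a i j \<ominus> a i l \<otimes> q \<otimes> a k j" for i j
    obtain z where z: "z \<in> J' \<rightarrow> carrier R" "\<exists>j\<in>J'. z j \<noteq> \<zero>" "\<forall>i\<in>I. (\<Oplus>j\<in>J'. b i j \<otimes> z j) = \<zero>"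
    proof -
      have "b i j \<in> carrier R" if "i \<in> I" "j \<in> J'" for i j
        unfolding b_def using a[of i j] a[of i l] a[of k j] that J'(3) q(1) by simp
      moreover have "card I < card J'" using insert.prems(2) insert.hyps J'(4) by simp
      ultimately show ?thesis using insert.IH[of J' b] J'(1) that by blast
    qed
    define S where "S = (\<Oplus>j\<in>J'. a k j \<otimes> z j)"
    have S: "S \<in> carrier R" unfolding S_def using a z(1) J' by (auto intro!: finsum_closed)
    \<comment> \<open>The eliminated unknown receives the value that solves row k.\<close>
    define y where "y = z(l := \<ominus> (q \<otimes> S))"
    have y: "y \<in> J \<rightarrow> carrier R" using z(1) q S J' unfolding y_def by auto
    have sum_y: "(\<Oplus>j\<in>J. a i j \<otimes> y j) = a i l \<otimes> (\<ominus> (q \<otimes> S)) \<oplus> (\<Oplus>j\<in>J'. a i j \<otimes> z j)"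
      if i: "i \<in> insert k I" for i
    proof -
      have "(\<Oplus>j\<in>insert l J'. a i j \<otimes> y j) = a i l \<otimes> y l \<oplus> (\<Oplus>j\<in>J'. a i j \<otimes> y j)"
        using J' a i y by (intro finsum_insert) auto
      moreover have "(\<Oplus>j\<in>J'. a i j \<otimes> y j) = (\<Oplus>j\<in>J'. a i j \<otimes> z j)"
        using J' a i z unfolding y_def by (intro finsum_cong') auto
      ultimately show ?thesis using J' unfolding y_def by simp
    qed
    have "(\<Oplus>j\<in>J. a i j \<otimes> y j) = \<zero>" if i: "i \<in> insert k I" for i
    proof (cases "i = k")
      case True
      have "a k l \<otimes> (\<ominus> (q \<otimes> S)) \<oplus> S = \<ominus> ((q \<otimes> a k l) \<otimes> S) \<oplus> S"
        using q(1,3) S by algebra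
      also have "\<dots> = \<zero>" unfolding q(2) using S by (simp add: l_neg)
      finally show ?thesis using sum_y[OF i] True unfolding S_def by simp
    next
      case False
      then have iI: "i \<in> I" using i by simp
      have cl: "\<And>j. j \<in> J' \<Longrightarrow> a i j \<in> carrier R" "\<And>j. j \<in> J' \<Longrightarrow> a k j \<in> carrier R"
          "\<And>j. j \<in> J' \<Longrightarrow> z j \<in> carrier R" "a i l \<in> carrier R"
        using a iI J'(3) z(1) by auto
      have "\<zero> = (\<Oplus>j\<in>J'. b i j \<otimes> z j)" using z(3) iI by simp
      also have "\<dots> = (\<Oplus>j\<in>J'. a i j \<otimes> z j \<oplus> (\<ominus> (a i l \<otimes> q)) \<otimes> (a k j \<otimes> z j))"
      proof (rule finsum_cong')
        fix j assume j: "j \<in> J'"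
        have "a i j \<in> carrier R" "a i l \<in> carrier R" "a k j \<in> carrier R" "z j \<in> carrier R"
          using cl j by auto
        then show "b i j \<otimes> z j = a i j \<otimes> z j \<oplus> (\<ominus> (a i l \<otimes> q)) \<otimes> (a k j \<otimes> z j)"
          unfolding b_def using q(1) by algebra
      qed (use cl q(1) in auto)
      also have "\<dots> = (\<Oplus>j\<in>J'. a i j \<otimes> z j) \<oplus> (\<ominus> (a i l \<otimes> q)) \<otimes> S"
      proof -
        have "(\<Oplus>j\<in>J'. (\<ominus> (a i l \<otimes> q)) \<otimes> (a k j \<otimes> z j)) = (\<ominus> (a i l \<otimes> q)) \<otimes> S"
          unfolding S_def using J'(1) cl q(1) by (intro finsum_rdistr[symmetric]) auto
        then show ?thesis using cl q(1) by (subst finsum_addf) auto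
      qed
      also have "\<dots> = a i l \<otimes> (\<ominus> (q \<otimes> S)) \<oplus> (\<Oplus>j\<in>J'. a i j \<otimes> z j)"
      proof -
        have "T \<oplus> (\<ominus> (a i l \<otimes> q)) \<otimes> S = a i l \<otimes> (\<ominus> (q \<otimes> S)) \<oplus> T" if "T \<in> carrier R" for T
          using that cl(4) q(1) S by algebra
        then show ?thesis using cl by (auto intro!: finsum_closed)
      qed
      finally show ?thesis using sum_y[OF i] by simp
    qed
    moreover have "\<exists>j\<in>J. y j \<noteq> \<zero>" using z(2) J' unfolding y_def by auto
    ultimately show ?thesis using y by blast
  qed
qed

lemma finsum_swap:
  assumes "finite A" "finite B" "\<And>a b. \<lbrakk>a \<in> A; b \<in> B\<rbrakk> \<Longrightarrow> f a b \<in> carrier R"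
  shows "(\<Oplus>a\<in>A. \<Oplus>b\<in>B. f a b) = (\<Oplus>b\<in>B. \<Oplus>a\<in>A. f a b)"
  using assms(1,3)
proof (induction A)
  case empty
  have "(\<Oplus>b\<in>B. \<zero>) = \<zero>" by (intro add.finprod_one_eqI) auto
  then show ?case by simp
next
  case (insert x A)
  have "(\<Oplus>a\<in>insert x A. \<Oplus>b\<in>B. f a b) = (\<Oplus>b\<in>B. f x b) \<oplus> (\<Oplus>b\<in>B. \<Oplus>a\<in>A. f a b)"
    using insert by (subst finsum_insert) (auto intro!: finsum_closed)
  also have "\<dots> = (\<Oplus>b\<in>B. f x b \<oplus> (\<Oplus>a\<in>A. f a b))"
    using insert.prems by (intro finsum_addf[symmetric]) (auto intro!: finsum_closed)
  also have "\<dots> = (\<Oplus>b\<in>B. \<Oplus>a\<in>insert x A. f a b)"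
    using insert by (intro finsum_cong' refl finsum_insert[symmetric]) (auto intro!: finsum_closed)
  finally show ?case .
qed

lemma combine_map_eq_finsum:
  assumes "distinct Us" "set Us \<subseteq> carrier R" "c \<in> set Us \<rightarrow> carrier R"
  shows "combine (map c Us) Us = (\<Oplus>u\<in>set Us. c u \<otimes> u)"
  using assms
proof (induction Us)
  case (Cons u Us)
  then show ?case by (subst list.set, subst finsum_insert) (auto simp: Pi_iff)
qed simp

end

text \<open>Members are extensional, like the elements of \<open>galois_group\<close>, so that two
  different members differ at a point of the carrier. Accordingly the identity is
  \<open>restrict id\<close> and the product is \<open>compose\<close>.\<close>

locale automorphism_group = field R for R (structure) +
  fixes H :: "('a \<Rightarrow> 'a) set"
  assumes finite_H: "finite H"
    and hom_H: "h \<in> H \<Longrightarrow> h \<in> ring_hom R R"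
    and ext_H: "h \<in> H \<Longrightarrow> h \<in> extensional (carrier R)"
    and id_H: "restrict id (carrier R) \<in> H"
    and comp_H: "\<lbrakk>g \<in> H; h \<in> H\<rbrakk> \<Longrightarrow> compose (carrier R) g h \<in> H"
    and inv_H: "h \<in> H \<Longrightarrow> \<exists>g\<in>H. (\<forall>x\<in>carrier R. g (h x) = x) \<and> (\<forall>x\<in>carrier R. h (g x) = x)"
begin

definition trace :: "'a \<Rightarrow> 'a" where
  "trace x = (\<Oplus>h\<in>H. h x)"

lemma H_closed: "\<lbrakk>h \<in> H; x \<in> carrier R\<rbrakk> \<Longrightarrow> h x \<in> carrier R"
  using hom_H ring_hom_closed by metis

lemma trace_closed: "x \<in> carrier R \<Longrightarrow> trace x \<in> carrier R"
  unfolding trace_def using H_closed by (auto intro!: finsum_closed)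

lemma hom_finsum:
  assumes "\<tau> \<in> ring_hom R R" "finite A" "f \<in> A \<rightarrow> carrier R"
  shows "\<tau> (\<Oplus>i\<in>A. f i) = (\<Oplus>i\<in>A. \<tau> (f i))"
proof -
  interpret t: ring_hom_cring R R \<tau>
    using assms(1) is_cring by (simp add: ring_hom_cring_def ring_hom_cring_axioms_def)
  show ?thesis using t.hom_finsum[OF assms(3)] by (simp add: comp_def)
qed

lemma bij_compose: "g \<in> H \<Longrightarrow> bij_betw (compose (carrier R) g) H H"
proof -
  assume g: "g \<in> H"
  obtain g' where g': "g' \<in> H" "\<forall>x\<in>carrier R. g' (g x) = x" "\<forall>x\<in>carrier R. g (g' x) = x"
    using inv_H[OF g] by blast
  show ?thesis
  proof (rule bij_betw_byWitness[of _ "compose (carrier R) g'"])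
    show "\<forall>a\<in>H. compose (carrier R) g' (compose (carrier R) g a) = a"
      "\<forall>a\<in>H. compose (carrier R) g (compose (carrier R) g' a) = a"
      using g' H_closed ext_H
      by (auto intro!: extensionalityI[of _ "carrier R"] simp: compose_eq compose_extensional)
  qed (use comp_H g g' in auto)
qed

lemma trace_fixed:
  assumes "g \<in> H" "x \<in> carrier R"
  shows "g (trace x) = trace x"
proof -
  have "g (trace x) = (\<Oplus>h\<in>H. g (h x))"
    unfolding trace_def using assms H_closed finite_H hom_H by (intro hom_finsum) auto
  also have "\<dots> = (\<Oplus>h\<in>H. compose (carrier R) g h x)"
    using assms H_closed by (intro finsum_cong') (auto simp: compose_eq)
  also have "\<dots> = (\<Oplus>h\<in>compose (carrier R) g ` H. h x)"
    using bij_compose[OF assms(1)] assms H_closed comp_H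
    by (subst add.finprod_reindex) (auto simp: bij_betw_def)
  also have "\<dots> = trace x" using bij_compose[OF assms(1)] unfolding trace_def bij_betw_def by simp
  finally show ?thesis .
qed

lemma H_distinct: "\<lbrakk>g \<in> H; h \<in> H; g \<noteq> h\<rbrakk> \<Longrightarrow> \<exists>x\<in>carrier R. g x \<noteq> h x"
  using ext_H extensionalityI by metis

text \<open>Dedekind independence with all coefficients equal to one.\<close>

lemma trace_nonzero: "\<exists>x\<in>carrier R. trace x \<noteq> \<zero>"
proof (rule ccontr)
  assume neg: "\<not> ?thesis"
  have "(\<Oplus>h\<in>H. \<one> \<otimes> h x) = \<zero>" if x: "x \<in> carrier R" for x
  proof -
    have "(\<Oplus>h\<in>H. \<one> \<otimes> h x) = trace x"
      unfolding trace_def using H_closed x by (intro finsum_cong') auto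
    then show ?thesis using neg x by auto
  qed
  then have "\<forall>h\<in>H. \<one> = \<zero>"
    using finite_H hom_H H_distinct
    by (intro dedekind_independence[of H "\<lambda>h. h" "\<lambda>_. \<one>"]) auto
  then show False using id_H by auto
qed

text \<open>One half of Artin's theorem. For more than |H| elements u, the |H| equations "sum over u
  of h(u) z_u = 0" have a nontrivial solution. Summing its images over H turns it into a relation
  among the u themselves whose coefficients are traces, hence lie in K; independence fails once one
  of these traces is nonzero.\<close>

lemma independent_length_le_card:
  assumes K: "subfield K R" and fix_K: "\<And>x. \<lbrakk>x \<in> carrier R; \<And>h. h \<in> H \<Longrightarrow> h x = x\<rbrakk> \<Longrightarrow> x \<in> K"
    and ind: "independent K Us"
  shows "length Us \<le> card H"
proof (rule ccontr)
  assume "\<not> ?thesis"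
  moreover have dist: "distinct Us" using independent_distinct[OF K ind] .
  ultimately have card: "card H < card (set Us)" by (simp add: distinct_card)
  have Us: "set Us \<subseteq> carrier R" using independent_in_carrier[OF ind] .
  have "\<And>h u. \<lbrakk>h \<in> H; u \<in> set Us\<rbrakk> \<Longrightarrow> h u \<in> carrier R" using Us H_closed by blast
  then obtain z where z1: "z \<in> set Us \<rightarrow> carrier R"
    and z2: "(\<exists>u\<in>set Us. z u \<noteq> \<zero>) \<and> (\<forall>h\<in>H. (\<Oplus>u\<in>set Us. h u \<otimes> z u) = \<zero>)"
    by (rule bexE[OF homogeneous_system_nontrivial_solution[OF finite_H finite_set card]])
  note z = z1 conjunct1[OF z2] conjunct2[OF z2]
  obtain u0 where u0: "u0 \<in> set Us" "z u0 \<noteq> \<zero>" using z(2) by blast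
  obtain x0 where x0: "x0 \<in> carrier R" "trace x0 \<noteq> \<zero>" using trace_nonzero by blast
  have "z u0 \<in> Units R" using u0 z(1) by (auto simp: field_Units)
  \<comment> \<open>Scaling by q makes the coordinate at \<open>u0\<close> equal to
    \<open>x0\<close>, whose trace is nonzero.\<close>
  define q where "q = inv (z u0) \<otimes> x0"
  have q: "q \<in> carrier R" "z u0 \<otimes> q = x0"
    using \<open>z u0 \<in> Units R\<close> x0(1) m_assoc[of "z u0" "inv (z u0)" x0] unfolding q_def
    by (simp_all add: Units_closed)
  define y where "y u = z u \<otimes> q" for u
  have y: "y \<in> set Us \<rightarrow> carrier R" using z(1) q unfolding y_def by auto
  have rel: "(\<Oplus>u\<in>set Us. g (y u) \<otimes> u) = \<zero>" if g: "g \<in> H" for g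
  proof -
    \<comment> \<open>With h inverse to g, applying g to the equation belonging to h frees u and
      leaves g on the coefficient.\<close>
    obtain h where h: "h \<in> H" "\<forall>x\<in>carrier R. g (h x) = x" using inv_H[OF g] by blast
    have "(\<Oplus>u\<in>set Us. h u \<otimes> y u) = (\<Oplus>u\<in>set Us. h u \<otimes> z u) \<otimes> q"
      unfolding y_def using Us z(1) q H_closed[OF h(1)]
      by (subst finsum_ldistr) (auto simp: m_assoc subset_iff Pi_iff intro!: finsum_cong')
    also have "\<dots> = \<zero>" using z(3) h(1) q by simp
    finally have "g (\<Oplus>u\<in>set Us. h u \<otimes> y u) = \<zero>"
      using hom_H[OF g] ring_hom_zero[of g R R] ring_axioms by simp
    moreover have "g (\<Oplus>u\<in>set Us. h u \<otimes> y u) = (\<Oplus>u\<in>set Us. g (h u \<otimes> y u))"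
      using Us y H_closed[OF h(1)] by (intro hom_finsum hom_H[OF g]) (auto simp: Pi_iff subset_iff)
    moreover have "\<dots> = (\<Oplus>u\<in>set Us. g (y u) \<otimes> u)"
    proof (rule finsum_cong')
      fix u assume u: "u \<in> set Us"
      have "g (h u \<otimes> y u) = g (h u) \<otimes> g (y u)"
        using u Us y H_closed[OF h(1)] by (auto simp: Pi_iff subset_iff intro!: ring_hom_mult[OF hom_H[OF g]])
      then show "g (h u \<otimes> y u) = g (y u) \<otimes> u"
        using u Us y H_closed[OF g] h(2) by (auto simp: m_comm Pi_iff subset_iff)
    qed (use Us y H_closed[OF g] in \<open>auto simp: Pi_iff subset_iff\<close>)
    ultimately show ?thesis by simp
  qed
  have "\<zero> = (\<Oplus>g\<in>H. \<Oplus>u\<in>set Us. g (y u) \<otimes> u)"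
    using rel by (intro add.finprod_one_eqI[symmetric]) auto
  also have "\<dots> = (\<Oplus>u\<in>set Us. \<Oplus>g\<in>H. g (y u) \<otimes> u)"
    using finite_H Us y H_closed by (intro finsum_swap) (auto simp: Pi_iff subset_iff)
  also have "\<dots> = (\<Oplus>u\<in>set Us. trace (y u) \<otimes> u)"
    unfolding trace_def using finite_H Us y H_closed
    by (intro finsum_cong' refl finsum_ldistr[symmetric])
      (auto simp: Pi_iff subset_iff intro!: finsum_closed)
  also have "\<dots> = combine (map (\<lambda>u. trace (y u)) Us) Us"
    using dist Us y trace_closed by (intro combine_map_eq_finsum[symmetric]) (auto simp: Pi_iff)
  finally have "combine (map (\<lambda>u. trace (y u)) Us) Us = \<zero>" by simp
  moreover have "set (map (\<lambda>u. trace (y u)) Us) \<subseteq> K"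
    using fix_K trace_closed trace_fixed y by (auto simp: Pi_iff)
  ultimately have "set (take (length Us) (map (\<lambda>u. trace (y u)) Us)) \<subseteq> {\<zero>}"
    using independent_imp_trivial_combine[OF K ind] by blast
  then have "trace (y u0) = \<zero>" using u0 by auto
  then show False using x0 q unfolding y_def by simp
qed

text \<open>The other half of Artin's theorem, again by traces. Since \<tau> fixes every trace, the
  sum of the maps \<tau> o h minus the sum of the maps h vanishes identically. If \<tau> were
  outside H, these 2|H| homomorphisms would be pairwise distinct, against Dedekind
  independence.\<close>

lemma mem_if_fixes_fixed_field:
  assumes fix_K: "\<And>x. \<lbrakk>x \<in> carrier R; \<And>h. h \<in> H \<Longrightarrow> h x = x\<rbrakk> \<Longrightarrow> x \<in> K"
    and \<tau>: "\<tau> \<in> ring_hom R R" "\<tau> \<in> extensional (carrier R)" "\<And>x. x \<in> K \<Longrightarrow> \<tau> x = x"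
  shows "\<tau> \<in> H"
proof (rule ccontr)
  assume nt: "\<tau> \<notin> H"
  have \<tau>c: "\<And>x. x \<in> carrier R \<Longrightarrow> \<tau> x \<in> carrier R" using \<tau>(1) ring_hom_closed by metis
  have ne: "\<exists>x\<in>carrier R. \<tau> (h x) \<noteq> g x" if gh: "g \<in> H" "h \<in> H" for g h
  proof (rule ccontr)
    assume "\<not> ?thesis"
    then have eq: "\<And>x. x \<in> carrier R \<Longrightarrow> \<tau> (h x) = g x" by blast
    obtain k where k: "k \<in> H" "\<forall>x\<in>carrier R. h (k x) = x" using inv_H[OF gh(2)] by blast
    have "\<tau> = compose (carrier R) g k"
    proof (rule extensionalityI[of _ "carrier R"])
      fix x assume x: "x \<in> carrier R"
      have "\<tau> x = \<tau> (h (k x))" using k x by simp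
      then show "\<tau> x = compose (carrier R) g k x" using eq[OF H_closed[OF k(1) x]] x by (simp add: compose_eq)
    qed (use \<tau> in \<open>auto simp: compose_def\<close>)
    then show False using comp_H[OF gh(1) k(1)] nt by simp
  qed
  \<comment> \<open>The boolean separates the maps \<tau> o h, with coefficient 1, from the maps h,
    with coefficient -1.\<close>
  define \<phi> where "\<phi> = (\<lambda>(b, h :: 'a \<Rightarrow> 'a) x. if b then \<tau> (h x) else h x)"
  define c where "c = (\<lambda>(b::bool, h::'a \<Rightarrow> 'a). if b then \<one> else \<ominus> \<one>)"
  let ?I = "(UNIV :: bool set) \<times> H"
  have "\<forall>i\<in>?I. c i = \<zero>"
  proof (rule dedekind_independence)
    show "finite ?I" using finite_H by simp
    show "\<phi> i \<in> ring_hom R R" if "i \<in> ?I" for i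
    proof -
      have "snd i \<in> ring_hom R R" using that hom_H by auto
      moreover from ring_hom_trans[OF this \<tau>(1)] have "\<tau> \<circ> snd i \<in> ring_hom R R" .
      ultimately show ?thesis unfolding \<phi>_def by (cases i; cases "fst i") (auto simp: comp_def)
    qed
    show "\<exists>x\<in>carrier R. \<phi> i x \<noteq> \<phi> j x" if ij: "i \<in> ?I" "j \<in> ?I" "i \<noteq> j" for i j
    proof -
      obtain b g b' h where e: "i = (b, g)" "j = (b', h)" by fastforce
      have gh: "g \<in> H" "h \<in> H" using ij e by auto
      have inj: "\<tau> x = \<tau> y \<Longrightarrow> x = y" if "x \<in> carrier R" "y \<in> carrier R" for x y
        using non_trivial_field_hom_is_inj[OF \<tau>(1) field_axioms field_axioms] that
        by (auto simp: inj_on_def)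
      show ?thesis
      proof (cases "b = b'")
        case True
        then obtain x where "x \<in> carrier R" "g x \<noteq> h x" using H_distinct gh ij e by blast
        then show ?thesis using True inj[of "g x" "h x"] H_closed gh unfolding \<phi>_def e by auto
      next
        case False
        obtain x y where "x \<in> carrier R" "\<tau> (h x) \<noteq> g x" "y \<in> carrier R" "\<tau> (g y) \<noteq> h y"
          using ne[OF gh] ne[OF gh(2,1)] by blast
        then show ?thesis using False unfolding \<phi>_def e by (cases b) (simp, metis)+
      qed
    qed
    show "c \<in> ?I \<rightarrow> carrier R" unfolding c_def by auto
    fix x assume x: "x \<in> carrier R"
    have U: "(UNIV :: bool set) \<times> H = Pair True ` H \<union> Pair False ` H" by (auto simp: image_iff)
    have cl: "\<And>b h. h \<in> H \<Longrightarrow> c (b, h) \<otimes> \<phi> (b, h) x \<in> carrier R"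
      unfolding c_def \<phi>_def using x H_closed \<tau>c by auto
    have "(\<Oplus>i\<in>?I. c i \<otimes> \<phi> i x) =
        (\<Oplus>i\<in>Pair True ` H. c i \<otimes> \<phi> i x) \<oplus> (\<Oplus>i\<in>Pair False ` H. c i \<otimes> \<phi> i x)"
      unfolding U using finite_H cl by (intro finsum_Un_disjoint) auto
    also have "(\<Oplus>i\<in>Pair True ` H. c i \<otimes> \<phi> i x) = (\<Oplus>h\<in>H. \<tau> (h x))"
      using cl x H_closed \<tau>c
      by (subst add.finprod_reindex) (auto simp: inj_on_def c_def \<phi>_def intro!: finsum_cong')
    also have "\<dots> = \<tau> (trace x)"
      unfolding trace_def using finite_H x H_closed \<tau>(1) by (intro hom_finsum[symmetric]) auto
    also have "\<dots> = trace x" using \<tau>(3) fix_K[OF trace_closed] trace_fixed x by blast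
    also have "(\<Oplus>i\<in>Pair False ` H. c i \<otimes> \<phi> i x) = (\<Oplus>h\<in>H. (\<ominus> \<one>) \<otimes> h x)"
      using cl x H_closed
      by (subst add.finprod_reindex) (auto simp: inj_on_def c_def \<phi>_def intro!: finsum_cong')
    also have "\<dots> = (\<ominus> \<one>) \<otimes> trace x"
      unfolding trace_def using finite_H x H_closed by (intro finsum_rdistr[symmetric]) auto
    also have "trace x \<oplus> (\<ominus> \<one>) \<otimes> trace x = \<zero>" using trace_closed[OF x] by algebra
    finally show "(\<Oplus>i\<in>?I. c i \<otimes> \<phi> i x) = \<zero>" .
  qed
  then have "c (True, restrict id (carrier R)) = \<zero>" using id_H by blast
  then show False unfolding c_def by simp
qed

end

context field
begin

text \<open>For an endomorphism \<tau> this is the partial norm w \<tau>(w) ... \<tau>^(j-1)(w); it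
  is the norm of w when j is the order of \<tau>.\<close>

primrec twisted_norm :: "('a \<Rightarrow> 'a) \<Rightarrow> 'a \<Rightarrow> nat \<Rightarrow> 'a" where
  "twisted_norm \<tau> w 0 = \<one>"
| "twisted_norm \<tau> w (Suc j) = w \<otimes> \<tau> (twisted_norm \<tau> w j)"

text \<open>The witness is the Lagrange resolvent, the sum of N_j \<tau>^j(x) over j < n with N_j
  the partial norms. Dedekind independence provides an x for which it is nonzero, because N_0 =
  1.\<close>

lemma hilbert_90:
  assumes \<tau>: "\<tau> \<in> ring_hom R R" and w: "w \<in> carrier R" and n: "n > 0"
    and per: "\<And>x. x \<in> carrier R \<Longrightarrow> (\<tau> ^^ n) x = x"
    and dist: "\<And>i j. i < j \<Longrightarrow> j < n \<Longrightarrow> \<exists>x\<in>carrier R. (\<tau> ^^ i) x \<noteq> (\<tau> ^^ j) x"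
    and norm: "twisted_norm \<tau> w n = \<one>"
  shows "\<exists>z\<in>carrier R - {\<zero>}. w \<otimes> \<tau> z = z"
proof -
  have \<tau>c: "\<And>x. x \<in> carrier R \<Longrightarrow> \<tau> x \<in> carrier R" using \<tau> ring_hom_closed by metis
  have hom: "(\<tau> ^^ i) \<in> ring_hom R R" for i
  proof (induction i)
    case 0
    then show ?case by (auto intro: ring_hom_memI)
  next
    case (Suc i)
    then show ?case using ring_hom_trans[OF Suc \<tau>] by (simp only: funpow.simps)
  qed
  have hc: "\<And>i x. x \<in> carrier R \<Longrightarrow> (\<tau> ^^ i) x \<in> carrier R" by (rule ring_hom_closed[OF hom])
  have Nc: "twisted_norm \<tau> w i \<in> carrier R" for i by (induction i) (use w \<tau>c in auto)
  have dist': "\<exists>x\<in>carrier R. (\<tau> ^^ i) x \<noteq> (\<tau> ^^ j) x" if "i < n" "j < n" "i \<noteq> j" for i j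
  proof (cases "i < j")
    case True
    then show ?thesis by (rule dist[OF _ that(2)])
  next
    case False
    then have "j < i" using that by simp
    then show ?thesis using dist[OF _ that(1)] by metis
  qed
  have "\<exists>x\<in>carrier R. (\<Oplus>j\<in>{..<n}. twisted_norm \<tau> w j \<otimes> (\<tau> ^^ j) x) \<noteq> \<zero>"
  proof (rule ccontr)
    assume neg: "\<not> ?thesis"
    have "\<forall>i\<in>{..<n}. twisted_norm \<tau> w i = \<zero>"
    proof (rule dedekind_independence[of "{..<n}" "\<lambda>j. \<tau> ^^ j"])
      show "(\<Oplus>i\<in>{..<n}. twisted_norm \<tau> w i \<otimes> (\<tau> ^^ i) x) = \<zero>" if "x \<in> carrier R" for x
        using neg that by blast
      show "\<tau> ^^ i \<in> ring_hom R R" for i by (rule hom)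
    qed (simp_all add: Nc dist')
    from bspec[OF this, of 0] show False using n by simp
  qed
  then obtain x where x: "x \<in> carrier R" "(\<Oplus>j\<in>{..<n}. twisted_norm \<tau> w j \<otimes> (\<tau> ^^ j) x) \<noteq> \<zero>"
    by blast
  define f where "f j = twisted_norm \<tau> w j \<otimes> (\<tau> ^^ j) x" for j
  have fc: "f j \<in> carrier R" for j unfolding f_def using Nc hc x by simp
  have step: "w \<otimes> \<tau> (f j) = f (Suc j)" for j
    unfolding f_def using Nc hc x w \<tau>c \<tau> by (simp add: ring_hom_mult m_assoc)
  \<comment> \<open>Applying \<tau> and multiplying by w shifts the summands by one index. At k = n
    the two boundary terms agree, since the norm is one and \<tau>^n is the identity.\<close>
  have sum_step: "w \<otimes> \<tau> (\<Oplus>j\<in>{..<k}. f j) \<oplus> f 0 = (\<Oplus>j\<in>{..<k}. f j) \<oplus> f k" for k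
  proof (induction k)
    case 0
    then show ?case using fc w \<tau> ring_hom_zero[OF \<tau>] ring_axioms by simp
  next
    case (Suc k)
    define S where "S = (\<Oplus>j\<in>{..<k}. f j)"
    have S: "S \<in> carrier R" unfolding S_def using fc by (auto intro!: finsum_closed)
    have eq: "(\<Oplus>j\<in>{..<Suc k}. f j) = f k \<oplus> S"
      unfolding S_def lessThan_Suc using fc by (intro finsum_insert) auto
    have "w \<otimes> \<tau> (f k \<oplus> S) = w \<otimes> \<tau> (f k) \<oplus> w \<otimes> \<tau> S"
      using \<tau> S fc w \<tau>c by (simp add: ring_hom_add r_distr)
    then have "w \<otimes> \<tau> (f k \<oplus> S) \<oplus> f 0 = f (Suc k) \<oplus> (w \<otimes> \<tau> S \<oplus> f 0)"
      using step[of k] fc w S \<tau>c by (simp add: a_assoc)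
    also have "\<dots> = f (Suc k) \<oplus> (S \<oplus> f k)" using Suc unfolding S_def by simp
    finally show ?case unfolding eq using fc S by (simp add: a_ac)
  qed
  define z where "z = (\<Oplus>j\<in>{..<n}. f j)"
  have zc: "z \<in> carrier R" unfolding z_def using fc by (auto intro!: finsum_closed)
  have zeq: "z = (\<Oplus>j\<in>{..<n}. twisted_norm \<tau> w j \<otimes> (\<tau> ^^ j) x)"
    unfolding z_def by (intro arg_cong[where f = "\<lambda>g. finsum R g {..<n}"] ext f_def)
  have z: "z \<in> carrier R" "z \<noteq> \<zero>" using zc x(2) unfolding zeq by blast+
  have "f n = f 0" unfolding f_def using norm per[OF x(1)] x(1) by simp
  with sum_step[of n] have "w \<otimes> \<tau> z \<oplus> f 0 = z \<oplus> f 0" unfolding z_def by (simp only:)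
  moreover have "w \<otimes> \<tau> z \<in> carrier R" using w \<tau>c[OF zc] by simp
  ultimately have "w \<otimes> \<tau> z = z" using add.right_cancel[OF fc] zc by blast
  with z show ?thesis by blast
qed

end

section \<open>Separable elements and powers of linear polynomials\<close>

context domain
begin

text \<open>The value of the formal derivative, computed on coefficient lists that need not be
  normalized, so that it can be followed through the list operations behind polynomial addition and
  multiplication. For the constant term the truncated exponent is harmless, since its coefficient is
  \<open>add_pow R 0 a\<close>.\<close>

primrec deriv_eval :: "'a list \<Rightarrow> 'a \<Rightarrow> 'a" where
  "deriv_eval [] x = \<zero>"
| "deriv_eval (a # p) x = add_pow R (length p) a \<otimes> x [^] (length p - 1) \<oplus> deriv_eval p x"

lemma deriv_eval_closed:
  "\<lbrakk>set p \<subseteq> carrier R; x \<in> carrier R\<rbrakk> \<Longrightarrow> deriv_eval p x \<in> carrier R"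
  by (induction p) auto

lemma eval_poly_derivative:
  assumes "set p \<subseteq> carrier R" "x \<in> carrier R"
  shows "eval (poly_derivative R p) x = deriv_eval p x"
proof -
  let ?l = "\<lambda>p. map (\<lambda>i. add_pow R (degree p - i) (p ! i)) [0..<degree p]"
  have cl: "set (?l p) \<subseteq> carrier R" if "set p \<subseteq> carrier R" for p
    using that by (auto simp: subset_iff)
  have "eval (?l p) x = deriv_eval p x"
    using assms(1)
  proof (induction p)
    case (Cons a p)
    show ?case
    proof (cases "p = []")
      case False
      then obtain n where n: "length p = Suc n" by (cases p) auto
      have "[0..<Suc n] = 0 # map Suc [0..<n]" by (simp add: upt_conv_Cons map_Suc_upt del: upt_Suc)
      then have "?l (a # p) = add_pow R (length p) a # ?l p" using n by (simp del: upt_Suc)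
      then show ?thesis using Cons n by simp
    qed (use Cons in simp)
  qed simp
  then show ?thesis
    unfolding poly_derivative_def using eval_normalize[OF cl[OF assms(1)] assms(2)] by simp
qed

lemma deriv_eval_normalize:
  assumes "set p \<subseteq> carrier R" "x \<in> carrier R"
  shows "deriv_eval (normalize p) x = deriv_eval p x"
  using assms by (induction p) (auto simp: deriv_eval_closed)

lemma deriv_eval_replicate_zero:
  assumes "set p \<subseteq> carrier R" "x \<in> carrier R"
  shows "deriv_eval (replicate n \<zero> @ p) x = deriv_eval p x"
  using assms by (induction n) (auto simp: deriv_eval_closed)

lemma deriv_eval_map2:
  assumes "length p = length q" "set p \<subseteq> carrier R" "set q \<subseteq> carrier R" "x \<in> carrier R"
  shows "deriv_eval (map2 (\<oplus>) p q) x = deriv_eval p x \<oplus> deriv_eval q x"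
  using assms
proof (induction p q rule: list_induct2)
  case (Cons a p b q)
  let ?c = "x [^] (length q - 1)"
  define d where "d = deriv_eval p x"
  define e where "e = deriv_eval q x"
  have cl: "add_pow R (length q) a \<in> carrier R" "add_pow R (length q) b \<in> carrier R" "?c \<in> carrier R"
      "d \<in> carrier R" "e \<in> carrier R"
    using Cons deriv_eval_closed unfolding d_def e_def by auto
  have "add_pow R (length q) (a \<oplus> b) = add_pow R (length q) a \<oplus> add_pow R (length q) b"
    using Cons.prems by (simp add: add.nat_pow_distrib)
  then show ?case
    using Cons cl by (simp add: l_distr a_ac d_def[symmetric] e_def[symmetric])
qed simp

lemma deriv_eval_poly_add:
  assumes "set p \<subseteq> carrier R" "set q \<subseteq> carrier R" "x \<in> carrier R"
  shows "deriv_eval (poly_add p q) x = deriv_eval p x \<oplus> deriv_eval q x"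
proof -
  have *: "deriv_eval (poly_add p q) x = deriv_eval p x \<oplus> deriv_eval q x"
    if "length q \<le> length p" "set p \<subseteq> carrier R" "set q \<subseteq> carrier R" for p q
  proof -
    let ?q = "replicate (length p - length q) \<zero> @ q"
    have q: "set ?q \<subseteq> carrier R" "length p = length ?q" using that by auto
    have "set (map2 (\<oplus>) p ?q) \<subseteq> carrier R"
    proof
      fix c assume "c \<in> set (map2 (\<oplus>) p ?q)"
      then obtain a b where ab: "(a, b) \<in> set (zip p ?q)" "c = a \<oplus> b"
        by (auto simp del: zip_append)
      have "a \<in> carrier R" "b \<in> carrier R"
        using set_zip_leftD[OF ab(1)] set_zip_rightD[OF ab(1)] that(2) q(1) by blast+
      then show "c \<in> carrier R" using ab(2) by simp
    qed
    then show ?thesis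
      using that deriv_eval_normalize[of "map2 (\<oplus>) p ?q" x] deriv_eval_map2[OF q(2) that(2) q(1)]
        deriv_eval_replicate_zero[OF that(3)] assms(3) by simp
  qed
  show ?thesis
  proof (cases "length q \<le> length p")
    case False
    then have "poly_add p q = poly_add q p" by simp
    then show ?thesis
      using *[of p q] False assms deriv_eval_closed a_comm by (simp del: poly_add.simps)
  qed (use * assms in blast)
qed

lemma deriv_eval_scale:
  assumes "set p \<subseteq> carrier R" "x \<in> carrier R" "c \<in> carrier R"
  shows "deriv_eval (map ((\<otimes>) c) p) x = c \<otimes> deriv_eval p x"
  using assms
proof (induction p)
  case (Cons a p)
  have "add_pow R (length p) (c \<otimes> a) = c \<otimes> add_pow R (length p) a"
    using Cons.prems by (simp add: add_pow_rdistr)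
  then show ?case
    using Cons deriv_eval_closed[of p x] by (simp add: r_distr m_assoc)
qed simp

text \<open>Appending a zero multiplies by X, so this is the product rule for X p.\<close>

lemma deriv_eval_append_zero:
  assumes "set p \<subseteq> carrier R" "x \<in> carrier R"
  shows "deriv_eval (p @ [\<zero>]) x = eval p x \<oplus> x \<otimes> deriv_eval p x"
  using assms
proof (induction p)
  case (Cons a p)
  define n where "n = length p"
  define d where "d = deriv_eval p x"
  define e where "e = eval p x"
  define b where "b = add_pow R n a"
  have cl: "a \<in> carrier R" "d \<in> carrier R" "e \<in> carrier R" "b \<in> carrier R"
    using Cons deriv_eval_closed eval_in_carrier unfolding d_def e_def b_def by auto
  have "b \<otimes> x [^] n = x \<otimes> (b \<otimes> x [^] (n - 1))"
    using cl(4) Cons.prems by (cases n) (auto simp: b_def m_ac)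
  moreover have "add_pow R (Suc n) a = a \<oplus> b"
    using cl unfolding b_def by (simp add: a_comm)
  moreover have "x [^] (n - 1) \<in> carrier R" "x [^] n \<in> carrier R" using Cons.prems by auto
  ultimately show ?case
    using Cons cl unfolding n_def[symmetric] d_def[symmetric] e_def[symmetric]
    by (simp add: n_def[symmetric] d_def[symmetric] e_def[symmetric] b_def[symmetric] l_distr r_distr a_ac)
qed simp

text \<open>The product rule at the root: the summand that retains the factor X - x vanishes
  there.\<close>

lemma deriv_eval_linear_mult:
  assumes "q \<in> carrier (poly_ring R)" "x \<in> carrier R"
  shows "deriv_eval ([\<one>, \<ominus> x] \<otimes>\<^bsub>poly_ring R\<^esub> q) x = eval q x"
proof -
  have q: "set q \<subseteq> carrier R"
    using assms(1) polynomial_incl univ_poly_carrier by blast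
  have "map ((\<otimes>) \<one>) q = q" using q by (induction q) auto
  then have eq: "[\<one>, \<ominus> x] \<otimes>\<^bsub>poly_ring R\<^esub> q = poly_add (q @ [\<zero>]) (poly_add (map ((\<otimes>) (\<ominus> x)) q) [])"
    by (simp add: univ_poly_mult del: poly_add.simps)
  have m: "set (map ((\<otimes>) (\<ominus> x)) q) \<subseteq> carrier R" using q assms(2) by auto
  have "set (poly_add (map ((\<otimes>) (\<ominus> x)) q) []) \<subseteq> carrier R"
    using m by (intro poly_add_in_carrier) auto
  then have "deriv_eval ([\<one>, \<ominus> x] \<otimes>\<^bsub>poly_ring R\<^esub> q) x
      = deriv_eval (q @ [\<zero>]) x \<oplus> deriv_eval (poly_add (map ((\<otimes>) (\<ominus> x)) q) []) x"
    unfolding eq using q assms(2) by (intro deriv_eval_poly_add) auto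
  also have "\<dots> = deriv_eval (q @ [\<zero>]) x \<oplus> ((\<ominus> x) \<otimes> deriv_eval q x \<oplus> \<zero>)"
    using deriv_eval_poly_add[OF m, of "[]" x] deriv_eval_scale[OF q assms(2), of "\<ominus> x"] assms(2)
    by simp
  also have "\<dots> = eval q x"
    using deriv_eval_append_zero[OF q assms(2)] deriv_eval_closed[OF q assms(2)]
      eval_in_carrier[OF q assms(2)] assms(2) by (simp add: a_assoc, algebra)
  finally show ?thesis .
qed

lemma linear_in_poly_ring: "x \<in> carrier R \<Longrightarrow> [\<one>, \<ominus> x] \<in> carrier (poly_ring R)"
  unfolding sym[OF univ_poly_carrier] polynomial_def by simp

lemma eval_linear_root: "x \<in> carrier R \<Longrightarrow> eval [\<one>, \<ominus> x] x = \<zero>"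
  by (simp add: r_neg)

text \<open>Since p does not vanish at x, every root factor X - x must come from q. Cancelling these
  factors one at a time leaves a product equal to one.\<close>

lemma factor_of_linear_power:
  assumes x: "x \<in> carrier R" and p: "p \<in> carrier (poly_ring R)" "eval p x \<noteq> \<zero>"
    and q: "q \<in> carrier (poly_ring R)"
    and eq: "p \<otimes>\<^bsub>poly_ring R\<^esub> q = [\<one>, \<ominus> x] [^]\<^bsub>poly_ring R\<^esub> (k::nat)"
  shows "p \<in> Units (poly_ring R)"
proof -
  interpret UP: domain "poly_ring R" by (rule univ_poly_is_domain[OF carrier_is_subring])
  let ?l = "[\<one>, \<ominus> x]"
  have l: "?l \<in> carrier (poly_ring R)" by (rule linear_in_poly_ring[OF x])
  note ev = ring_hom_memE[OF eval_is_hom[OF carrier_is_subring x]]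
  have l0: "?l \<noteq> \<zero>\<^bsub>poly_ring R\<^esub>" by (simp add: univ_poly_zero)
  show ?thesis
    using q eq
  proof (induction k arbitrary: q)
    case 0
    then have "p \<otimes>\<^bsub>poly_ring R\<^esub> q = \<one>\<^bsub>poly_ring R\<^esub>" by simp
    moreover have "q \<otimes>\<^bsub>poly_ring R\<^esub> p = p \<otimes>\<^bsub>poly_ring R\<^esub> q"
      by (rule UP.m_comm[OF 0(1) p(1)])
    ultimately show ?case using p(1) 0(1) unfolding Units_def by auto
  next
    case (Suc k)
    have "p \<otimes>\<^bsub>poly_ring R\<^esub> q = ?l \<otimes>\<^bsub>poly_ring R\<^esub> ?l [^]\<^bsub>poly_ring R\<^esub> k"
      using Suc.prems(2) l by (simp add: UP.m_comm)
    then have "eval p x \<otimes> eval q x = eval ?l x \<otimes> eval (?l [^]\<^bsub>poly_ring R\<^esub> k) x"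
      using ev(2)[OF p(1) Suc.prems(1)] ev(2)[OF l UP.nat_pow_closed[OF l, of k]] by simp
    also have "\<dots> = \<zero>" using eval_linear_root[OF x] ev(1)[OF UP.nat_pow_closed[OF l, of k]] by simp
    finally have q0: "eval q x = \<zero>"
      using p(2) ev(1)[OF p(1)] ev(1)[OF Suc.prems(1)] integral by blast
    have "q \<noteq> \<zero>\<^bsub>poly_ring R\<^esub>"
    proof
      assume "q = \<zero>\<^bsub>poly_ring R\<^esub>"
      then have "?l [^]\<^bsub>poly_ring R\<^esub> Suc k = \<zero>\<^bsub>poly_ring R\<^esub>" using Suc.prems(2) p(1) by simp
      then show False using polynomial_pow_not_zero[OF l, of "Suc k"] by (simp add: univ_poly_zero del: UP.nat_pow_Suc)
    qed
    then have "is_root q x" using q0 x unfolding is_root_def univ_poly_zero by simp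
    then obtain q' where q': "q' \<in> carrier (poly_ring R)" "q = ?l \<otimes>\<^bsub>poly_ring R\<^esub> q'"
      using is_root_imp_pdivides[OF Suc.prems(1)] unfolding pdivides_def factor_def by blast
    have "?l \<otimes>\<^bsub>poly_ring R\<^esub> (p \<otimes>\<^bsub>poly_ring R\<^esub> q') = ?l \<otimes>\<^bsub>poly_ring R\<^esub> ?l [^]\<^bsub>poly_ring R\<^esub> k"
      using Suc.prems(2) l p q' by (simp add: UP.m_ac)
    then have "p \<otimes>\<^bsub>poly_ring R\<^esub> q' = ?l [^]\<^bsub>poly_ring R\<^esub> k"
      using UP.m_lcancel[OF l0 l] p q' l by simp
    then show ?case using Suc.IH q'(1) by blast
  qed
qed

end

text \<open>Write the minimal polynomial as P = (X - x) P1. Separability gives P1(x) = P'(x)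
  \<noteq> 0. As P divides a power of X - x, its factor P1 is a unit, so P is linear and its root
  lies in K.\<close>

lemma (in field) separable_linear_power_imp_mem:
  assumes K: "subfield K R" and x: "x \<in> carrier R" and alg: "(algebraic over K) x"
    and sep: "separable_poly R K (Irr K x)"
    and pow: "[\<one>, \<ominus> x] [^]\<^bsub>poly_ring R\<^esub> (m::nat) \<in> carrier (K[X])" and m: "m > 0"
  shows "x \<in> K"
proof -
  interpret UP: domain "poly_ring R" by (rule univ_poly_is_domain[OF carrier_is_subring])
  let ?l = "[\<one>, \<ominus> x]"
  have l: "?l \<in> carrier (poly_ring R)" by (rule linear_in_poly_ring[OF x])
  have l0: "?l \<noteq> \<zero>\<^bsub>poly_ring R\<^esub>" by (simp add: univ_poly_zero)
  note sub = subfieldE(1)[OF K]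
  have KR: "carrier (K[X]) \<subseteq> carrier (poly_ring R)"
    using subfieldE(3)[OF K] by (auto simp: sym[OF univ_poly_carrier] polynomial_def subset_iff)
  note ev = ring_hom_memE[OF eval_is_hom[OF carrier_is_subring x]]
  define P where "P = Irr K x"
  note Irr = IrrE[OF K x alg, folded P_def]
  have P: "P \<in> carrier (poly_ring R)" using Irr(1) KR by blast
  have Pne: "P \<noteq> []"
    using Irr(2) unfolding ring_irreducible_def univ_poly_zero by simp
  then have "is_root P x" using Irr(4) x unfolding is_root_def by simp
  then obtain P1 where P1: "P1 \<in> carrier (poly_ring R)" "P = ?l \<otimes>\<^bsub>poly_ring R\<^esub> P1"
    using is_root_imp_pdivides[OF P] unfolding pdivides_def factor_def by blast
  have Pset: "set P \<subseteq> carrier R" "set P \<subseteq> K"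
    using P Irr(1) polynomial_incl univ_poly_carrier by blast+
  have "eval P1 x = deriv_eval P x" unfolding P1(2) using deriv_eval_linear_mult[OF P1(1) x] by simp
  also have "\<dots> = eval (poly_derivative R P) x" using eval_poly_derivative[OF Pset(1) x] by simp
  finally have evP1: "eval P1 x = eval (poly_derivative R P) x" .
  have "add_pow R (n::nat) a \<in> K" if "a \<in> K" for a n
    using that subringE(2,7)[OF sub] by (induction n) auto
  then have P': "poly_derivative R P \<in> carrier (K[X])"
    unfolding poly_derivative_def sym[OF univ_poly_carrier] using Pset(2)
    by (intro normalize_gives_polynomial) (auto simp: subset_iff)
  obtain s t where st: "s \<in> carrier (K[X])" "t \<in> carrier (K[X])"
      "(s \<otimes>\<^bsub>K[X]\<^esub> P) \<oplus>\<^bsub>K[X]\<^esub> (t \<otimes>\<^bsub>K[X]\<^esub> poly_derivative R P) = \<one>\<^bsub>K[X]\<^esub>"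
    using sep unfolding separable_poly_def P_def by blast
  note evK = ring_hom_memE[OF eval_is_hom[OF sub x]]
  interpret UK: domain "K[X]" by (rule univ_poly_is_domain[OF sub])
  \<comment> \<open>At x the Bezout identity reduces to t(x) P'(x) = 1.\<close>
  have "eval s x \<otimes> \<zero> \<oplus> eval t x \<otimes> eval P1 x = \<one>"
    using arg_cong[OF st(3), of "\<lambda>q. eval q x"] evK st(1,2) Irr(1,4) P' evP1 by simp
  then have P1x: "eval P1 x \<noteq> \<zero>"
    using evK(1) st(1,2) by force
  have "eval (?l [^]\<^bsub>poly_ring R\<^esub> m) x = \<zero>"
  proof -
    obtain k where "m = Suc k" using m by (cases m) auto
    then show ?thesis
      using ev(2)[OF UP.nat_pow_closed[OF l, of k] l] ev(1)[OF UP.nat_pow_closed[OF l, of k]]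
        eval_linear_root[OF x] by simp
  qed
  then have "P pdivides (?l [^]\<^bsub>poly_ring R\<^esub> m)"
    unfolding P_def using Irr_minimal[OF K x alg pow] by simp
  then obtain U where U: "U \<in> carrier (poly_ring R)" "?l [^]\<^bsub>poly_ring R\<^esub> m = P \<otimes>\<^bsub>poly_ring R\<^esub> U"
    unfolding pdivides_def factor_def by blast
  obtain k where k: "m = Suc k" using m by (cases m) auto
  have "?l \<otimes>\<^bsub>poly_ring R\<^esub> (P1 \<otimes>\<^bsub>poly_ring R\<^esub> U) = ?l \<otimes>\<^bsub>poly_ring R\<^esub> ?l [^]\<^bsub>poly_ring R\<^esub> k"
    using U(2) l P1 U(1) UP.nat_pow_closed[OF l, of k] unfolding k by (simp add: UP.m_ac)
  then have "P1 \<otimes>\<^bsub>poly_ring R\<^esub> U = ?l [^]\<^bsub>poly_ring R\<^esub> k"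
    using UP.m_lcancel[OF l0 l] P1(1) U(1) l by simp
  then have "P1 \<in> Units (poly_ring R)"
    by (rule factor_of_linear_power[OF x P1(1) P1x U(1)])
  then have "P \<sim>\<^bsub>poly_ring R\<^esub> ?l"
    using P1(2) UP.associatedI2'[of P ?l P1] l UP.associated_sym by blast
  then have "length P = 2"
    using associated_polynomials_imp_same_length[OF carrier_is_subring P l] by simp
  then obtain a b where ab: "P = [a, b]" by (metis One_nat_def Suc_1 length_0_conv length_Suc_conv)
  then have "a = \<one>" "b \<in> K" using Irr(3) Pset by auto
  then have "x \<oplus> b = \<zero>" "b \<in> carrier R" using Irr(4) ab x Pset by auto
  then have "x = \<ominus> b" using x by (simp add: minus_equality)
  then show ?thesis using subringE(5)[OF sub \<open>b \<in> K\<close>] by simp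
qed

section \<open>Wedderburn factorization in division rings\<close>

locale division_ring = ring R for R (structure) +
  assumes one_neq_zero: "\<one> \<noteq> \<zero>" and Units_eq: "Units R = carrier R - {\<zero>}"
begin

lemma inv_props:
  assumes "a \<in> carrier R" "a \<noteq> \<zero>"
  shows "inv a \<in> carrier R" "inv a \<otimes> a = \<one>" "a \<otimes> inv a = \<one>" "inv a \<noteq> \<zero>"
proof -
  have a: "a \<in> Units R" using assms Units_eq by simp
  then show "inv a \<in> carrier R" "inv a \<otimes> a = \<one>" "a \<otimes> inv a = \<one>" by simp_all
  show "inv a \<noteq> \<zero>" using Units_inv_Units[OF a] Units_eq by simp
qed

lemma mult_nonzero:
  assumes "a \<in> carrier R" "b \<in> carrier R" "a \<noteq> \<zero>" "b \<noteq> \<zero>"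
  shows "a \<otimes> b \<noteq> \<zero>"
proof -
  have "a \<otimes> b \<in> Units R" using assms by (intro Units_m_closed) (simp_all add: Units_eq)
  then show ?thesis using Units_eq by simp
qed

lemma mult_zero_iff:
  assumes "a \<in> carrier R" "b \<in> carrier R"
  shows "a \<otimes> b = \<zero> \<longleftrightarrow> a = \<zero> \<or> b = \<zero>"
  using assms mult_nonzero by auto

text \<open>A list \<open>c\<close> stands for the operator \<open>d \<mapsto> c\<^sub>0 d a\<^sup>k + c\<^sub>1 d a\<^sup>k\<^sup>-\<^sup>1 + \<dots> + c\<^sub>k d\<close>, that is, for a
  polynomial over the division ring whose indeterminate acts by right multiplication by \<open>a\<close>.\<close>

primrec lop :: "'a \<Rightarrow> 'a list \<Rightarrow> 'a \<Rightarrow> 'a" where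
  "lop a [] d = \<zero>"
| "lop a (c # cs) d = c \<otimes> (d \<otimes> a [^] length cs) \<oplus> lop a cs d"

definition annihilates :: "'a \<Rightarrow> 'a list \<Rightarrow> bool" where
  "annihilates a c \<longleftrightarrow> set c \<subseteq> carrier R \<and> (\<forall>d\<in>carrier R. lop a c d = \<zero>)"

text \<open>The product of \<open>X - b\<close> with the polynomial \<open>c\<close>.\<close>

definition linear_mult :: "'a \<Rightarrow> 'a list \<Rightarrow> 'a list" where
  "linear_mult b c = map2 (\<oplus>) (c @ [\<zero>]) (\<zero> # map (\<lambda>y. \<ominus> (b \<otimes> y)) c)"

lemma lop_closed [simp]:
  "\<lbrakk>a \<in> carrier R; set c \<subseteq> carrier R; d \<in> carrier R\<rbrakk> \<Longrightarrow> lop a c d \<in> carrier R"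
  by (induction c) auto

lemma lop_append_one:
  assumes "a \<in> carrier R" "set c \<subseteq> carrier R" "d \<in> carrier R" "b \<in> carrier R"
  shows "lop a (c @ [b]) d = lop a c d \<otimes> a \<oplus> b \<otimes> d"
  using assms by (induction c) (auto simp: l_distr m_assoc a_assoc)

lemma lop_scale:
  assumes "a \<in> carrier R" "set c \<subseteq> carrier R" "d \<in> carrier R" "b \<in> carrier R"
  shows "lop a (map ((\<otimes>) b) c) d = b \<otimes> lop a c d"
  using assms by (induction c) (auto simp: r_distr m_assoc)

text \<open>Left multiplications commute with right multiplication by a, so a product of polynomials
  acts as the composite of the operators; here X - b acts after \<open>c\<close>.\<close>

lemma lop_linear_mult:
  assumes a: "a \<in> carrier R" and c: "set c \<subseteq> carrier R" and d: "d \<in> carrier R" and b: "b \<in> carrier R"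
  shows "lop a (linear_mult b c) d = lop a c d \<otimes> a \<ominus> b \<otimes> lop a c d"
proof -
  have add: "lop a (map2 (\<oplus>) p q) d = lop a p d \<oplus> lop a q d"
    if "length p = length q" "set p \<subseteq> carrier R" "set q \<subseteq> carrier R" for p q
    using that a d by (induction p q rule: list_induct2) (auto simp: l_distr a_ac)
  have neg: "lop a (map (\<lambda>y. \<ominus> (b \<otimes> y)) c) d = \<ominus> (b \<otimes> lop a c d)"
    using c a b d by (induction c) (auto simp: r_distr minus_add l_minus m_assoc)
  have cl: "set (map (\<lambda>y. \<ominus> (b \<otimes> y)) c) \<subseteq> carrier R" using b c by auto
  show ?thesis
    unfolding linear_mult_def
    using add[of "c @ [\<zero>]" "\<zero> # map (\<lambda>y. \<ominus> (b \<otimes> y)) c"] lop_append_one[OF a c d zero_closed]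
      neg cl a b c d by (simp add: minus_eq)
qed

lemma linear_mult_closed:
  assumes "set c \<subseteq> carrier R" "b \<in> carrier R"
  shows "set (linear_mult b c) \<subseteq> carrier R"
proof
  fix y assume "y \<in> set (linear_mult b c)"
  then obtain s t where st: "(s, t) \<in> set (zip (c @ [\<zero>]) (\<zero> # map (\<lambda>y. \<ominus> (b \<otimes> y)) c))" "y = s \<oplus> t"
    unfolding linear_mult_def by (auto simp del: zip_append zip_Cons zip_Cons1)
  have "s \<in> carrier R" "t \<in> carrier R"
    using set_zip_leftD[OF st(1)] set_zip_rightD[OF st(1)] assms by auto
  then show "y \<in> carrier R" using st(2) by simp
qed

lemma length_linear_mult [simp]: "length (linear_mult b c) = Suc (length c)"
  unfolding linear_mult_def by simp

lemma linear_mult_monic: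
  "\<exists>c'. linear_mult b (\<one> # c) = \<one> # c'"
  unfolding linear_mult_def by simp

text \<open>Leading zeros are stripped and the first nonzero coefficient is scaled to one. The
  inequality is strict because \<open>t\<close> omits the leading one.\<close>

lemma exists_monic_annihilator_shorter:
  assumes a: "a \<in> carrier R" and "annihilates a c" "\<not> set c \<subseteq> {\<zero>}"
  shows "\<exists>t. length t < length c \<and> annihilates a (\<one> # t)"
  using assms(2,3)
proof (induction c)
  case (Cons y c)
  show ?case
  proof (cases "y = \<zero>")
    case True
    then have "annihilates a c" using Cons.prems a unfolding annihilates_def by auto
    then show ?thesis using Cons True less_Suc_eq by auto
  next
    case False
    have y: "y \<in> carrier R" "set c \<subseteq> carrier R" using Cons.prems unfolding annihilates_def by auto
    have "annihilates a (map ((\<otimes>) (inv y)) (y # c))"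
      using Cons.prems(1) lop_scale[OF a, of "y # c"] inv_props[OF y(1) False]
      unfolding annihilates_def by (auto simp del: lop.simps list.map(2))
    then have "annihilates a (\<one> # map ((\<otimes>) (inv y)) c)"
      using inv_props[OF y(1) False] by simp
    then show ?thesis by (intro exI[of _ "map ((\<otimes>) (inv y)) c"]) simp
  qed
qed simp

text \<open>With L the operator of the list, e L(d) - L(e d) is zero for every e. It is the operator
  of the list of commutators of e with the coefficients, from which the leading one has dropped out.
  Minimality of the degree forces every commutator to vanish.\<close>

lemma minimal_annihilator_central:
  assumes a: "a \<in> carrier R" and c: "annihilates a (\<one> # c)"
    and min: "\<And>t. annihilates a (\<one> # t) \<Longrightarrow> length c \<le> length t"
  shows "set c \<subseteq> ring_center R"
proof
  fix y assume y: "y \<in> set c"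
  have cR: "set c \<subseteq> carrier R" using c unfolding annihilates_def by auto
  have "e \<otimes> y = y \<otimes> e" if e: "e \<in> carrier R" for e
  proof -
    let ?s = "map (\<lambda>y. e \<otimes> y \<ominus> y \<otimes> e) c"
    have comm: "lop a ?s d = e \<otimes> lop a c d \<ominus> lop a c (e \<otimes> d)" if d: "d \<in> carrier R" for d
      using cR
    proof (induction c)
      case (Cons z c)
      define T where "T = a [^] length c"
      have cl: "z \<in> carrier R" "T \<in> carrier R" "lop a c d \<in> carrier R" "lop a c (e \<otimes> d) \<in> carrier R"
        using Cons.prems a e d unfolding T_def by auto
      have "(e \<otimes> z \<ominus> z \<otimes> e) \<otimes> (d \<otimes> T) \<oplus> (e \<otimes> P \<ominus> Q) =
          e \<otimes> (z \<otimes> (d \<otimes> T) \<oplus> P) \<ominus> (z \<otimes> (e \<otimes> d \<otimes> T) \<oplus> Q)"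
        if "P \<in> carrier R" "Q \<in> carrier R" for P Q
        using cl(1,2) e d that by algebra
      then show ?case using Cons cl by (simp add: T_def)
    qed (use e in \<open>simp add: minus_eq\<close>)
    have "lop a ?s d = \<zero>" if d: "d \<in> carrier R" for d
    proof -
      define T where "T = a [^] length c"
      define P where "P = lop a c d"
      define Q where "Q = lop a c (e \<otimes> d)"
      have cl: "T \<in> carrier R" "P \<in> carrier R" "Q \<in> carrier R"
        using a cR e d unfolding T_def P_def Q_def by auto
      have "d \<otimes> T \<oplus> P = \<zero>" "e \<otimes> d \<otimes> T \<oplus> Q = \<zero>"
        using c d e cl unfolding annihilates_def T_def P_def Q_def by auto
      moreover have "e \<otimes> P \<ominus> Q = e \<otimes> (d \<otimes> T \<oplus> P) \<ominus> (e \<otimes> d \<otimes> T \<oplus> Q)"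
        using cl e d by algebra
      ultimately show ?thesis using comm[OF d] e unfolding P_def Q_def by (simp add: minus_eq)
    qed
    then have "annihilates a ?s" using cR e unfolding annihilates_def by auto
    then have "set ?s \<subseteq> {\<zero>}"
      using exists_monic_annihilator_shorter[OF a, of ?s] min by fastforce
    then have "e \<otimes> y \<ominus> y \<otimes> e = \<zero>" using y by auto
    then show ?thesis using y cR e by (simp add: subset_iff)
  qed
  then show "y \<in> ring_center R" using y cR unfolding ring_center_def by auto
qed

text \<open>Synthetic division by X - b on the right, so that X - b acts first on d. The induction
  runs from the end of the list because each remainder becomes the next coefficient of the
  quotient.\<close>

lemma right_division_by_linear:
  assumes a: "a \<in> carrier R" and b: "b \<in> carrier R" and "set t \<subseteq> carrier R" "t \<noteq> []"
  shows "\<exists>q r. set q \<subseteq> carrier R \<and> r \<in> carrier R \<and> Suc (length q) = length t \<and>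
    (\<forall>d\<in>carrier R. lop a (\<one> # t) d = lop a (\<one> # q) (d \<otimes> a \<ominus> b \<otimes> d) \<oplus> r \<otimes> d)"
  using assms(3,4)
proof (induction t rule: rev_induct)
  case (snoc y t)
  have y: "y \<in> carrier R" and t: "set t \<subseteq> carrier R" using snoc.prems by auto
  show ?case
  proof (cases "t = []")
    case True
    have "d \<otimes> a \<oplus> y \<otimes> d = (d \<otimes> a \<ominus> b \<otimes> d) \<oplus> (b \<oplus> y) \<otimes> d" if "d \<in> carrier R" for d
      using that a b y by algebra
    then show ?thesis
      using True a b y by (intro exI[of _ "[]"] exI[of _ "b \<oplus> y"]) simp
  next
    case False
    then obtain q r where q: "set q \<subseteq> carrier R" "r \<in> carrier R" "Suc (length q) = length t"
      and eq: "\<And>d. d \<in> carrier R \<Longrightarrow> lop a (\<one> # t) d = lop a (\<one> # q) (d \<otimes> a \<ominus> b \<otimes> d) \<oplus> r \<otimes> d"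
      using snoc.IH[OF t] by blast
    have "lop a (\<one> # (t @ [y])) d = lop a (\<one> # (q @ [r])) (d \<otimes> a \<ominus> b \<otimes> d) \<oplus> (r \<otimes> b \<oplus> y) \<otimes> d"
      if d: "d \<in> carrier R" for d
    proof -
      define P where "P = lop a (\<one> # q) (d \<otimes> a \<ominus> b \<otimes> d)"
      have P: "P \<in> carrier R" unfolding P_def using a b d q by (intro lop_closed) auto
      have "lop a (\<one> # (t @ [y])) d = lop a (\<one> # t) d \<otimes> a \<oplus> y \<otimes> d"
        using lop_append_one[OF a, of "\<one> # t" d y] t y d by simp
      also have "\<dots> = (P \<oplus> r \<otimes> d) \<otimes> a \<oplus> y \<otimes> d" unfolding eq[OF d] P_def ..
      also have "\<dots> = P \<otimes> a \<oplus> r \<otimes> (d \<otimes> a \<ominus> b \<otimes> d) \<oplus> (r \<otimes> b \<oplus> y) \<otimes> d"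
        using P q(2) d a b y by algebra
      also have "P \<otimes> a \<oplus> r \<otimes> (d \<otimes> a \<ominus> b \<otimes> d) = lop a (\<one> # (q @ [r])) (d \<otimes> a \<ominus> b \<otimes> d)"
        using lop_append_one[OF a, of "\<one> # q" "d \<otimes> a \<ominus> b \<otimes> d" r] a b d q unfolding P_def by simp
      finally show ?thesis .
    qed
    then show ?thesis
      using q b y by (intro exI[of _ "q @ [r]"] exI[of _ "r \<otimes> b \<oplus> y"]) auto
  qed
qed simp

text \<open>As long as the operator of the partial product \<open>c\<close> is nonzero, it has a value \<open>w \<noteq> 0\<close>, and
  \<open>X - w a w\<^sup>-\<^sup>1\<close> right-divides the remaining cofactor. The predicate \<open>Q\<close> serves to keep track of the
  residues of these factors.\<close>

theorem wedderburn_factorization: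
  assumes a: "a \<in> carrier R" and ex: "annihilates a (\<one> # r)"
    and Q1: "Q [\<one>]"
    and Q2: "\<And>c w. \<lbrakk>Q c; set c \<subseteq> carrier R; w \<in> carrier R; w \<noteq> \<zero>\<rbrakk>
               \<Longrightarrow> Q (linear_mult (w \<otimes> a \<otimes> inv w) c)"
  shows "\<exists>c. c \<noteq> [] \<and> Q (\<one> # c) \<and> set c \<subseteq> ring_center R \<and> annihilates a (\<one> # c)"
proof -
  obtain s where s: "annihilates a (\<one> # s)" and min: "\<And>t. annihilates a (\<one> # t) \<Longrightarrow> length s \<le> length t"
    using ex_has_least_nat[of "\<lambda>t. annihilates a (\<one> # t)" r length] ex by blast
  have sR: "set s \<subseteq> carrier R" using s unfolding annihilates_def by auto
  \<comment> \<open>Invariant: the minimal polynomial is the cofactor q times c, where c collects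
    the k linear factors found so far. As an operator c acts before q.\<close>
  have chain: "\<exists>c q. length c = k \<and> length q = length s - k \<and> set c \<subseteq> carrier R \<and> set q \<subseteq> carrier R \<and>
      Q (\<one> # c) \<and> (\<forall>d\<in>carrier R. lop a (\<one> # s) d = lop a (\<one> # q) (lop a (\<one> # c) d))"
    if "k \<le> length s" for k
    using that
  proof (induction k)
    case 0
    then show ?case using Q1 sR a by (intro exI[of _ "[]"] exI[of _ s]) auto
  next
    case (Suc k)
    then obtain c q where c: "length c = k" "set c \<subseteq> carrier R" "Q (\<one> # c)"
      and q: "length q = length s - k" "set q \<subseteq> carrier R"
      and eq: "\<And>d. d \<in> carrier R \<Longrightarrow> lop a (\<one> # s) d = lop a (\<one> # q) (lop a (\<one> # c) d)"
      by auto
    have "\<not> annihilates a (\<one> # c)" using min[of c] c(1) Suc.prems by auto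
    then obtain d0 where d0: "d0 \<in> carrier R" "lop a (\<one> # c) d0 \<noteq> \<zero>"
      using c(2) unfolding annihilates_def by auto
    define w where "w = lop a (\<one> # c) d0"
    have w: "w \<in> carrier R" "w \<noteq> \<zero>"
      using lop_closed[of a "\<one> # c" d0] a c(2) d0 unfolding w_def by auto
    note iw = inv_props[OF w]
    define b where "b = w \<otimes> a \<otimes> inv w"
    have b: "b \<in> carrier R" "b \<otimes> w = w \<otimes> a"
      using w a iw unfolding b_def by (auto simp: m_assoc)
    obtain q' r' where q': "set q' \<subseteq> carrier R" "r' \<in> carrier R" "Suc (length q') = length q"
      and eq': "\<And>d. d \<in> carrier R \<Longrightarrow> lop a (\<one> # q) d = lop a (\<one> # q') (d \<otimes> a \<ominus> b \<otimes> d) \<oplus> r' \<otimes> d"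
      using right_division_by_linear[OF a b(1) q(2)] q(1) Suc.prems by fastforce
    have lop0: "lop a p \<zero> = \<zero>" if "set p \<subseteq> carrier R" for p
      using that a by (induction p) auto
    \<comment> \<open>As a value of c, w is killed by q. It is also killed by X - b, because b w = w
      a. So r' w = 0, and the division by X - b is exact.\<close>
    have "\<zero> = lop a (\<one> # q) w" using s d0 eq[OF d0(1)] unfolding annihilates_def w_def by simp
    also have "\<dots> = lop a (\<one> # q') (w \<otimes> a \<ominus> b \<otimes> w) \<oplus> r' \<otimes> w" by (rule eq'[OF w(1)])
    also have "w \<otimes> a \<ominus> b \<otimes> w = \<zero>" using b w a by (simp add: minus_eq r_neg)
    also have "lop a (\<one> # q') \<zero> = \<zero>" using lop0[of "\<one> # q'"] q' by simp
    finally have "r' \<otimes> w = \<zero>" using q'(2) w by simp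
    then have r0: "r' = \<zero>" using mult_nonzero q'(2) w by blast
    obtain c' where c': "linear_mult b (\<one> # c) = \<one> # c'" using linear_mult_monic by blast
    have lc: "length c' = Suc k" using arg_cong[OF c', of length] c(1) by simp
    have c'R: "set c' \<subseteq> carrier R" using linear_mult_closed[of "\<one> # c" b] c(2) b c' by auto
    have "Q (\<one> # c')" using Q2[OF c(3) _ w] c(2) c' unfolding b_def by simp
    moreover have "lop a (\<one> # s) d = lop a (\<one> # q') (lop a (\<one> # c') d)" if d: "d \<in> carrier R" for d
    proof -
      define y where "y = lop a (\<one> # c) d"
      have y: "y \<in> carrier R" unfolding y_def using lop_closed[of a "\<one> # c" d] a c(2) d by simp
      have "lop a (\<one> # c') d = y \<otimes> a \<ominus> b \<otimes> y"
        using lop_linear_mult[OF a _ d b(1), of "\<one> # c"] c(2) c' unfolding y_def by simp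
      moreover have "lop a (\<one> # s) d = lop a (\<one> # q') (y \<otimes> a \<ominus> b \<otimes> y)"
        using eq[OF d] eq'[OF y] r0 y q'(1) a b(1) lop_closed[of a "\<one> # q'" "y \<otimes> a \<ominus> b \<otimes> y"]
        unfolding y_def[symmetric] by simp
      ultimately show ?thesis by simp
    qed
    ultimately show ?case using lc c'R q' q(1) by (intro exI[of _ c'] exI[of _ q']) auto
  qed
  obtain c where c: "length c = length s" "set c \<subseteq> carrier R" "Q (\<one> # c)"
    and eq: "\<And>d. d \<in> carrier R \<Longrightarrow> lop a (\<one> # s) d = lop a [\<one>] (lop a (\<one> # c) d)"
    using chain[of "length s"] by auto
  have "lop a (\<one> # c) d = \<zero>" if d: "d \<in> carrier R" for d
  proof -
    have "lop a (\<one> # c) d \<in> carrier R" using lop_closed[of a "\<one> # c" d] a c(2) d by simp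
    then show ?thesis using eq[OF d] s d unfolding annihilates_def by simp
  qed
  then have ann: "annihilates a (\<one> # c)" using c(2) unfolding annihilates_def by simp
  \<comment> \<open>The full product has the degree of a minimal annihilator, so the commutator
    argument applies to it as well.\<close>
  then have "set c \<subseteq> ring_center R"
    using minimal_annihilator_central[OF a] min c(1) by simp
  moreover have "c \<noteq> []"
  proof
    assume "c = []"
    then have "lop a [\<one>] \<one> = \<zero>" using ann unfolding annihilates_def by simp
    then show False using one_neq_zero by simp
  qed
  ultimately show ?thesis using c(3) ann by blast
qed

text \<open>Finite dimension makes the powers of a linearly dependent over F. Central coefficients
  move past d, so the operator of such a relation is d times its value at a, which is zero.\<close>

lemma exists_annihilator:
  assumes F: "subfield F R" "F \<subseteq> ring_center R" "finite_dimension F (carrier R)" and a: "a \<in> carrier R"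
  shows "\<exists>r. annihilates a (\<one> # r)"
proof -
  obtain n where n: "dimension n F (carrier R)" using F(3) unfolding finite_dimension_def by blast
  have base: "set (exp_base a (Suc n)) \<subseteq> carrier R" by (rule exp_base_closed[OF a])
  have "dependent F (exp_base a (Suc n))"
  proof
    assume "independent F (exp_base a (Suc n))"
    from independent_length_le_dimension[OF F(1) n this base] show False
      by (simp add: exp_base_def)
  qed
  then obtain Ks where Ks: "length Ks = length (exp_base a (Suc n))"
      "combine Ks (exp_base a (Suc n)) = \<zero>" "set Ks \<subseteq> F" "set Ks \<noteq> {\<zero>}"
    using dependent_imp_non_trivial_combine[OF F(1) base] by blast
  have len: "length Ks = Suc n" using Ks(1) by (simp add: exp_base_def)
  have KsR: "set Ks \<subseteq> carrier R" using Ks(3) F(2) unfolding ring_center_def by blast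
  have ev: "eval Ks a = \<zero>" using combine_eq_eval[of Ks a] Ks(2) len by simp
  have "lop a Ks d = d \<otimes> eval Ks a" if d: "d \<in> carrier R" for d
    using Ks(3)
  proof (induction Ks)
    case (Cons k Ks)
    have k: "k \<in> carrier R" "k \<otimes> d = d \<otimes> k" using Cons.prems F(2) d unfolding ring_center_def by auto
    have K: "set Ks \<subseteq> carrier R" using Cons.prems F(2) unfolding ring_center_def by auto
    have "k \<otimes> (d \<otimes> T) = d \<otimes> (k \<otimes> T)" if "T \<in> carrier R" for T
      using that k d by (simp add: m_assoc[symmetric])
    then show ?case
      using Cons k(1) d a eval_in_carrier[OF K a] by (simp add: r_distr)
  qed (use d in simp)
  then have "annihilates a Ks" using ev KsR unfolding annihilates_def by simp
  moreover have "\<not> set Ks \<subseteq> {\<zero>}" using Ks(4) len by (cases Ks) auto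
  ultimately show ?thesis using exists_monic_annihilator_shorter[OF a] by blast
qed

end

section \<open>Valued division rings\<close>

locale valued_division_ring = division_ring +
  fixes F :: "'a set" and v :: "'a \<Rightarrow> 'g::linordered_ab_group_add"
  assumes F_eq: "F = ring_center R" and valuation: "valuation R v"
begin

abbreviation "V \<equiv> valuation_ring R v"
abbreviation "M \<equiv> valuation_ideal R v"
abbreviation "E \<equiv> residue_ring R v"
abbreviation "K \<equiv> residue_subfield R v F"
abbreviation "res \<equiv> residue R v"

lemma v_mult:
  "\<lbrakk>x \<in> carrier R; y \<in> carrier R; x \<noteq> \<zero>; y \<noteq> \<zero>\<rbrakk> \<Longrightarrow> v (x \<otimes> y) = v x + v y"
  using valuation unfolding valuation_def by simp

lemma v_add:
  "\<lbrakk>x \<in> carrier R; y \<in> carrier R; x \<noteq> \<zero>; y \<noteq> \<zero>; x \<oplus> y \<noteq> \<zero>\<rbrakk> \<Longrightarrow> min (v x) (v y) \<le> v (x \<oplus> y)"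
  using valuation unfolding valuation_def by simp

lemma v_one [simp]: "v \<one> = 0"
  using v_mult[of \<one> \<one>] one_neq_zero by simp

lemma v_inv: "\<lbrakk>x \<in> carrier R; x \<noteq> \<zero>\<rbrakk> \<Longrightarrow> v (inv x) = - v x"
  using v_mult[of x "inv x"] inv_props[of x] by (simp add: eq_neg_iff_add_eq_0 add.commute)

lemma v_uminus: "\<lbrakk>x \<in> carrier R; x \<noteq> \<zero>\<rbrakk> \<Longrightarrow> v (\<ominus> x) = v x"
proof -
  assume x: "x \<in> carrier R" "x \<noteq> \<zero>"
  have ne: "\<ominus> \<one> \<noteq> \<zero>" using one_neq_zero by (metis minus_minus minus_zero one_closed)
  have "v ((\<ominus> \<one>) \<otimes> (\<ominus> \<one>)) = v (\<ominus> \<one>) + v (\<ominus> \<one>)" using v_mult ne by simp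
  then have "v (\<ominus> \<one>) = 0" by (simp add: l_minus)
  then show ?thesis using v_mult[of "\<ominus> \<one>" x] x ne by (simp add: l_minus)
qed

lemma v_add_ge:
  assumes "x \<in> carrier R" "y \<in> carrier R" "x = \<zero> \<or> g \<le> v x" "y = \<zero> \<or> g \<le> v y"
  shows "x \<oplus> y = \<zero> \<or> g \<le> v (x \<oplus> y)"
proof (cases "x = \<zero> \<or> y = \<zero> \<or> x \<oplus> y = \<zero>")
  case False
  then have "g \<le> min (v x) (v y)" using assms by simp
  also have "\<dots> \<le> v (x \<oplus> y)" using False assms by (intro v_add) auto
  finally show ?thesis by blast
qed (use assms in auto)

lemma v_add_gt:
  assumes "x \<in> carrier R" "y \<in> carrier R" "x = \<zero> \<or> g < v x" "y = \<zero> \<or> g < v y"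
  shows "x \<oplus> y = \<zero> \<or> g < v (x \<oplus> y)"
proof (cases "x = \<zero> \<or> y = \<zero> \<or> x \<oplus> y = \<zero>")
  case False
  then have "g < min (v x) (v y)" using assms by simp
  also have "\<dots> \<le> v (x \<oplus> y)" using False assms by (intro v_add) auto
  finally show ?thesis by blast
qed (use assms in auto)

lemma v_add_eq:
  assumes x: "x \<in> carrier R" "x \<noteq> \<zero>" and y: "y \<in> carrier R" "y = \<zero> \<or> v x < v y"
  shows "x \<oplus> y \<noteq> \<zero> \<and> v (x \<oplus> y) = v x"
proof (cases "y = \<zero>")
  case False
  then have lt: "v x < v y" using y by simp
  have my: "\<ominus> y \<noteq> \<zero>" "v (\<ominus> y) = v y" using v_uminus y False by (auto simp: add.inv_eq_1_iff)
  have ne: "x \<oplus> y \<noteq> \<zero>"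
  proof
    assume "x \<oplus> y = \<zero>"
    then have "x = \<ominus> y" using x y by (simp add: minus_equality)
    then show False using my lt by simp
  qed
  have "(x \<oplus> y) \<oplus> \<ominus> y = x" using x y by (simp add: a_assoc r_neg)
  then have "min (v (x \<oplus> y)) (v y) \<le> v x"
    using v_add[of "x \<oplus> y" "\<ominus> y"] x y ne my by simp
  then have "v (x \<oplus> y) \<le> v x" using lt by (auto simp: min_le_iff_disj dest: leD)
  moreover have "min (v x) (v y) = v x" using lt by (simp add: min_absorb1)
  then have "v x \<le> v (x \<oplus> y)" using v_add[of x y] x y False ne by simp
  ultimately show ?thesis using ne by simp
qed (use x in simp)

lemma V_iff: "x \<in> V \<longleftrightarrow> x \<in> carrier R \<and> (x = \<zero> \<or> 0 \<le> v x)"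
  unfolding valuation_ring_def by simp

lemma M_iff: "x \<in> M \<longleftrightarrow> x \<in> carrier R \<and> (x = \<zero> \<or> 0 < v x)"
  unfolding valuation_ideal_def by simp

lemma V_carrier: "x \<in> V \<Longrightarrow> x \<in> carrier R" and M_V: "x \<in> M \<Longrightarrow> x \<in> V"
  by (auto simp: V_iff M_iff)

lemma V_subring: "subring V R"
proof (rule subringI)
  show "\<ominus> h \<in> V" if "h \<in> V" for h
    using that v_uminus[of h] by (cases "h = \<zero>") (auto simp: V_iff)
  show "\<And>x y. \<lbrakk>x \<in> V; y \<in> V\<rbrakk> \<Longrightarrow> x \<otimes> y \<in> V" using v_mult by (fastforce simp: V_iff)
  show "\<And>x y. \<lbrakk>x \<in> V; y \<in> V\<rbrakk> \<Longrightarrow> x \<oplus> y \<in> V" using v_add_ge by (auto simp: V_iff)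
qed (auto simp: V_iff)

sublocale V_ring: ring "R\<lparr>carrier := V\<rparr>"
  by (rule subring_is_ring[OF V_subring])

lemma M_ideal: "ideal M (R\<lparr>carrier := V\<rparr>)"
proof (rule idealI)
  have mult: "x \<otimes> y \<in> M \<and> y \<otimes> x \<in> M" if "x \<in> M" "y \<in> V" for x y
    using that v_mult[of x y] v_mult[of y x]
    by (cases "x = \<zero>"; cases "y = \<zero>") (auto simp: V_iff M_iff add_pos_nonneg add_nonneg_pos)
  show "\<And>a x. \<lbrakk>a \<in> M; x \<in> carrier (R\<lparr>carrier := V\<rparr>)\<rbrakk> \<Longrightarrow> x \<otimes>\<^bsub>R\<lparr>carrier := V\<rparr>\<^esub> a \<in> M"
    "\<And>a x. \<lbrakk>a \<in> M; x \<in> carrier (R\<lparr>carrier := V\<rparr>)\<rbrakk> \<Longrightarrow> a \<otimes>\<^bsub>R\<lparr>carrier := V\<rparr>\<^esub> x \<in> M"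
    using mult by auto
  show "subgroup M (add_monoid (R\<lparr>carrier := V\<rparr>))"
  proof (rule V_ring.add.subgroupI)
    fix a b assume a: "a \<in> M" and b: "b \<in> M"
    have "\<ominus> \<one> \<in> V" using V_subring by (simp add: subringE)
    from mult[OF a this] have "\<ominus> a \<in> M" using a by (simp add: l_minus M_iff)
    moreover have "\<ominus>\<^bsub>R\<lparr>carrier := V\<rparr>\<^esub> a = \<ominus> a"
      using M_V[OF a] V_carrier V_subring \<open>\<ominus> a \<in> M\<close> M_V
      by (intro V_ring.minus_equality) (auto simp: l_neg)
    ultimately show "\<ominus>\<^bsub>R\<lparr>carrier := V\<rparr>\<^esub> a \<in> M" by simp
    show "a \<oplus>\<^bsub>R\<lparr>carrier := V\<rparr>\<^esub> b \<in> M" using v_add_gt[of a b 0] a b by (simp add: M_iff)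
  next
    have "\<zero> \<in> M" by (simp add: M_iff)
    then show "M \<noteq> {}" by blast
  qed (auto simp: M_V)
qed (rule V_ring.ring_axioms)

sublocale M: ideal M "R\<lparr>carrier := V\<rparr>"
  by (rule M_ideal)

sublocale E: ring E
  unfolding residue_ring_def by (rule M.quotient_is_ring)

lemma res_eq: "res x = M +>\<^bsub>R\<lparr>carrier := V\<rparr>\<^esub> x"
  unfolding residue_def a_r_coset_def' by simp

lemma res_hom: "res \<in> ring_hom (R\<lparr>carrier := V\<rparr>) E"
  unfolding residue_ring_def res_eq[abs_def] by (rule M.rcos_ring_hom)

lemma res_closed [simp]: "x \<in> V \<Longrightarrow> res x \<in> carrier E"
  using ring_hom_closed[OF res_hom] by simp

lemma res_mult: "\<lbrakk>x \<in> V; y \<in> V\<rbrakk> \<Longrightarrow> res (x \<otimes> y) = res x \<otimes>\<^bsub>E\<^esub> res y"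
  using ring_hom_mult[OF res_hom] by simp

lemma res_add: "\<lbrakk>x \<in> V; y \<in> V\<rbrakk> \<Longrightarrow> res (x \<oplus> y) = res x \<oplus>\<^bsub>E\<^esub> res y"
  using ring_hom_add[OF res_hom] by simp

lemma res_one [simp]: "res \<one> = \<one>\<^bsub>E\<^esub>"
  using ring_hom_one[OF res_hom] by simp

lemma V_simps [simp]: "\<zero> \<in> V" "\<one> \<in> V"
  using V_subring by (simp_all add: subringE)

lemma V_closed: "\<lbrakk>x \<in> V; y \<in> V\<rbrakk> \<Longrightarrow> x \<otimes> y \<in> V" "\<lbrakk>x \<in> V; y \<in> V\<rbrakk> \<Longrightarrow> x \<oplus> y \<in> V" "x \<in> V \<Longrightarrow> \<ominus> x \<in> V"
    "\<lbrakk>x \<in> V; y \<in> V\<rbrakk> \<Longrightarrow> x \<ominus> y \<in> V"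
  using V_subring by (simp_all add: subringE minus_eq)

lemma res_zero [simp]: "res \<zero> = \<zero>\<^bsub>E\<^esub>"
  using ring_hom_zero[OF res_hom V_ring.ring_axioms E.ring_axioms] by simp

lemma res_uminus: "x \<in> V \<Longrightarrow> res (\<ominus> x) = \<ominus>\<^bsub>E\<^esub> res x"
proof -
  assume x: "x \<in> V"
  have "res (\<ominus> x) \<oplus>\<^bsub>E\<^esub> res x = res (\<ominus> x \<oplus> x)" using x V_closed(3) by (simp add: res_add)
  also have "\<dots> = \<zero>\<^bsub>E\<^esub>" using V_carrier[OF x] by (simp add: l_neg)
  finally show ?thesis using x V_closed(3) by (metis E.minus_equality res_closed)
qed

lemma res_surj: "C \<in> carrier E \<Longrightarrow> \<exists>x\<in>V. C = res x"
  unfolding residue_ring_def FactRing_def A_RCOSETS_def RCOSETS_def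
  by (auto simp: res_eq a_r_coset_def)

lemma res_eq_iff: "\<lbrakk>x \<in> V; y \<in> V\<rbrakk> \<Longrightarrow> res x = res y \<longleftrightarrow> x \<ominus> y \<in> M"
proof -
  assume xy: "x \<in> V" "y \<in> V"
  have zero: "res z = \<zero>\<^bsub>E\<^esub> \<longleftrightarrow> z \<in> M" if "z \<in> V" for z
  proof
    have z0: "\<zero>\<^bsub>E\<^esub> = M" by (simp add: residue_ring_def FactRing_def)
    show "z \<in> M" if "res z = \<zero>\<^bsub>E\<^esub>"
      using M.a_rcos_self[of z] \<open>z \<in> V\<close> that z0 by (simp add: res_eq)
    show "res z = \<zero>\<^bsub>E\<^esub>" if "z \<in> M"
      using M.a_rcos_const[OF that] z0 by (simp add: res_eq)
  qed
  have "res (x \<ominus> y) = res x \<ominus>\<^bsub>E\<^esub> res y"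
    using xy V_closed by (simp add: minus_eq E.minus_eq res_add res_uminus)
  moreover have "res x \<ominus>\<^bsub>E\<^esub> res y = \<zero>\<^bsub>E\<^esub> \<longleftrightarrow> res x = res y"
    using xy by (intro E.r_right_minus_eq) simp_all
  ultimately show ?thesis using zero[OF V_closed(4)[OF xy]] by (simp only:)
qed

lemma res_zero_iff: "x \<in> V \<Longrightarrow> res x = \<zero>\<^bsub>E\<^esub> \<longleftrightarrow> x \<in> M"
  using res_eq_iff[of x \<zero>] V_carrier by (simp add: minus_eq)

lemma unit_V:
  assumes "x \<in> carrier R" "x \<noteq> \<zero>" "v x = 0"
  shows "x \<in> V" "inv x \<in> V" "res x \<noteq> \<zero>\<^bsub>E\<^esub>" "res x \<otimes>\<^bsub>E\<^esub> res (inv x) = \<one>\<^bsub>E\<^esub>"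
    "res (inv x) \<otimes>\<^bsub>E\<^esub> res x = \<one>\<^bsub>E\<^esub>"
proof -
  note i = inv_props[OF assms(1,2)]
  show V: "x \<in> V" "inv x \<in> V" using assms i v_inv by (auto simp: V_iff)
  show "res x \<noteq> \<zero>\<^bsub>E\<^esub>" using assms V res_zero_iff by (simp add: M_iff)
  show "res x \<otimes>\<^bsub>E\<^esub> res (inv x) = \<one>\<^bsub>E\<^esub>" "res (inv x) \<otimes>\<^bsub>E\<^esub> res x = \<one>\<^bsub>E\<^esub>"
    using V i by (simp_all flip: res_mult)
qed

lemma res_nonzero: "\<lbrakk>x \<in> V; res x \<noteq> \<zero>\<^bsub>E\<^esub>\<rbrakk> \<Longrightarrow> x \<noteq> \<zero> \<and> v x = 0"
  using res_zero_iff[of x] by (auto simp: V_iff M_iff)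

abbreviation conjugate :: "'a \<Rightarrow> 'a \<Rightarrow> 'a" where "conjugate a x \<equiv> a \<otimes> x \<otimes> inv a"

lemma conjugate_props:
  assumes a: "a \<in> carrier R" "a \<noteq> \<zero>" and x: "x \<in> carrier R"
  shows "conjugate a x \<in> carrier R" "conjugate a x = \<zero> \<longleftrightarrow> x = \<zero>" "x \<noteq> \<zero> \<Longrightarrow> v (conjugate a x) = v x"
    "x \<in> V \<Longrightarrow> conjugate a x \<in> V" "x \<in> M \<Longrightarrow> conjugate a x \<in> M"
proof -
  note i = inv_props[OF a]
  show 1: "conjugate a x \<in> carrier R" using a x i by simp
  show 2: "conjugate a x = \<zero> \<longleftrightarrow> x = \<zero>" using a x i by (simp add: mult_zero_iff)
  show 3: "v (conjugate a x) = v x" if "x \<noteq> \<zero>"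
    using that a x i by (simp add: v_mult v_inv mult_nonzero)
  show "x \<in> V \<Longrightarrow> conjugate a x \<in> V" "x \<in> M \<Longrightarrow> conjugate a x \<in> M" using 1 2 3 by (auto simp: V_iff M_iff)
qed

lemma conjugate_mult:
  assumes a: "a \<in> carrier R" "a \<noteq> \<zero>" and xy: "x \<in> carrier R" "y \<in> carrier R"
  shows "conjugate a (x \<otimes> y) = conjugate a x \<otimes> conjugate a y"
proof -
  note i = inv_props[OF a]
  have "conjugate a x \<otimes> conjugate a y = a \<otimes> x \<otimes> (inv a \<otimes> a) \<otimes> y \<otimes> inv a" using a xy i(1) by (simp add: m_assoc)
  then show ?thesis using a xy i by (simp add: m_assoc)
qed

lemma conjugate_add:
  assumes a: "a \<in> carrier R" "a \<noteq> \<zero>" and xy: "x \<in> carrier R" "y \<in> carrier R"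
  shows "conjugate a (x \<oplus> y) = conjugate a x \<oplus> conjugate a y"
  using a xy inv_props[OF a] by (simp add: l_distr r_distr)

lemma inv_mult:
  assumes a: "a \<in> carrier R" "a \<noteq> \<zero>" and b: "b \<in> carrier R" "b \<noteq> \<zero>"
  shows "inv (a \<otimes> b) = inv b \<otimes> inv a"
proof -
  note i = inv_props[OF a] and j = inv_props[OF b]
  have "a \<otimes> b \<otimes> (inv b \<otimes> inv a) = a \<otimes> (b \<otimes> inv b) \<otimes> inv a"
    "inv b \<otimes> inv a \<otimes> (a \<otimes> b) = inv b \<otimes> (inv a \<otimes> a) \<otimes> b"
    using a b i(1) j(1) by (simp_all add: m_assoc)
  then show ?thesis using a b i j by (intro inv_char) simp_all
qed

lemma conjugate_conjugate:
  assumes a: "a \<in> carrier R" "a \<noteq> \<zero>" and b: "b \<in> carrier R" "b \<noteq> \<zero>" and x: "x \<in> carrier R"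
  shows "conjugate (a \<otimes> b) x = conjugate a (conjugate b x)"
  unfolding inv_mult[OF a b] using a b x inv_props[OF a] inv_props[OF b] by (simp add: m_assoc)

lemma conjugate_inv_conjugate:
  assumes a: "a \<in> carrier R" "a \<noteq> \<zero>" and x: "x \<in> carrier R"
  shows "conjugate (inv a) (conjugate a x) = x" "conjugate a (conjugate (inv a) x) = x"
proof -
  note i = inv_props[OF a]
  have "inv (inv a) = a" using a by (intro Units_inv_inv) (simp add: Units_eq)
  then show "conjugate (inv a) (conjugate a x) = x" "conjugate a (conjugate (inv a) x) = x"
    using conjugate_conjugate[OF i(1,4) a x] conjugate_conjugate[OF a i(1,4) x] i x by simp_all
qed

text \<open>\<open>theta\<close> acts on a coset as a set. Conjugation by a maps the valuation ideal
  onto itself, its inverse being conjugation by \<open>inv a\<close>, so the image is the whole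
  coset of the conjugate.\<close>

lemma theta_res:
  assumes a: "a \<in> carrier R" "a \<noteq> \<zero>" and x: "x \<in> V"
  shows "theta R v a (res x) = res (conjugate a x)"
proof -
  note i = inv_props[OF a]
  have xR: "x \<in> carrier R" by (rule V_carrier[OF x])
  have coset: "res y = (\<lambda>m. m \<oplus> y) ` M" for y unfolding residue_def a_r_coset_def' by auto
  have "conjugate a ` res x = res (conjugate a x)"
  proof
    show "conjugate a ` res x \<subseteq> res (conjugate a x)"
      using conjugate_add[OF a _ xR] conjugate_props(5)[OF a] unfolding coset by (auto simp: M_iff)
    show "res (conjugate a x) \<subseteq> conjugate a ` res x"
    proof
      fix y assume "y \<in> res (conjugate a x)"
      then obtain m where m: "m \<in> M" "y = m \<oplus> conjugate a x" unfolding coset by auto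
      have mR: "m \<in> carrier R" using m by (simp add: M_iff)
      have m': "conjugate (inv a) m \<in> M" using conjugate_props(5)[OF i(1,4) mR m(1)] .
      have "conjugate a (conjugate (inv a) m \<oplus> x) = conjugate a (conjugate (inv a) m) \<oplus> conjugate a x"
        using m' xR by (intro conjugate_add[OF a]) (simp_all add: M_iff)
      then have "y = conjugate a (conjugate (inv a) m \<oplus> x)" using conjugate_inv_conjugate(2)[OF a mR] m(2) by simp
      then show "y \<in> conjugate a ` res x" using m' unfolding coset by blast
    qed
  qed
  then show ?thesis using x unfolding theta_def by simp
qed

lemma theta_ext: "theta R v a \<in> extensional (carrier E)"
  unfolding theta_def by simp

lemma theta_closed:
  assumes "a \<in> carrier R" "a \<noteq> \<zero>" "y \<in> carrier E"
  shows "theta R v a y \<in> carrier E"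
  using res_surj[OF assms(3)] theta_res[OF assms(1,2)] conjugate_props(4)[OF assms(1,2)] V_carrier by auto

lemma theta_hom:
  assumes a: "a \<in> carrier R" "a \<noteq> \<zero>"
  shows "theta R v a \<in> ring_hom E E"
proof (rule ring_hom_memI)
  fix y z assume "y \<in> carrier E" "z \<in> carrier E"
  then obtain s t where st: "s \<in> V" "y = res s" "t \<in> V" "z = res t" using res_surj by blast
  note c = V_carrier[OF st(1)] V_carrier[OF st(3)]
  show "theta R v a (y \<otimes>\<^bsub>E\<^esub> z) = theta R v a y \<otimes>\<^bsub>E\<^esub> theta R v a z"
    using st c theta_res[OF a] conjugate_props(4)[OF a] V_closed(1) conjugate_mult[OF a c] by (simp flip: res_mult)
  show "theta R v a (y \<oplus>\<^bsub>E\<^esub> z) = theta R v a y \<oplus>\<^bsub>E\<^esub> theta R v a z"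
    using st c theta_res[OF a] conjugate_props(4)[OF a] V_closed(2) conjugate_add[OF a c] by (simp flip: res_add)
next
  show "theta R v a \<one>\<^bsub>E\<^esub> = \<one>\<^bsub>E\<^esub>"
    using theta_res[OF a V_simps(2)] a inv_props[OF a] by simp
qed (use theta_closed[OF a] in auto)

lemma theta_mult:
  assumes a: "a \<in> carrier R" "a \<noteq> \<zero>" and b: "b \<in> carrier R" "b \<noteq> \<zero>"
  shows "theta R v (a \<otimes> b) = compose (carrier E) (theta R v a) (theta R v b)"
proof (rule extensionalityI[of _ "carrier E"])
  fix y assume y: "y \<in> carrier E"
  then obtain x where x: "x \<in> V" "y = res x" using res_surj by blast
  show "theta R v (a \<otimes> b) y = compose (carrier E) (theta R v a) (theta R v b) y"
    using theta_res[OF _ _ x(1), of "a \<otimes> b"] theta_res[OF b x(1)]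
      theta_res[OF a conjugate_props(4)[OF b V_carrier[OF x(1)] x(1)]] conjugate_conjugate[OF a b V_carrier[OF x(1)]]
      mult_nonzero a b y x(2) by (simp add: compose_eq)
qed (auto simp: theta_ext compose_def)

lemma theta_one: "theta R v \<one> = (\<lambda>y\<in>carrier E. y)"
proof (rule extensionalityI[of _ "carrier E"])
  fix y assume y: "y \<in> carrier E"
  then obtain x where x: "x \<in> V" "y = res x" using res_surj by blast
  then show "theta R v \<one> y = (\<lambda>y\<in>carrier E. y) y"
    using theta_res[OF one_closed one_neq_zero x(1)] V_carrier y by simp
qed (auto simp: theta_ext)

lemma theta_inv_theta:
  assumes a: "a \<in> carrier R" "a \<noteq> \<zero>" and y: "y \<in> carrier E"
  shows "theta R v (inv a) (theta R v a y) = y" "theta R v a (theta R v (inv a) y) = y"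
proof -
  note i = inv_props[OF a]
  show "theta R v (inv a) (theta R v a y) = y"
    using fun_cong[OF theta_mult[OF i(1,4) a], of y] theta_one i y by (simp add: compose_eq)
  show "theta R v a (theta R v (inv a) y) = y"
    using fun_cong[OF theta_mult[OF a i(1,4)], of y] theta_one i y by (simp add: compose_eq)
qed

lemma F_subfield: "subfield F R"
proof (rule subfieldI)
  have zc: "\<And>z x. \<lbrakk>z \<in> F; x \<in> carrier R\<rbrakk> \<Longrightarrow> z \<otimes> x = x \<otimes> z" and Fc: "\<And>z. z \<in> F \<Longrightarrow> z \<in> carrier R"
    unfolding F_eq ring_center_def by auto
  have FI: "\<And>z. \<lbrakk>z \<in> carrier R; \<And>x. x \<in> carrier R \<Longrightarrow> z \<otimes> x = x \<otimes> z\<rbrakk> \<Longrightarrow> z \<in> F"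
    unfolding F_eq ring_center_def by auto
  show "subcring F R"
  proof (rule subcringI[OF subringI])
    fix h assume h: "h \<in> F"
    show "\<ominus> h \<in> F" using h zc Fc by (intro FI) (auto simp: l_minus r_minus)
    fix g assume g: "g \<in> F"
    show "h \<oplus> g \<in> F" using h g zc Fc by (intro FI) (auto simp: l_distr r_distr)
    show "h \<otimes> g \<in> F"
    proof (rule FI)
      fix x assume x: "x \<in> carrier R"
      have "h \<otimes> g \<otimes> x = h \<otimes> (x \<otimes> g)" using h g x Fc zc[OF g x] by (simp add: m_assoc)
      also have "\<dots> = x \<otimes> (h \<otimes> g)" using h g x Fc zc[OF h x] by (simp flip: m_assoc)
      finally show "h \<otimes> g \<otimes> x = x \<otimes> (h \<otimes> g)" .
    qed (use h g Fc in simp)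
  qed (use zc Fc in \<open>auto intro!: FI\<close>)
  show "Units (R\<lparr>carrier := F\<rparr>) = F - {\<zero>}"
  proof
    show "Units (R\<lparr>carrier := F\<rparr>) \<subseteq> F - {\<zero>}"
      using one_neq_zero Fc unfolding Units_def by auto
    show "F - {\<zero>} \<subseteq> Units (R\<lparr>carrier := F\<rparr>)"
    proof
      fix z assume z: "z \<in> F - {\<zero>}"
      then have zR: "z \<in> carrier R" "z \<noteq> \<zero>" using Fc by auto
      note i = inv_props[OF zR]
      have "inv z \<in> F"
      proof (rule FI[OF i(1)])
        fix x assume x: "x \<in> carrier R"
        have "inv z \<otimes> x = inv z \<otimes> (x \<otimes> z) \<otimes> inv z" using x zR i by (simp add: m_assoc)
        also have "\<dots> = inv z \<otimes> (z \<otimes> x) \<otimes> inv z" using zc[of z x] z x by simp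
        also have "\<dots> = (inv z \<otimes> z) \<otimes> x \<otimes> inv z" using x zR i(1) by (simp add: m_assoc)
        finally show "inv z \<otimes> x = x \<otimes> inv z" using x i by simp
      qed
      then show "z \<in> Units (R\<lparr>carrier := F\<rparr>)" using z i unfolding Units_def by auto
    qed
  qed
qed

lemma F_carrier: "z \<in> F \<Longrightarrow> z \<in> carrier R"
  unfolding F_eq ring_center_def by auto

lemma F_commute: "\<lbrakk>z \<in> F; x \<in> carrier R\<rbrakk> \<Longrightarrow> z \<otimes> x = x \<otimes> z"
  unfolding F_eq ring_center_def by auto

lemma F_inv: "\<lbrakk>z \<in> F; z \<noteq> \<zero>\<rbrakk> \<Longrightarrow> inv z \<in> F"
  using subfield_m_inv(1)[OF F_subfield, of z] by simp

lemmas F_closed = subringE[OF subfieldE(1)[OF F_subfield]]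

lemma K_iff: "y \<in> K \<longleftrightarrow> (\<exists>x\<in>F \<inter> V. y = res x)"
  unfolding residue_subfield_def by auto

lemma theta_K:
  assumes a: "a \<in> carrier R" "a \<noteq> \<zero>" and y: "y \<in> K"
  shows "theta R v a y = y"
proof -
  obtain x where x: "x \<in> F" "x \<in> V" "y = res x" using y unfolding K_iff by blast
  have "conjugate a x = x"
    unfolding F_commute[OF x(1) a(1), symmetric] using F_carrier[OF x(1)] inv_props[OF a] a
    by (simp add: m_assoc)
  then show ?thesis using theta_res[OF a x(2)] x(3) by simp
qed

end

section \<open>The Galois group of the residue field\<close>

text \<open>The leading coefficient stays one, so normalization changes nothing and the product is
  literally the formula of \<open>linear_mult\<close>. This allows residues of a Wedderburn product
  to be compared coefficient by coefficient.\<close>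

lemma (in domain) linear_mult_monic_list:
  assumes x: "x \<in> carrier R" and p: "set p \<subseteq> carrier R"
  shows "[\<one>, \<ominus> x] \<otimes>\<^bsub>poly_ring R\<^esub> (\<one> # p) =
    map2 (\<oplus>) ((\<one> # p) @ [\<zero>]) (\<zero> # map (\<lambda>y. \<ominus> (x \<otimes> y)) (\<one> # p))"
proof -
  let ?p = "\<one> # p"
  let ?q = "map (\<lambda>y. \<ominus> (x \<otimes> y)) ?p"
  have p1: "set ?p \<subseteq> carrier R" and q: "set ?q \<subseteq> carrier R" using p x by auto
  have m: "map ((\<otimes>) \<one>) ?p = ?p" "map ((\<otimes>) (\<ominus> x)) ?p = ?q"
    using p x by (auto simp: subset_iff l_minus intro!: map_idI)
  have "[\<one>, \<ominus> x] \<otimes>\<^bsub>poly_ring R\<^esub> ?p =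
      poly_add (map ((\<otimes>) \<one>) ?p @ [\<zero>]) (poly_add (map ((\<otimes>) (\<ominus> x)) ?p) [])"
    by (simp add: univ_poly_mult del: poly_add.simps list.map)
  also have "\<dots> = poly_add (?p @ [\<zero>]) (poly_add ?q [])" unfolding m ..
  also have "poly_add ?q [] = normalize ?q"
    using poly_add_zero'(1)[OF q] .
  also have "poly_add (?p @ [\<zero>]) (normalize ?q) = poly_add (?p @ [\<zero>]) ?q"
    by (rule poly_add_normalize(2)[symmetric]) (use p1 q in auto)
  also have "\<dots> = map2 (\<oplus>) (?p @ [\<zero>]) (\<zero> # ?q)"
    by (simp add: Suc_diff_le)
  finally show ?thesis .
qed

locale semi_ramified_division_ring = valued_division_ring R F v
  for R :: "('a, 'b) ring_scheme" (structure) and F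
    and v :: "'a \<Rightarrow> 'g::linordered_ab_group_add" +
  assumes finite_dim: "finite_dimension F (carrier R)"
    and semi_ramified: "semi_ramified R F v"
    and separable: "separable_extension E K"
begin

lemma E_field: "field E"
  using semi_ramified unfolding semi_ramified_def Let_def by blast

sublocale Ef: field E
  by (rule E_field)

definition "\<Gamma>F = v ` (F - {\<zero>})"

text \<open>The coset \<Gamma>_F + v(a), written on the side on which \<open>r_coset\<close>
  unfolds, so that the classes are literally the elements of the quotient group in
  \<open>semi_ramified\<close>.\<close>

definition val_class :: "'a \<Rightarrow> 'g set" where
  "val_class a = (\<lambda>g. g + v a) ` \<Gamma>F"

definition "val_classes = val_class ` (carrier R - {\<zero>})"

lemma \<Gamma>F_closed: "0 \<in> \<Gamma>F" "\<lbrakk>g \<in> \<Gamma>F; h \<in> \<Gamma>F\<rbrakk> \<Longrightarrow> g + h \<in> \<Gamma>F" "g \<in> \<Gamma>F \<Longrightarrow> - g \<in> \<Gamma>F"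
proof -
  show "0 \<in> \<Gamma>F" unfolding \<Gamma>F_def using F_closed one_neq_zero v_one by force
  show "g + h \<in> \<Gamma>F" if gh: "g \<in> \<Gamma>F" "h \<in> \<Gamma>F"
  proof -
    obtain a b where "a \<in> F" "a \<noteq> \<zero>" "g = v a" "b \<in> F" "b \<noteq> \<zero>" "h = v b"
      using gh unfolding \<Gamma>F_def by auto
    then show ?thesis unfolding \<Gamma>F_def
      using v_mult[of a b] mult_nonzero[of a b] F_closed F_carrier by (intro image_eqI[of _ _ "a \<otimes> b"]) auto
  qed
  show "- g \<in> \<Gamma>F" if g: "g \<in> \<Gamma>F"
  proof -
    obtain a where "a \<in> F" "a \<noteq> \<zero>" "g = v a" using g unfolding \<Gamma>F_def by auto
    then show ?thesis unfolding \<Gamma>F_def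
      using v_inv[of a] inv_props[of a] F_inv F_carrier by (intro image_eqI[of _ _ "inv a"]) auto
  qed
qed

lemma val_class_eq_iff: "val_class a = val_class b \<longleftrightarrow> v a - v b \<in> \<Gamma>F"
proof
  assume "val_class a = val_class b"
  moreover have "0 + v a \<in> val_class a" unfolding val_class_def using \<Gamma>F_closed(1) by blast
  ultimately have "v a \<in> val_class b" by simp
  then obtain g where "g \<in> \<Gamma>F" "v a = g + v b" unfolding val_class_def by auto
  then show "v a - v b \<in> \<Gamma>F" by simp
next
  have sub: "val_class a \<subseteq> val_class b" if "v a - v b \<in> \<Gamma>F" for a b
  proof
    fix x assume "x \<in> val_class a"
    then obtain g where g: "g \<in> \<Gamma>F" "x = g + v a" unfolding val_class_def by auto
    have "g + (v a - v b) \<in> \<Gamma>F" using \<Gamma>F_closed(2) g(1) that by blast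
    moreover have "x = (g + (v a - v b)) + v b" using g(2) by simp
    ultimately show "x \<in> val_class b" unfolding val_class_def by blast
  qed
  assume h: "v a - v b \<in> \<Gamma>F"
  then have "v b - v a \<in> \<Gamma>F" using \<Gamma>F_closed(3)[OF h] by simp
  then show "val_class a = val_class b" using sub h by blast
qed

definition "n = ring.dim E K (carrier E)"

text \<open>All numbers are read off from the common square root in \<open>semi_ramified\<close>.
  Positivity of n turns the statement about \<open>card\<close> into finiteness of the set of
  classes.\<close>

lemma dim_R: "ring.dim R F (carrier R) = n * n" and card_val_classes: "card val_classes = n" and n_pos: "n > 0"
  and dimension_E: "ring.dimension E n K (carrier E)" if K: "subfield K E"
proof -
  have sr: "real n = sqrt (real (ring.dim R F (carrier R)))"
    "real (order (value_group R v (carrier R) Mod carrier (value_group R v F))) = sqrt (real (ring.dim R F (carrier R)))"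
    "E.finite_dimension K (carrier E)"
    using semi_ramified unfolding semi_ramified_def n_def Let_def by blast+
  have "real (n * n) = real (ring.dim R F (carrier R))" using sr(1) by simp
  then show d: "ring.dim R F (carrier R) = n * n" using of_nat_eq_iff by metis
  have "order (value_group R v (carrier R) Mod carrier (value_group R v F)) = n"
    using sr(1,2) by simp
  moreover have "rcosets\<^bsub>value_group R v (carrier R)\<^esub> (carrier (value_group R v F)) = val_classes"
    unfolding RCOSETS_def r_coset_def value_group_def val_classes_def val_class_def \<Gamma>F_def by auto
  ultimately show "card val_classes = n" unfolding order_def FactGroup_def by simp
  have "dimension (dim F (carrier R)) F (carrier R)"
    using finite_dimensionE[OF F_subfield finite_dim] by (simp add: over_def)
  then have "dim F (carrier R) \<noteq> 0" using dimension_zero[OF F_subfield] one_neq_zero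
    by (metis one_closed singletonD)
  then show "n > 0" using d by (cases n) auto
  show "ring.dimension E n K (carrier E)"
    using E.finite_dimensionE[OF K sr(3)] unfolding n_def by (simp add: over_def)
qed

lemma K_subfield: "subfield K E"
proof (rule Ef.subfieldI')
  show "subring K E"
  proof (rule E.subringI)
    show "\<one>\<^bsub>E\<^esub> \<in> K" unfolding K_iff using F_closed by (intro bexI[of _ \<one>]) auto
    fix h assume "h \<in> K"
    then obtain x where x: "x \<in> F" "x \<in> V" "h = res x" unfolding K_iff by blast
    then show "\<ominus>\<^bsub>E\<^esub> h \<in> K" unfolding K_iff
      using F_closed V_closed res_uminus by (intro bexI[of _ "\<ominus> x"]) auto
    fix k assume "k \<in> K"
    then obtain y where y: "y \<in> F" "y \<in> V" "k = res y" unfolding K_iff by blast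
    show "h \<otimes>\<^bsub>E\<^esub> k \<in> K" unfolding K_iff
      using x y F_closed V_closed res_mult by (intro bexI[of _ "x \<otimes> y"]) auto
    show "h \<oplus>\<^bsub>E\<^esub> k \<in> K" unfolding K_iff
      using x y F_closed V_closed res_add by (intro bexI[of _ "x \<oplus> y"]) auto
  qed (auto simp: K_iff)
  fix h assume h: "h \<in> K - {\<zero>\<^bsub>E\<^esub>}"
  then have "h \<in> K" by blast
  then obtain x where x: "x \<in> F" "x \<in> V" "h = res x" unfolding K_iff by blast
  then have u: "x \<noteq> \<zero>" "v x = 0" using res_nonzero h by blast+
  note U = unit_V[OF F_carrier[OF x(1)] u]
  have "inv\<^bsub>E\<^esub> h = res (inv x)"
    using x(3) U by (intro E.inv_char) auto
  then show "inv\<^bsub>E\<^esub> h \<in> K" unfolding K_iff using F_inv x(1) u(1) U(2) by blast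
qed

lemmas card_classes = card_val_classes[OF K_subfield] and dim_D = dim_R[OF K_subfield]
  and n_positive = n_pos[OF K_subfield] and dim_E = dimension_E[OF K_subfield]

lemma theta_fixed_imp_mem_K:
  assumes x: "x \<in> carrier E" and fixed: "\<And>a. \<lbrakk>a \<in> carrier R; a \<noteq> \<zero>\<rbrakk> \<Longrightarrow> theta R v a x = x"
  shows "x \<in> K"
proof -
  obtain a where a: "a \<in> V" "x = res a" using res_surj[OF x] by blast
  have aR: "a \<in> carrier R" using V_carrier[OF a(1)] .
  let ?l = "[\<one>\<^bsub>E\<^esub>, \<ominus>\<^bsub>E\<^esub> x]"
  interpret UP: domain "poly_ring E" by (rule Ef.univ_poly_is_domain[OF E.carrier_is_subring])
  have l: "?l \<in> carrier (poly_ring E)" by (rule Ef.linear_in_poly_ring[OF x])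
  \<comment> \<open>Monic lists over the valuation ring that reduce to a power of X - x; the
    exponent is the degree, one less than the length.\<close>
  define Q where "Q c \<longleftrightarrow> (\<exists>t. c = \<one> # t) \<and> set c \<subseteq> V \<and>
    map res c = ?l [^]\<^bsub>poly_ring E\<^esub> (length c - 1)" for c
  obtain r where r: "annihilates a (\<one> # r)"
    using exists_annihilator[OF F_subfield _ finite_dim aR] F_eq by blast
  have "\<exists>c. c \<noteq> [] \<and> Q (\<one> # c) \<and> set c \<subseteq> ring_center R \<and> annihilates a (\<one> # c)"
  proof (rule wedderburn_factorization[OF aR r])
    show "Q [\<one>]" unfolding Q_def by (simp add: univ_poly_one)
    fix c w assume c: "Q c" "set c \<subseteq> carrier R" and w: "w \<in> carrier R" "w \<noteq> \<zero>"
    \<comment> \<open>Each new factor is X - b with b conjugate to a, and the residue of b is the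
      image of x under \<theta>(w), which is x by assumption.\<close>
    define b where "b = conjugate w a"
    have b: "b \<in> V" "res b = x"
      using conjugate_props(4)[OF w aR a(1)] theta_res[OF w a(1)] fixed[OF w] a(2) unfolding b_def by auto
    obtain t where t: "c = \<one> # t" using c(1) unfolding Q_def by blast
    have cV: "set c \<subseteq> V" "set t \<subseteq> V" using c(1) t unfolding Q_def by auto
    have pw: "map res c = ?l [^]\<^bsub>poly_ring E\<^esub> (length t)" using c(1) t unfolding Q_def by simp
    have map2_res: "map res (map2 (\<oplus>) p q) = map2 (\<oplus>\<^bsub>E\<^esub>) (map res p) (map res q)"
      if "length p = length q" "set p \<subseteq> V" "set q \<subseteq> V" for p q
      using that by (induction p q rule: list_induct2) (auto simp: res_add)
    have neg: "map res (map (\<lambda>y. \<ominus> (b \<otimes> y)) c) = map (\<lambda>y. \<ominus>\<^bsub>E\<^esub> (x \<otimes>\<^bsub>E\<^esub> y)) (map res c)"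
      using cV(1) b V_closed by (auto simp: res_uminus res_mult subset_iff)
    have nV: "set (map (\<lambda>y. \<ominus> (b \<otimes> y)) c) \<subseteq> V" using cV(1) b V_closed by auto
    have "map res (linear_mult b c) =
        map2 (\<oplus>\<^bsub>E\<^esub>) (map res (c @ [\<zero>])) (map res (\<zero> # map (\<lambda>y. \<ominus> (b \<otimes> y)) c))"
      unfolding linear_mult_def using cV(1) nV by (intro map2_res) auto
    also have "\<dots> = map2 (\<oplus>\<^bsub>E\<^esub>) (map res c @ [\<zero>\<^bsub>E\<^esub>]) (\<zero>\<^bsub>E\<^esub> # map (\<lambda>y. \<ominus>\<^bsub>E\<^esub> (x \<otimes>\<^bsub>E\<^esub> y)) (map res c))"
      by (simp only: map_append list.map neg res_zero)
    also have "\<dots> = ?l \<otimes>\<^bsub>poly_ring E\<^esub> map res c"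
    proof -
      have "set (map res t) \<subseteq> carrier E" using cV(2) by auto
      from Ef.linear_mult_monic_list[OF x this] show ?thesis
        unfolding t by (simp only: list.map res_one)
    qed
    also have "\<dots> = ?l [^]\<^bsub>poly_ring E\<^esub> Suc (length t)"
      unfolding pw using l by (simp add: UP.m_comm)
    finally have "map res (linear_mult b c) = ?l [^]\<^bsub>poly_ring E\<^esub> (length (linear_mult b c) - 1)"
      using t by simp
    moreover have "set (linear_mult b c) \<subseteq> V"
    proof
      fix y assume "y \<in> set (linear_mult b c)"
      then obtain s u where su: "(s, u) \<in> set (zip (c @ [\<zero>]) (\<zero> # map (\<lambda>y. \<ominus> (b \<otimes> y)) c))" "y = s \<oplus> u"
        unfolding linear_mult_def by (auto simp del: zip_append zip_Cons zip_Cons1)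
      have "s \<in> V" "u \<in> V"
        using set_zip_leftD[OF su(1)] set_zip_rightD[OF su(1)] cV nV by auto
      then show "y \<in> V" using su(2) V_closed by simp
    qed
    ultimately show "Q (linear_mult (conjugate w a) c)"
      using linear_mult_monic[of b t] t unfolding Q_def b_def by simp
  qed
  then obtain c where c: "c \<noteq> []" "Q (\<one> # c)" "set c \<subseteq> F" unfolding F_eq by blast
  \<comment> \<open>Central coefficients of nonnegative value have residues in K. That
    \<open>c\<close> is nonempty makes the power of X - x a positive one.\<close>
  have "set (\<one> # c) \<subseteq> F \<inter> V" using c(2,3) F_closed(3) unfolding Q_def by simp
  then have "set (map res (\<one> # c)) \<subseteq> K"
    unfolding set_map residue_subfield_def by (rule image_mono)
  then have "map res (\<one> # c) \<in> carrier (K[X]\<^bsub>E\<^esub>)"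
    by (simp add: univ_poly_carrier[symmetric] polynomial_def)
  then have pow: "?l [^]\<^bsub>poly_ring E\<^esub> (length c) \<in> carrier (K[X]\<^bsub>E\<^esub>)"
    using c(2) unfolding Q_def by simp
  show "x \<in> K"
    using separable x c(1) unfolding separable_extension_def
    by (intro Ef.separable_linear_power_imp_mem[OF K_subfield x _ _ pow]) (auto simp: over_def)
qed

section \<open>The automorphisms induced by conjugation, and their identification with the Galois
  group\<close>

definition "H = theta R v ` (carrier R - {\<zero>})"

text \<open>A unit of the valuation ring acts through its residue, and the residue ring is
  commutative.\<close>

lemma theta_unit:
  assumes "a \<in> carrier R" "a \<noteq> \<zero>" "v a = 0" "y \<in> carrier E"
  shows "theta R v a y = y"
proof -
  obtain x where x: "x \<in> V" "y = res x" using res_surj assms(4) by blast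
  note U = unit_V[OF assms(1-3)]
  have "res (conjugate a x) = res a \<otimes>\<^bsub>E\<^esub> res x \<otimes>\<^bsub>E\<^esub> res (inv a)"
    using U x V_closed by (simp add: res_mult)
  also have "\<dots> = res x \<otimes>\<^bsub>E\<^esub> (res a \<otimes>\<^bsub>E\<^esub> res (inv a))"
    using U(1,2) x by (simp add: Ef.m_ac)
  also have "\<dots> = res x" using U x by simp
  finally show ?thesis using theta_res[OF assms(1,2) x(1)] x(2) by simp
qed

text \<open>Here a = u f b with f in F and u of value zero. Conjugation by f is trivial on
  \<open>D\<close>, and conjugation by u is trivial on residues.\<close>

lemma theta_eq_if_val_class_eq:
  assumes a: "a \<in> carrier R" "a \<noteq> \<zero>" and b: "b \<in> carrier R" "b \<noteq> \<zero>" and eq: "val_class a = val_class b"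
  shows "theta R v a = theta R v b"
proof -
  obtain f where f: "f \<in> F" "f \<noteq> \<zero>" "v a - v b = v f"
    using eq unfolding val_class_eq_iff \<Gamma>F_def by auto
  have fR: "f \<in> carrier R" using F_carrier[OF f(1)] .
  note i = inv_props[OF b] and j = inv_props[OF fR f(2)]
  define u where "u = a \<otimes> (inv b \<otimes> inv f)"
  have bf: "inv b \<otimes> inv f \<in> carrier R" "inv b \<otimes> inv f \<noteq> \<zero>" using i j mult_nonzero by auto
  have u: "u \<in> carrier R" "u \<noteq> \<zero>" "v u = 0"
  proof -
    show "u \<in> carrier R" "u \<noteq> \<zero>" unfolding u_def using a bf mult_nonzero by auto
    have "v u = v a + (- v b + - v f)"
      unfolding u_def using a bf i j fR f(2) b by (simp add: v_mult v_inv)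
    then show "v u = 0" using f(3) by (simp add: algebra_simps)
  qed
  have "u \<otimes> (f \<otimes> b) = a \<otimes> (inv b \<otimes> (inv f \<otimes> f) \<otimes> b)"
    unfolding u_def using a b i(1) j(1) fR by (simp add: m_assoc)
  then have a_eq: "a = u \<otimes> (f \<otimes> b)" using a b i j by simp
  have fb: "f \<otimes> b \<in> carrier R" "f \<otimes> b \<noteq> \<zero>" using fR f(2) b mult_nonzero by auto
  show ?thesis
  proof (rule extensionalityI[OF theta_ext theta_ext])
    fix y assume y: "y \<in> carrier E"
    then obtain x where x: "x \<in> V" "y = res x" using res_surj by blast
    note tb = theta_closed[OF b y]
    obtain z where z: "z \<in> V" "theta R v b y = res z" using res_surj tb by blast
    have "conjugate f z = z"
      unfolding F_commute[OF f(1) V_carrier[OF z(1)]] using fR f(2) V_carrier[OF z(1)] j by (simp add: m_assoc)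
    then have tf: "theta R v f (theta R v b y) = theta R v b y"
      using theta_res[OF fR f(2) z(1)] z(2) by simp
    have "theta R v a y = theta R v u (theta R v f (theta R v b y))"
      unfolding a_eq theta_mult[OF u(1,2) fb] theta_mult[OF fR f(2) b] using y by (simp add: compose_eq)
    then show "theta R v a y = theta R v b y" using theta_unit[OF u tb] tf by simp
  qed
qed

lemma finite_classes: "finite val_classes"
  using card_classes n_positive by (metis card.infinite less_numeral_extra(3))

text \<open>\<theta> as a map on the quotient of the value groups, through a chosen
  representative.\<close>

definition "class_theta C = theta R v (SOME a. a \<in> carrier R \<and> a \<noteq> \<zero> \<and> val_class a = C)"

lemma class_theta_val_class:
  assumes "a \<in> carrier R" "a \<noteq> \<zero>"
  shows "class_theta (val_class a) = theta R v a"
proof -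
  have "\<exists>b. b \<in> carrier R \<and> b \<noteq> \<zero> \<and> val_class b = val_class a" using assms by blast
  from someI_ex[OF this] show ?thesis
    unfolding class_theta_def using theta_eq_if_val_class_eq assms by blast
qed

lemma H_eq: "H = class_theta ` val_classes"
  unfolding H_def val_classes_def using class_theta_val_class by (auto simp: image_image intro!: image_cong)

sublocale H: automorphism_group E H
proof (unfold_locales)
  show "finite H" unfolding H_eq using finite_classes by simp
  show "h \<in> ring_hom E E" "h \<in> extensional (carrier E)"
    "\<exists>g\<in>H. (\<forall>x\<in>carrier E. g (h x) = x) \<and> (\<forall>x\<in>carrier E. h (g x) = x)" if h: "h \<in> H" for h
  proof -
    obtain a where a: "a \<in> carrier R" "a \<noteq> \<zero>" "h = theta R v a" using h unfolding H_def by auto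
    show "h \<in> ring_hom E E" "h \<in> extensional (carrier E)" using theta_hom a theta_ext by auto
    show "\<exists>g\<in>H. (\<forall>x\<in>carrier E. g (h x) = x) \<and> (\<forall>x\<in>carrier E. h (g x) = x)"
      using theta_inv_theta[OF a(1,2)] inv_props[OF a(1,2)] a(3) unfolding H_def by blast
  qed
  show "restrict id (carrier E) \<in> H"
    unfolding H_def using theta_one one_neq_zero by (intro image_eqI[of _ _ \<one>]) (auto simp: id_def)
  show "compose (carrier E) g h \<in> H" if gh: "g \<in> H" "h \<in> H" for g h
  proof -
    obtain a b where "a \<in> carrier R" "a \<noteq> \<zero>" "g = theta R v a" "b \<in> carrier R" "b \<noteq> \<zero>" "h = theta R v b"
      using gh unfolding H_def by auto
    then show ?thesis unfolding H_def
      using theta_mult[of a b] mult_nonzero by (intro image_eqI[of _ _ "a \<otimes> b"]) auto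
  qed
qed

lemma H_fixed: "\<lbrakk>x \<in> carrier E; \<And>h. h \<in> H \<Longrightarrow> h x = x\<rbrakk> \<Longrightarrow> x \<in> K"
  using theta_fixed_imp_mem_K unfolding H_def by blast

text \<open>Counting: n = [E:K] \<le> |H| by Artin's bound, and |H| is at most the number of
  classes, which is n. So the surjection \<open>class_theta\<close> of the classes onto
  \<open>H\<close> is injective.\<close>

lemma theta_inj:
  assumes a: "a \<in> carrier R" "a \<noteq> \<zero>" and b: "b \<in> carrier R" "b \<noteq> \<zero>"
    and eq: "theta R v a = theta R v b"
  shows "v a - v b \<in> \<Gamma>F"
proof -
  obtain Us where Us: "E.independent K Us" "length Us = n"
    using E.exists_base[OF K_subfield dim_E] by blast
  have "length Us \<le> card H"
    by (rule H.independent_length_le_card[OF K_subfield H_fixed Us(1)])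
  then have "n \<le> card H" using Us(2) by simp
  moreover have "card H \<le> card val_classes" unfolding H_eq by (rule card_image_le[OF finite_classes])
  ultimately have "card (class_theta ` val_classes) = card val_classes" using card_classes H_eq by simp
  then have "inj_on class_theta val_classes" using eq_card_imp_inj_on[OF finite_classes] by blast
  moreover have "class_theta (val_class a) = class_theta (val_class b)"
    unfolding class_theta_val_class[OF a] class_theta_val_class[OF b] by (rule eq)
  moreover have "val_class a \<in> val_classes" "val_class b \<in> val_classes"
    unfolding val_classes_def using a b by blast+
  ultimately have "val_class a = val_class b" by (rule inj_onD)
  then show ?thesis by (simp add: val_class_eq_iff)
qed

abbreviation "G \<equiv> residue_galois_group R F v"

lemma carrier_G: "carrier G = H"
proof
  show "carrier G \<subseteq> H"
  proof
    fix g assume "g \<in> carrier G"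
    then have g: "g \<in> ring_hom E E" "g \<in> extensional (carrier E)" "\<And>x. x \<in> K \<Longrightarrow> g x = x"
      unfolding galois_group_def by (auto simp: ring_iso_def)
    show "g \<in> H" by (rule H.mem_if_fixes_fixed_field[OF H_fixed g])
  qed
  show "H \<subseteq> carrier G"
  proof
    fix h assume h: "h \<in> H"
    then obtain a where a: "a \<in> carrier R" "a \<noteq> \<zero>" "h = theta R v a" unfolding H_def by auto
    have "bij_betw h (carrier E) (carrier E)"
      using theta_inv_theta[OF a(1,2)] theta_closed[OF a(1,2)] inv_props[OF a(1,2)] theta_closed[of "inv a"] a(3)
      by (intro bij_betw_byWitness[of _ "theta R v (inv a)"]) auto
    then show "h \<in> carrier G"
      unfolding galois_group_def using H.hom_H[OF h] H.ext_H[OF h] theta_K[OF a(1,2)] a(3)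
      by (simp add: ring_iso_def)
  qed
qed

lemma mult_G: "\<lbrakk>g \<in> H; h \<in> H\<rbrakk> \<Longrightarrow> g \<otimes>\<^bsub>G\<^esub> h = compose (carrier E) g h"
proof -
  assume "g \<in> H" "h \<in> H"
  then have "g \<in> Bij (carrier E)" "h \<in> Bij (carrier E)"
    unfolding carrier_G[symmetric] by (auto simp: galois_group_def ring_iso_def Bij_def)
  then show ?thesis by (simp add: galois_group_def BijGroup_def)
qed

lemma theta_in_G: "\<lbrakk>a \<in> carrier R; a \<noteq> \<zero>\<rbrakk> \<Longrightarrow> theta R v a \<in> carrier G"
  unfolding carrier_G H_def by blast

lemma G_theta: "g \<in> carrier G \<Longrightarrow> \<exists>a. a \<in> carrier R \<and> a \<noteq> \<zero> \<and> g = theta R v a"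
  unfolding carrier_G H_def by blast

lemma theta_mult_G:
  "\<lbrakk>a \<in> carrier R; a \<noteq> \<zero>; b \<in> carrier R; b \<noteq> \<zero>\<rbrakk> \<Longrightarrow> theta R v (a \<otimes> b) = theta R v a \<otimes>\<^bsub>G\<^esub> theta R v b"
  using mult_G theta_in_G theta_mult unfolding carrier_G by simp

lemma one_G: "\<one>\<^bsub>G\<^esub> = theta R v \<one>"
  unfolding theta_one by (simp add: galois_group_def BijGroup_def)

text \<open>The products a b and b a have the same value, hence the same image under \<theta>;
  commutativity is inherited from the value group.\<close>

lemma G_comm_group: "comm_group G"
proof (rule comm_groupI)
  show "\<one>\<^bsub>G\<^esub> \<in> carrier G" unfolding one_G using theta_in_G one_neq_zero by simp
next
  fix g assume "g \<in> carrier G"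
  then obtain a where a: "a \<in> carrier R" "a \<noteq> \<zero>" "g = theta R v a" using G_theta by blast
  note i = inv_props[OF a(1,2)]
  show "\<one>\<^bsub>G\<^esub> \<otimes>\<^bsub>G\<^esub> g = g"
    unfolding one_G a(3) using theta_mult_G[OF one_closed one_neq_zero a(1,2)] a by simp
  show "\<exists>h\<in>carrier G. h \<otimes>\<^bsub>G\<^esub> g = \<one>\<^bsub>G\<^esub>"
    using theta_mult_G[OF i(1,4) a(1,2)] theta_in_G[OF i(1,4)] i(2) a(3) one_G by force
  fix h assume "h \<in> carrier G"
  then obtain b where b: "b \<in> carrier R" "b \<noteq> \<zero>" "h = theta R v b" using G_theta by blast
  have ab: "a \<otimes> b \<in> carrier R" "a \<otimes> b \<noteq> \<zero>" "b \<otimes> a \<in> carrier R" "b \<otimes> a \<noteq> \<zero>"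
    using a b mult_nonzero by auto
  show "g \<otimes>\<^bsub>G\<^esub> h \<in> carrier G"
    using theta_mult_G[OF a(1,2) b(1,2)] theta_in_G[OF ab(1,2)] a(3) b(3) by simp
  have "val_class (a \<otimes> b) = val_class (b \<otimes> a)"
    unfolding val_class_def using a b by (simp add: v_mult add.commute)
  from theta_eq_if_val_class_eq[OF ab this]
  show "g \<otimes>\<^bsub>G\<^esub> h = h \<otimes>\<^bsub>G\<^esub> g"
    using theta_mult_G[OF a(1,2) b(1,2)] theta_mult_G[OF b(1,2) a(1,2)] a(3) b(3) by simp
  fix k assume "k \<in> carrier G"
  then obtain c where c: "c \<in> carrier R" "c \<noteq> \<zero>" "k = theta R v c" using G_theta by blast
  have bc: "b \<otimes> c \<in> carrier R" "b \<otimes> c \<noteq> \<zero>" using b c mult_nonzero by auto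
  show "g \<otimes>\<^bsub>G\<^esub> h \<otimes>\<^bsub>G\<^esub> k = g \<otimes>\<^bsub>G\<^esub> (h \<otimes>\<^bsub>G\<^esub> k)"
    using theta_mult_G[OF ab(1,2) c(1,2)] theta_mult_G[OF a(1,2) bc] theta_mult_G[OF a(1,2) b(1,2)]
      theta_mult_G[OF b(1,2) c(1,2)] a b c m_assoc[of a b c] by simp
qed

sublocale G: comm_group G
  by (rule G_comm_group)

lemma finite_G: "finite (carrier G)"
  unfolding carrier_G by (rule H.finite_H)

end

section \<open>Valuation splitting and central approximation\<close>

context semi_ramified_division_ring
begin

text \<open>The leading term of \<open>w\<close> is a central element times an element of \<open>S\<close>.\<close>

definition scaled_residue_in :: "'a \<Rightarrow> 'a set set \<Rightarrow> bool" where
  "scaled_residue_in w S \<longleftrightarrow> (\<exists>c\<in>F - {\<zero>}. w \<otimes> inv c \<in> V \<and> res (w \<otimes> inv c) \<in> S - {\<zero>\<^bsub>E\<^esub>})"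

lemma scaled_residue_in_value:
  assumes "w \<in> carrier R" "w \<noteq> \<zero>" "scaled_residue_in w S"
  shows "v w \<in> \<Gamma>F"
proof -
  obtain c where c: "c \<in> F" "c \<noteq> \<zero>" "w \<otimes> inv c \<in> V" "res (w \<otimes> inv c) \<noteq> \<zero>\<^bsub>E\<^esub>"
    using assms(3) unfolding scaled_residue_in_def by blast
  note i = inv_props[OF F_carrier[OF c(1)] c(2)]
  have "v w + v (inv c) = 0" using res_nonzero[OF c(3,4)] v_mult[OF assms(1) i(1) assms(2) i(4)] by simp
  then have "v w = v c" using v_inv[OF F_carrier[OF c(1)] c(2)] by simp
  then show ?thesis using c unfolding \<Gamma>F_def by blast
qed

lemma F_scalar_residue:
  assumes "k \<in> F" "k \<noteq> \<zero>" "c \<in> F" "c \<noteq> \<zero>" "v c \<le> v k"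
  shows "k \<otimes> inv c \<in> F \<inter> V" "res (k \<otimes> inv c) \<in> K" "v c < v k \<Longrightarrow> res (k \<otimes> inv c) = \<zero>\<^bsub>E\<^esub>"
proof -
  note kR = F_carrier[OF assms(1)] and cR = F_carrier[OF assms(3)]
  note i = inv_props[OF cR assms(4)]
  have val: "v (k \<otimes> inv c) = v k - v c" using kR cR assms i by (simp add: v_mult v_inv)
  show 1: "k \<otimes> inv c \<in> F \<inter> V"
    using F_closed assms F_inv kR i val by (auto simp: V_iff)
  then show "res (k \<otimes> inv c) \<in> K" unfolding K_iff by blast
  assume "v c < v k"
  then show "res (k \<otimes> inv c) = \<zero>\<^bsub>E\<^esub>" using 1 val by (subst res_zero_iff) (auto simp: M_iff V_iff)
qed

text \<open>In k u + w1 the scalar k competes with the scale c already found for w1, and the one of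
  smaller value scales the sum. Independence of the residues excludes cancellation of leading terms
  when the values agree.\<close>

lemma Span_scaled_residue:
  assumes "set Us \<subseteq> V" "E.independent K (map res Us)" "w \<in> Span F Us" "w \<noteq> \<zero>"
  shows "scaled_residue_in w (E.Span K (map res Us))"
  using assms
proof (induction Us arbitrary: w)
  case (Cons u Us)
  let ?S = "E.Span K (map res Us)"
  have u: "u \<in> V" "u \<in> carrier R" and Us: "set Us \<subseteq> V" "set Us \<subseteq> carrier R"
    using Cons.prems(1) V_carrier by auto
  have ind: "res u \<notin> ?S" "E.independent K (map res Us)" "res u \<in> carrier E"
    using E.independent_backwards[of K "res u" "map res Us"] Cons.prems(2) by auto
  have rU: "set (map res Us) \<subseteq> carrier E" using Us by auto
  note Sp = E.Span_subgroup_props[OF K_subfield rU] and Sm = E.Span_smult_closed[OF K_subfield rU]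
  have mem: "y \<in> E.Span K (map res (u # Us)) \<longleftrightarrow> (\<exists>k\<in>K. \<exists>s\<in>?S. y = k \<otimes>\<^bsub>E\<^esub> res u \<oplus>\<^bsub>E\<^esub> s)" for y
    by (simp add: E.line_extension_mem_iff)
  have K01: "\<zero>\<^bsub>E\<^esub> \<in> K" "\<one>\<^bsub>E\<^esub> \<in> K" using subringE(2,3)[OF subfieldE(1)[OF K_subfield]] by auto
  have in_Span: "s \<in> E.Span K (map res (u # Us))" if "s \<in> ?S" for s
    unfolding mem using that K01(1) ind(3) Sp(1) by (intro bexI[of _ "\<zero>\<^bsub>E\<^esub>"] bexI[of _ s]) auto
  have u_plus: "res u \<oplus>\<^bsub>E\<^esub> s \<in> E.Span K (map res (u # Us)) - {\<zero>\<^bsub>E\<^esub>}" if s: "s \<in> ?S" for s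
  proof -
    have sE: "s \<in> carrier E" using s Sp(1) by blast
    have "res u \<oplus>\<^bsub>E\<^esub> s \<noteq> \<zero>\<^bsub>E\<^esub>"
    proof
      assume "res u \<oplus>\<^bsub>E\<^esub> s = \<zero>\<^bsub>E\<^esub>"
      then have "res u = \<ominus>\<^bsub>E\<^esub> s" using ind(3) sE by (simp add: E.minus_equality)
      then show False using ind(1) Sp(4)[OF s] by simp
    qed
    moreover have "res u \<oplus>\<^bsub>E\<^esub> s \<in> E.Span K (map res (u # Us))"
      unfolding mem using s K01(2) ind(3) by (intro bexI[of _ "\<one>\<^bsub>E\<^esub>"] bexI[of _ s]) auto
    ultimately show ?thesis by blast
  qed
  have "w \<in> line_extension F u (Span F Us)" using Cons.prems(3) by simp
  then obtain k w1 where w: "k \<in> F" "w1 \<in> Span F Us" "w = k \<otimes> u \<oplus> w1"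
    unfolding line_extension_mem_iff by blast
  have kR: "k \<in> carrier R" using F_carrier[OF w(1)] .
  have w1R: "w1 \<in> carrier R" using w(2) Span_subgroup_props(1)[OF F_subfield Us(2)] by blast
  show ?case
  proof (cases "k = \<zero>")
    case True
    then have "w = w1" using w u w1R by simp
    then show ?thesis
      using Cons.IH[OF Us(1) ind(2) w(2)] Cons.prems(4) in_Span unfolding scaled_residue_in_def by blast
  next
    case k0: False
    note ik = inv_props[OF kR k0]
    have ku: "k \<otimes> u \<otimes> inv k = u"
      unfolding F_commute[OF w(1) u(2)] using kR u ik by (simp add: m_assoc)
    show ?thesis
    proof (cases "w1 = \<zero>")
      case True
      have "w \<otimes> inv k = u" using w(3) True ku kR u by simp
      then show ?thesis unfolding scaled_residue_in_def
        using w(1) k0 u u_plus[OF Sp(2)] ind(3) by (intro bexI[of _ k]) auto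
    next
      case False
      then obtain c where c: "c \<in> F" "c \<noteq> \<zero>" "w1 \<otimes> inv c \<in> V" "res (w1 \<otimes> inv c) \<in> ?S"
          "res (w1 \<otimes> inv c) \<noteq> \<zero>\<^bsub>E\<^esub>"
        using Cons.IH[OF Us(1) ind(2) w(2)] unfolding scaled_residue_in_def by blast
      have cR: "c \<in> carrier R" using F_carrier[OF c(1)] .
      note ic = inv_props[OF cR c(2)]
      show ?thesis
      proof (cases "v k \<le> v c")
        \<comment> \<open>Equality of the values is included: the residue is that of u plus an
          element of the span of the later residues, which \<open>u_plus\<close> shows to be
          nonzero.\<close>
        case True
        note sc = F_scalar_residue[OF c(1,2) w(1) k0 True]
        have "w1 \<otimes> inv k = (w1 \<otimes> (inv c \<otimes> c)) \<otimes> inv k" using ic w1R by simp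
        also have "\<dots> = (w1 \<otimes> inv c) \<otimes> (c \<otimes> inv k)" using w1R ic(1) ik(1) cR by (simp add: m_assoc)
        also have "\<dots> = (c \<otimes> inv k) \<otimes> (w1 \<otimes> inv c)"
          using F_commute[of "c \<otimes> inv k" "w1 \<otimes> inv c"] sc(1) w1R ic(1) by simp
        finally have w1k: "w1 \<otimes> inv k = (c \<otimes> inv k) \<otimes> (w1 \<otimes> inv c)" .
        have wk: "w \<otimes> inv k = u \<oplus> (c \<otimes> inv k) \<otimes> (w1 \<otimes> inv c)"
          using w(3) ku w1k kR u w1R ik by (simp add: l_distr)
        have V1: "(c \<otimes> inv k) \<otimes> (w1 \<otimes> inv c) \<in> V" using sc(1) c(3) V_closed by simp
        have "res (w \<otimes> inv k) = res u \<oplus>\<^bsub>E\<^esub> res (c \<otimes> inv k) \<otimes>\<^bsub>E\<^esub> res (w1 \<otimes> inv c)"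
          unfolding wk using u V1 sc(1) c(3) by (simp add: res_add res_mult)
        moreover have "w \<otimes> inv k \<in> V" unfolding wk using u V1 V_closed by simp
        ultimately show ?thesis
          unfolding scaled_residue_in_def using u_plus[OF Sm[OF sc(2) c(4)]] w(1) k0
          by (intro bexI[of _ k]) auto
      next
        \<comment> \<open>Now k is strictly smaller than c in size, so the term with u vanishes in
          the residue.\<close>
        case False
        then have lt: "v c < v k" by simp
        note sc = F_scalar_residue[OF w(1) k0 c(1,2) less_imp_le[OF lt]]
        have "k \<otimes> u \<otimes> inv c = (k \<otimes> inv c) \<otimes> u"
          using kR u ic(1) F_commute[OF F_inv[OF c(1,2)] u(2)] by (simp add: m_assoc)
        then have wc: "w \<otimes> inv c = (k \<otimes> inv c) \<otimes> u \<oplus> w1 \<otimes> inv c"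
          using w(3) kR u w1R ic by (simp add: l_distr)
        have V1: "(k \<otimes> inv c) \<otimes> u \<in> V" using sc(1) u V_closed by simp
        have "res (w \<otimes> inv c) = res (k \<otimes> inv c) \<otimes>\<^bsub>E\<^esub> res u \<oplus>\<^bsub>E\<^esub> res (w1 \<otimes> inv c)"
          unfolding wc using u V1 sc(1) c(3) by (simp add: res_add res_mult)
        also have "\<dots> = res (w1 \<otimes> inv c)" using sc(3)[OF lt] ind(3) c(3) by simp
        finally have "res (w \<otimes> inv c) = res (w1 \<otimes> inv c)" .
        moreover have "w \<otimes> inv c \<in> V" unfolding wc using c(3) V1 V_closed by simp
        ultimately show ?thesis
          unfolding scaled_residue_in_def using in_Span[OF c(4)] c(1,2,5)
          by (intro bexI[of _ c]) auto
      qed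
    qed
  qed
qed simp

text \<open>If u were in the span of the later lifts, its leading term would be a central c times an
  element with residue in their residue span. Since u is a unit, so is c, and the residue of u would
  lie in that span.\<close>

lemma independent_lift:
  assumes "set Us \<subseteq> V" "E.independent K (map res Us)"
  shows "independent F Us"
  using assms
proof (induction Us)
  case (Cons u Us)
  let ?S = "E.Span K (map res Us)"
  have u: "u \<in> V" "u \<in> carrier R" and Us: "set Us \<subseteq> V" "set Us \<subseteq> carrier R"
    using Cons.prems(1) V_carrier by auto
  have ind: "res u \<notin> ?S" "E.independent K (map res Us)" "res u \<in> carrier E"
    using E.independent_backwards[of K "res u" "map res Us"] Cons.prems(2) by auto
  have rU: "set (map res Us) \<subseteq> carrier E" using Us by auto
  have u0: "u \<noteq> \<zero>" using ind(1) E.Span_subgroup_props(2)[OF K_subfield rU] by auto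
  have "u \<notin> Span F Us"
  proof
    assume "u \<in> Span F Us"
    then obtain c where c: "c \<in> F" "c \<noteq> \<zero>" "u \<otimes> inv c \<in> V" "res (u \<otimes> inv c) \<in> ?S"
          "res (u \<otimes> inv c) \<noteq> \<zero>\<^bsub>E\<^esub>"
      using Span_scaled_residue[OF Us(1) ind(2) _ u0] unfolding scaled_residue_in_def by blast
    have cR: "c \<in> carrier R" using F_carrier[OF c(1)] .
    note ic = inv_props[OF cR c(2)]
    have "res u \<noteq> \<zero>\<^bsub>E\<^esub>" using ind(1) E.Span_subgroup_props(2)[OF K_subfield rU] by auto
    then have "v u = 0" using res_nonzero u by blast
    moreover have "v (u \<otimes> inv c) = 0" using res_nonzero c(3,5) by blast
    ultimately have "v c = 0" using v_mult[OF u(2) ic(1) u0 ic(4)] v_inv[OF cR c(2)] by simp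
    then have cV: "c \<in> V" using cR by (simp add: V_iff)
    have "u = c \<otimes> (u \<otimes> inv c)"
      using F_commute[OF c(1), of "u \<otimes> inv c"] u ic cR by (simp add: m_assoc)
    then have "res u = res c \<otimes>\<^bsub>E\<^esub> res (u \<otimes> inv c)" using res_mult[OF cV c(3)] by simp
    moreover have "res c \<in> K" unfolding K_iff using c(1) cV by blast
    ultimately show False
      using ind(1) E.Span_smult_closed[OF K_subfield rU _ c(4)] by simp
  qed
  then show ?case using Cons.IH[OF Us(1) ind(2)] u(2) by (intro li_Cons)
qed simp

lemma Span_right_mult:
  assumes a: "a \<in> carrier R" "a \<noteq> \<zero>" and Us: "set Us \<subseteq> carrier R"
  shows "Span F (map (\<lambda>u. u \<otimes> a) Us) = (\<lambda>x. x \<otimes> a) ` Span F Us"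
  using Us
proof (induction Us)
  case Nil
  then show ?case using a by simp
next
  case (Cons u Us)
  have u: "u \<in> carrier R" "set Us \<subseteq> carrier R" using Cons.prems by auto
  have SR: "Span F Us \<subseteq> carrier R" using Span_subgroup_props(1)[OF F_subfield u(2)] .
  have eq: "k \<otimes> (u \<otimes> a) \<oplus> x \<otimes> a = (k \<otimes> u \<oplus> x) \<otimes> a" if "k \<in> F" "x \<in> Span F Us" for k x
    using that F_carrier SR u(1) a(1) by (simp add: l_distr m_assoc subset_iff)
  have "y \<in> line_extension F (u \<otimes> a) ((\<lambda>x. x \<otimes> a) ` Span F Us) \<longleftrightarrow>
      y \<in> (\<lambda>x. x \<otimes> a) ` line_extension F u (Span F Us)" for y
    using eq unfolding image_iff Bex_def line_extension_mem_iff by metis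
  then show ?case using Cons.IH[OF u(2)] by auto
qed

lemma independent_right_mult:
  assumes a: "a \<in> carrier R" "a \<noteq> \<zero>" and "independent F Us"
  shows "independent F (map (\<lambda>u. u \<otimes> a) Us)"
  using assms(3)
proof (induction Us rule: list.induct)
  case (Cons u Us)
  have u: "u \<notin> Span F Us" "independent F Us" "u \<in> carrier R"
    using independent_backwards[OF Cons.prems] by auto
  have UsR: "set Us \<subseteq> carrier R" using independent_in_carrier[OF u(2)] .
  note i = inv_props[OF a]
  have "u \<otimes> a \<notin> Span F (map (\<lambda>u. u \<otimes> a) Us)"
  proof
    assume "u \<otimes> a \<in> Span F (map (\<lambda>u. u \<otimes> a) Us)"
    then obtain x where x: "x \<in> Span F Us" "u \<otimes> a = x \<otimes> a" using Span_right_mult[OF a UsR] by auto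
    have xR: "x \<in> carrier R" using x(1) Span_subgroup_props(1)[OF F_subfield UsR] by blast
    have "u \<otimes> a \<otimes> inv a = x \<otimes> a \<otimes> inv a" using x(2) by simp
    then have "u = x" using u(3) xR a i by (simp add: m_assoc)
    then show False using u(1) x(1) by simp
  qed
  then show ?case using Cons.IH[OF u(2)] u(3) a by (simp add: li_Cons)
qed simp

text \<open>The spaces \<open>Span F Us\<close> times b, for b in different classes, take values in
  different cosets of \<Gamma>_F. Hence they meet trivially, and a sum of terms from different
  spaces has the least of their values. Each space has dimension n, as right multiplication by b
  preserves independence.\<close>

lemma totally_ramified_sum:
  assumes Us: "set Us \<subseteq> V" "E.independent K (map res Us)" "length Us = n"
    and bs: "set bs \<subseteq> carrier R - {\<zero>}" "distinct (map val_class bs)"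
  shows "\<exists>T. dimension (n * length bs) F T \<and> (\<forall>t\<in>T - {\<zero>}. \<exists>b\<in>set bs. v t - v b \<in> \<Gamma>F)"
  using bs
proof (induction bs)
  case Nil
  show ?case by (intro exI[of _ "{\<zero>}"]) auto
next
  case (Cons b bs)
  then obtain T where T: "dimension (n * length bs) F T" "\<And>t. \<lbrakk>t \<in> T; t \<noteq> \<zero>\<rbrakk> \<Longrightarrow> \<exists>b\<in>set bs. v t - v b \<in> \<Gamma>F"
    by auto
  have b: "b \<in> carrier R" "b \<noteq> \<zero>" using Cons.prems by auto
  have UsR: "set Us \<subseteq> carrier R" using Us(1) V_carrier by blast
  define A where "A = Span F (map (\<lambda>u. u \<otimes> b) Us)"
  have dA: "dimension n F A"
    unfolding A_def
    using dimension_independent[OF independent_right_mult[OF b independent_lift[OF Us(1,2)]]] Us(3) by simp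
  note TA = space_subgroup_props[OF F_subfield T(1)] space_subgroup_props[OF F_subfield dA]
  have A_val: "v s - v b \<in> \<Gamma>F" if s: "s \<in> A" "s \<noteq> \<zero>" for s
  proof -
    obtain w where w: "w \<in> Span F Us" "s = w \<otimes> b" using s(1) Span_right_mult[OF b UsR] unfolding A_def by auto
    have wR: "w \<in> carrier R" using w(1) Span_subgroup_props(1)[OF F_subfield UsR] by blast
    have w0: "w \<noteq> \<zero>" using s(2) w(2) b by auto
    have "v w \<in> \<Gamma>F" using scaled_residue_in_value[OF wR w0 Span_scaled_residue[OF Us(1,2) w(1) w0]] .
    then show ?thesis using w(2) wR w0 b by (simp add: v_mult)
  qed
  have differ: "v t \<noteq> v s" if t: "t \<in> T" "t \<noteq> \<zero>" and s: "s \<in> A" "s \<noteq> \<zero>" for t s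
  proof
    assume eq: "v t = v s"
    obtain b' where b': "b' \<in> set bs" "v t - v b' \<in> \<Gamma>F" using T(2)[OF t] by blast
    have "v t - v b' + - (v s - v b) \<in> \<Gamma>F"
      using \<Gamma>F_closed(2)[OF b'(2) \<Gamma>F_closed(3)[OF A_val[OF s]]] .
    then have "val_class b = val_class b'" unfolding val_class_eq_iff using eq by simp
    then show False using Cons.prems(2) b'(1) by auto
  qed
  have "T \<inter> A = {\<zero>}" using differ TA(2,8) by blast
  from dimension_direct_sum_space[OF F_subfield T(1) dA this]
  have "dimension (n * length (b # bs)) F (T <+>\<^bsub>R\<^esub> A)" by (simp add: add.commute)
  moreover have "\<exists>c\<in>set (b # bs). v y - v c \<in> \<Gamma>F" if y: "y \<in> T <+>\<^bsub>R\<^esub> A" "y \<noteq> \<zero>" for y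
  proof -
    obtain t s where ts: "t \<in> T" "s \<in> A" "y = t \<oplus> s" using y(1) unfolding set_add_def' by blast
    have c: "t \<in> carrier R" "s \<in> carrier R" using ts TA(1,7) by auto
    consider "t = \<zero>" | "s = \<zero>" | "t \<noteq> \<zero>" "s \<noteq> \<zero>" "v t < v s" | "t \<noteq> \<zero>" "s \<noteq> \<zero>" "v s < v t"
      using differ[OF ts(1) _ ts(2)] by force
    then show ?thesis
    proof cases
      case 1
      then show ?thesis using A_val[OF ts(2)] ts(3) y(2) c by auto
    next
      case 2
      then show ?thesis using T(2)[OF ts(1)] ts(3) y(2) c by auto
    next
      case 3
      then have "v y = v t" using v_add_eq[of t s] c ts(3) by auto
      then show ?thesis using T(2)[OF ts(1)] 3 by auto
    next
      case 4
      then have "v y = v s" using v_add_eq[of s t] c ts(3) by (auto simp: a_comm)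
      then show ?thesis using A_val[OF ts(2)] 4 by auto
    qed
  qed
  ultimately show ?case by blast
qed

text \<open>The chosen basis of E over K ends in 1, and f is the coefficient of the lift 1 in an
  expansion of a. What remains is w' + t, with w' in the span of the other lifts and t in the part
  whose nonzero elements have values outside \<Gamma>_F. The dominant term decides: t gives a value
  outside \<Gamma>_F, and w' gives a nonzero residue in a space that meets K only in zero.\<close>

theorem best_central_approximation:
  assumes a: "a \<in> carrier R"
  shows "\<exists>f\<in>F. a \<ominus> f = \<zero> \<or> v (a \<ominus> f) \<notin> \<Gamma>F \<or>
     (\<exists>c\<in>F - {\<zero>}. (a \<ominus> f) \<otimes> inv c \<in> V \<and> res ((a \<ominus> f) \<otimes> inv c) \<notin> K)"
proof -
  have K01: "\<zero>\<^bsub>E\<^esub> \<in> K" "\<one>\<^bsub>E\<^esub> \<in> K" using subringE(2,3)[OF subfieldE(1)[OF K_subfield]] by auto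
  have "E.Span K [] = {\<zero>\<^bsub>E\<^esub>}" by simp
  then have "E.independent K [\<one>\<^bsub>E\<^esub>]" by (intro E.li_Cons) auto
  then obtain Vs where Vs: "length (Vs @ [\<one>\<^bsub>E\<^esub>]) = n" "E.independent K (Vs @ [\<one>\<^bsub>E\<^esub>])"
    using E.complete_base[OF K_subfield dim_E, of "[\<one>\<^bsub>E\<^esub>]"] by auto
  have "\<forall>y\<in>set Vs. \<exists>x\<in>V. y = res x"
    using res_surj E.independent_in_carrier[OF Vs(2)] by auto
  then obtain l where l: "\<And>y. y \<in> set Vs \<Longrightarrow> l y \<in> V" "\<And>y. y \<in> set Vs \<Longrightarrow> y = res (l y)" by metis
  define Ws where "Ws = map l Vs"
  have Ws: "set Ws \<subseteq> V" "map res Ws = Vs"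
    unfolding Ws_def using l by (auto intro!: map_idI[symmetric] simp: comp_def map_idI)
  define Us where "Us = Ws @ [\<one>]"
  have Us: "set Us \<subseteq> V" "map res Us = Vs @ [\<one>\<^bsub>E\<^esub>]" "length Us = n" "E.independent K (map res Us)"
    using Ws Vs unfolding Us_def Ws_def by auto
  have UsR: "set Us \<subseteq> carrier R" and WsR: "set Ws \<subseteq> carrier R" using Us(1) Ws(1) V_carrier by blast+
  obtain cs where cs: "set cs = val_classes - {val_class \<one>}" "distinct cs"
    using finite_distinct_list[of "val_classes - {val_class \<one>}"] finite_classes by auto
  have "\<forall>C\<in>set cs. \<exists>b\<in>carrier R - {\<zero>}. C = val_class b" using cs(1) unfolding val_classes_def by auto
  then obtain r where r: "\<And>C. C \<in> set cs \<Longrightarrow> r C \<in> carrier R - {\<zero>}" "\<And>C. C \<in> set cs \<Longrightarrow> C = val_class (r C)"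
    by metis
  define bs where "bs = map r cs"
  have mb: "map val_class bs = cs" unfolding bs_def using r(2) by (auto intro!: map_idI simp: comp_def)
  have bs: "set bs \<subseteq> carrier R - {\<zero>}" unfolding bs_def using r(1) by auto
  \<comment> \<open>The class of one is left out because \<open>A\<close> below already accounts for
    the values in \<Gamma>_F.\<close>
  have "length cs = n - 1"
    using cs distinct_card[of cs] card_classes finite_classes one_neq_zero
    by (simp add: val_classes_def)
  then have len: "length bs = n - 1" unfolding bs_def by simp
  have "distinct (map val_class bs)" unfolding mb by (rule cs(2))
  then obtain T where T: "dimension (n * length bs) F T" "\<And>t. \<lbrakk>t \<in> T; t \<noteq> \<zero>\<rbrakk> \<Longrightarrow> \<exists>b\<in>set bs. v t - v b \<in> \<Gamma>F"
    using totally_ramified_sum[OF Us(1,4,3) bs] by blast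
  have T_val: "v t \<notin> \<Gamma>F" if t: "t \<in> T" "t \<noteq> \<zero>" for t
  proof
    assume h: "v t \<in> \<Gamma>F"
    obtain b where b: "b \<in> set bs" "v t - v b \<in> \<Gamma>F" using T(2)[OF t] by blast
    have "v b - v \<one> \<in> \<Gamma>F" using \<Gamma>F_closed(2)[OF h \<Gamma>F_closed(3)[OF b(2)]] by simp
    then have "val_class b = val_class \<one>" unfolding val_class_eq_iff .
    moreover have "val_class b \<in> set cs" using b(1) mb by (metis imageI set_map)
    ultimately show False using cs(1) by simp
  qed
  have indU: "independent F Us" by (rule independent_lift[OF Us(1,4)])
  define A where "A = Span F Us"
  have dA: "dimension n F A" unfolding A_def using dimension_independent[OF indU] Us(3) by simp
  have A_val: "v w \<in> \<Gamma>F" if w: "w \<in> A" "w \<noteq> \<zero>" for w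
    using scaled_residue_in_value[OF _ w(2) Span_scaled_residue[OF Us(1,4) _ w(2)]] w(1)
      Span_subgroup_props(1)[OF F_subfield UsR] unfolding A_def by blast
  note TA = space_subgroup_props[OF F_subfield T(1)] space_subgroup_props[OF F_subfield dA]
  have "A \<inter> T = {\<zero>}" using A_val T_val TA(2,8) by blast
  from dimension_direct_sum_space[OF F_subfield dA T(1) this]
  \<comment> \<open>The dimensions n and n (n - 1) add up to [D:F], so the sum is all of
    \<open>D\<close>.\<close>
  have "dimension (n * n) F (A <+>\<^bsub>R\<^esub> T)"
    using len n_positive by (metis Suc_diff_1 mult_Suc_right)
  then obtain Xs where Xs: "set Xs \<subseteq> carrier R" "independent F Xs" "length Xs = n * n" "Span F Xs = A <+>\<^bsub>R\<^esub> T"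
    using exists_base[OF F_subfield] by blast
  have "dimension (n * n) F (carrier R)"
    using finite_dimensionE[OF F_subfield finite_dim] dim_D by (simp add: over_def)
  then have "A <+>\<^bsub>R\<^esub> T = carrier R"
    using independent_length_eq_dimension[OF F_subfield _ Xs(2,1)] Xs(3,4) by blast
  then obtain w t where wt: "w \<in> A" "t \<in> T" "a = w \<oplus> t" using a unfolding set_add_def' by blast
  have "A = Span F Ws <+>\<^bsub>R\<^esub> Span F [\<one>]"
    unfolding A_def Us_def using Span_append_eq_set_add[OF F_subfield WsR, of "[\<one>]"] by simp
  then obtain w' f where w': "w' \<in> Span F Ws" "f \<in> Span F [\<one>]" "w = w' \<oplus> f"
    using wt(1) unfolding set_add_def' by blast
  have "f \<in> F" using w'(2) F_carrier by (auto simp: line_extension_mem_iff)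
  have cl: "f \<in> carrier R" "w' \<in> carrier R" "t \<in> carrier R"
    using F_carrier[OF \<open>f \<in> F\<close>] w'(1) Span_subgroup_props(1)[OF F_subfield WsR] wt(2) TA(1) by auto
  have af: "a \<ominus> f = w' \<oplus> t" unfolding wt(3) w'(3) using cl by algebra
  have WsA: "w' \<in> A"
  proof -
    have "w' \<oplus> \<zero> \<in> Span F Ws <+>\<^bsub>R\<^esub> Span F [\<one>]"
      using w'(1) Span_subgroup_props(2)[OF F_subfield, of "[\<one>]"] unfolding set_add_def' by auto
    then show ?thesis using cl \<open>A = Span F Ws <+>\<^bsub>R\<^esub> Span F [\<one>]\<close> by simp
  qed
  show ?thesis
  proof (cases "t \<noteq> \<zero> \<and> (w' = \<zero> \<or> v t < v w')")
    case True
    then have "v (a \<ominus> f) = v t" unfolding af using v_add_eq[of t w'] cl by (simp add: a_comm)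
    then show ?thesis using T_val[OF wt(2)] True \<open>f \<in> F\<close> by (intro bexI[of _ f]) auto
  next
    case False
    show ?thesis
    proof (cases "w' = \<zero>")
      case True
      then show ?thesis using False af \<open>f \<in> F\<close> by auto
    next
      case w0: False
      \<comment> \<open>Equal values are impossible: that of w' lies in \<Gamma>_F, that of a
        nonzero t does not.\<close>
      have lt: "t = \<zero> \<or> v w' < v t"
        using False w0 A_val[OF WsA w0] T_val[OF wt(2)] by force
      have indW: "E.independent K (map res Ws)" "E.Span K Vs \<inter> E.Span K [\<one>\<^bsub>E\<^esub>] = {\<zero>\<^bsub>E\<^esub>}"
        using E.independent_split[OF K_subfield Vs(2)] Ws(2) by auto
      obtain c where c: "c \<in> F" "c \<noteq> \<zero>" "w' \<otimes> inv c \<in> V" "res (w' \<otimes> inv c) \<in> E.Span K Vs"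
          "res (w' \<otimes> inv c) \<noteq> \<zero>\<^bsub>E\<^esub>"
        using Span_scaled_residue[OF Ws(1) indW(1) w'(1) w0] Ws(2) unfolding scaled_residue_in_def by auto
      have cR: "c \<in> carrier R" using F_carrier[OF c(1)] .
      note ic = inv_props[OF cR c(2)]
      have vw: "v w' + v (inv c) = 0"
        using res_nonzero[OF c(3,5)] v_mult[OF cl(2) ic(1) w0 ic(4)] by simp
      have tM: "t \<otimes> inv c \<in> M"
      proof (cases "t = \<zero>")
        case True
        then show ?thesis using ic by (simp add: M_iff)
      next
        case False
        then have "v w' < v t" using lt by simp
        then have "v w' + v (inv c) < v t + v (inv c)" by simp
        then show ?thesis using vw v_mult[OF cl(3) ic(1) False ic(4)] cl ic by (simp add: M_iff)
      qed
      have eq: "(a \<ominus> f) \<otimes> inv c = w' \<otimes> inv c \<oplus> t \<otimes> inv c"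
        unfolding af using cl ic by (simp add: l_distr)
      have "res ((a \<ominus> f) \<otimes> inv c) = res (w' \<otimes> inv c)"
        unfolding eq using res_add[OF c(3) M_V[OF tM]] res_zero_iff[OF M_V[OF tM]] tM c(3) by simp
      moreover have "(a \<ominus> f) \<otimes> inv c \<in> V" unfolding eq using V_closed(2)[OF c(3) M_V[OF tM]] .
      moreover have "res (w' \<otimes> inv c) \<notin> K"
      proof
        assume k: "res (w' \<otimes> inv c) \<in> K"
        have "res (w' \<otimes> inv c) \<otimes>\<^bsub>E\<^esub> \<one>\<^bsub>E\<^esub> \<oplus>\<^bsub>E\<^esub> \<zero>\<^bsub>E\<^esub> \<in> E.Span K [\<one>\<^bsub>E\<^esub>]"
          using k by (auto simp: E.line_extension_mem_iff simp del: E.r_zero E.r_one)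
        then have "res (w' \<otimes> inv c) \<in> E.Span K [\<one>\<^bsub>E\<^esub>]" using c(3) by simp
        then show False using indW(2) c(4,5) by blast
      qed
      ultimately show ?thesis using c(1,2) \<open>f \<in> F\<close> by (intro bexI[of _ f]) auto
    qed
  qed
qed

end

section \<open>Central p-th powers\<close>

text \<open>Pascal's rule: multiplication by x shifts the index, multiplication by y keeps it. Only
  x and y have to commute, since \<open>D\<close> need not be commutative.\<close>

lemma (in ring) binomial_of_commuting:
  assumes x: "x \<in> carrier R" and y: "y \<in> carrier R" and comm: "x \<otimes> y = y \<otimes> x"
  shows "(x \<oplus> y) [^] (n::nat) = (\<Oplus>k\<in>{..n}. add_pow R (n choose k) (x [^] k \<otimes> y [^] (n - k)))"
proof (induction n)
  case 0
  then show ?case by simp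
next
  case (Suc n)
  define t where "t k = x [^] k \<otimes> y [^] (Suc n - k)" for k
  have tc: "t k \<in> carrier R" for k unfolding t_def using x y by simp
  let ?f = "\<lambda>k. add_pow R (n choose k) (x [^] k \<otimes> y [^] (n - k))"
  have fc: "?f k \<in> carrier R" for k using x y by simp
  have yx: "y [^] i \<otimes> x = x \<otimes> y [^] i" for i :: nat
    using group_commutes_pow[of y x i] comm x y by simp
  have sy: "(\<Oplus>k\<in>{..n}. ?f k) \<otimes> y = (\<Oplus>k\<in>{..Suc n}. add_pow R (n choose k) (t k))"
  proof -
    have "(\<Oplus>k\<in>{..n}. ?f k) \<otimes> y = (\<Oplus>k\<in>{..n}. ?f k \<otimes> y)"
      using y fc by (intro finsum_ldistr) auto
    also have "\<dots> = (\<Oplus>k\<in>{..n}. add_pow R (n choose k) (t k))"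
      using x y by (intro finsum_cong') (auto simp: t_def add_pow_ldistr m_assoc Suc_diff_le)
    \<comment> \<open>The added top term has the coefficient \<open>n choose Suc n\<close>, which is
      zero.\<close>
    also have "\<dots> = (\<Oplus>k\<in>{..Suc n}. add_pow R (n choose k) (t k))"
      using tc by (simp add: binomial_eq_0)
    finally show ?thesis .
  qed
  have sx: "(\<Oplus>k\<in>{..n}. ?f k) \<otimes> x = (\<Oplus>k\<in>{..Suc n}. add_pow R (if k = 0 then 0 else n choose (k - 1)) (t k))"
  proof -
    have "(\<Oplus>k\<in>{..n}. ?f k) \<otimes> x = (\<Oplus>k\<in>{..n}. ?f k \<otimes> x)"
      using x fc by (intro finsum_ldistr) auto
    also have "\<dots> = (\<Oplus>k\<in>{..n}. add_pow R (n choose k) (t (Suc k)))"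
    proof (rule finsum_cong')
      fix k
      have "x [^] k \<otimes> y [^] (n - k) \<otimes> x = x [^] k \<otimes> (x \<otimes> y [^] (n - k))"
        using x y yx[of "n - k"] by (simp add: m_assoc)
      also have "\<dots> = t (Suc k)" unfolding t_def using x y by (simp add: m_assoc)
      finally show "?f k \<otimes> x = add_pow R (n choose k) (t (Suc k))"
        using x y by (simp add: add_pow_ldistr)
    qed (use tc in auto)
    also have "\<dots> = (\<Oplus>k\<in>{..Suc n}. add_pow R (if k = 0 then 0 else n choose (k - 1)) (t k))"
      using tc by (subst finsum_Suc2) (auto intro!: finsum_closed)
    finally show ?thesis .
  qed
  have "(x \<oplus> y) [^] Suc n = (\<Oplus>k\<in>{..n}. ?f k) \<otimes> x \<oplus> (\<Oplus>k\<in>{..n}. ?f k) \<otimes> y"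
    using Suc x y fc by (simp add: r_distr finsum_closed)
  also have "\<dots> = (\<Oplus>k\<in>{..Suc n}. add_pow R (if k = 0 then 0 else n choose (k - 1)) (t k)
      \<oplus> add_pow R (n choose k) (t k))"
    unfolding sx sy using tc by (intro finsum_addf[symmetric]) auto
  also have "\<dots> = (\<Oplus>k\<in>{..Suc n}. add_pow R (Suc n choose k) (t k))"
  proof (rule finsum_cong')
    fix k
    have "(if k = 0 then 0 else n choose (k - 1)) + (n choose k) = (Suc n choose k)"
      by (cases k) auto
    then show "add_pow R (if k = 0 then 0 else n choose (k - 1)) (t k) \<oplus> add_pow R (n choose k) (t k) =
        add_pow R (Suc n choose k) (t k)"
      using add.nat_pow_mult[OF tc] by simp
  qed (use tc in auto)
  finally show ?case unfolding t_def .
qed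

text \<open>The inner binomial coefficients are multiples of p. The same statement serves the
  division algebra and its residue field.\<close>

lemma (in ring) freshmans_dream:
  fixes p :: nat
  assumes p: "Factorial_Ring.prime p" and char: "add_pow R p \<one> = \<zero>"
    and x: "x \<in> carrier R" and y: "y \<in> carrier R" and comm: "x \<otimes> y = y \<otimes> x"
  shows "(x \<oplus> y) [^] p = x [^] p \<oplus> y [^] p"
proof -
  let ?f = "\<lambda>k. add_pow R (p choose k) (x [^] k \<otimes> y [^] (p - k))"
  have fc: "?f k \<in> carrier R" for k using x y by simp
  have p0: "p > 0" using p by (rule prime_gt_0_nat)
  have "?f k = \<zero>" if k: "k \<in> {..p} - {0, p}" for k
  proof -
    obtain m where m: "p choose k = p * m"
      using dvd_choose_prime[of k p] p k by (auto elim: dvdE)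
    define z where "z = x [^] k \<otimes> y [^] (p - k)"
    have z: "z \<in> carrier R" unfolding z_def using x y by simp
    have "add_pow R p z = add_pow R p \<one> \<otimes> z" using z by (simp add: add_pow_ldistr)
    then have "add_pow R p z = \<zero>" using char z by simp
    then have "add_pow R (p * m) z = \<zero>" using add.nat_pow_pow[OF z, of m p] by simp
    then show ?thesis unfolding m z_def .
  qed
  then have "(\<Oplus>k\<in>{..p}. ?f k) = (\<Oplus>k\<in>{0, p}. ?f k)"
    using fc by (intro add.finprod_mono_neutral_cong_right) auto
  also have "\<dots> = ?f 0 \<oplus> ?f p"
  proof -
    have "(\<Oplus>k\<in>{0, p}. g k) = g 0 \<oplus> g p" if "\<And>k. g k \<in> carrier R" for g
      using that p0 by simp
    from this[of ?f, OF fc] show ?thesis .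
  qed
  also have "\<dots> = y [^] p \<oplus> x [^] p" using x y by simp
  finally show ?thesis using binomial_of_commuting[OF x y comm, of p] x y by (simp add: a_comm)
qed

lemma (in field) hilbert_90_quotient:
  assumes \<tau>: "\<tau> \<in> ring_hom R R" and w: "w \<in> carrier R" and n: "n > 0"
    and "\<And>x. x \<in> carrier R \<Longrightarrow> (\<tau> ^^ n) x = x"
    and "\<And>i j. i < j \<Longrightarrow> j < n \<Longrightarrow> \<exists>x\<in>carrier R. (\<tau> ^^ i) x \<noteq> (\<tau> ^^ j) x"
    and "twisted_norm \<tau> w n = \<one>"
  shows "\<exists>y\<in>carrier R - {\<zero>}. w = \<tau> y \<otimes> inv y"
proof -
  obtain z where z: "z \<in> carrier R" "z \<noteq> \<zero>" "w \<otimes> \<tau> z = z"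
    using hilbert_90[OF assms] by blast
  have zU: "z \<in> Units R" using z by (simp add: field_Units)
  have \<tau>c: "\<tau> z \<in> carrier R" "\<tau> (inv z) \<in> carrier R" using ring_hom_closed[OF \<tau>] z zU by auto
  have "\<tau> z \<otimes> \<tau> (inv z) = \<tau> (z \<otimes> inv z)"
    using ring_hom_mult[OF \<tau> z(1), of "inv z"] zU by simp
  also have "\<dots> = \<one>" using zU ring_hom_one[OF \<tau>] by simp
  finally have one: "\<tau> z \<otimes> \<tau> (inv z) = \<one>" .
  have "w = w \<otimes> (\<tau> z \<otimes> \<tau> (inv z))" using one w by simp
  also have "\<dots> = z \<otimes> \<tau> (inv z)" using w \<tau>c z(3) by (simp add: m_assoc[symmetric])
  finally have "w = \<tau> (inv z) \<otimes> inv (inv z)" using zU z(1) \<tau>c by (simp add: m_comm)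
  moreover have "inv z \<noteq> \<zero>" using zU field_Units Units_inv_Units by blast
  ultimately show ?thesis using zU by (intro bexI[of _ "inv z"]) auto
qed

section \<open>Elements with central p-th power and strong degeneracy\<close>

context semi_ramified_division_ring
begin

lemma theta_F:
  assumes "z \<in> F" "z \<noteq> \<zero>"
  shows "theta R v z = \<one>\<^bsub>G\<^esub>"
proof -
  have "v z \<in> \<Gamma>F" unfolding \<Gamma>F_def using assms by blast
  then have "val_class z = val_class \<one>" unfolding val_class_eq_iff by simp
  then show ?thesis
    unfolding one_G using F_carrier assms one_neq_zero by (intro theta_eq_if_val_class_eq) auto
qed

lemma pow_nonzero:
  assumes "a \<in> carrier R" "a \<noteq> \<zero>"
  shows "a [^] (i::nat) \<in> carrier R" "a [^] i \<noteq> \<zero>"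
proof -
  show "a [^] i \<in> carrier R" using assms by simp
  show "a [^] i \<noteq> \<zero>" using assms one_neq_zero mult_nonzero by (induction i) auto
qed

lemma theta_pow:
  assumes "a \<in> carrier R" "a \<noteq> \<zero>"
  shows "theta R v (a [^] (i::nat)) = theta R v a [^]\<^bsub>G\<^esub> i"
  using theta_mult_G pow_nonzero[OF assms] assms by (induction i) (auto simp: one_G)

lemma theta_pow_funpow:
  assumes "a \<in> carrier R" "a \<noteq> \<zero>" "y \<in> carrier E"
  shows "theta R v (a [^] (i::nat)) y = (theta R v a ^^ i) y"
proof (induction i)
  case 0
  then show ?case using theta_one assms(3) by simp
next
  case (Suc i)
  have "a [^] Suc i = a \<otimes> a [^] i" using assms(1) by (rule nat_pow_Suc2)
  then show ?case
    using Suc theta_mult[OF assms(1,2) pow_nonzero[OF assms(1,2)]] assms(3) by (simp add: compose_eq)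
qed

lemma theta_foldr:
  assumes "\<And>i. i \<in> set xs \<Longrightarrow> x i \<in> carrier R - {\<zero>}"
  shows "foldr (\<lambda>i y. x i \<otimes> y) xs \<one> \<in> carrier R - {\<zero>} \<and>
    theta R v (foldr (\<lambda>i y. x i \<otimes> y) xs \<one>) = foldr (\<lambda>i y. theta R v (x i) \<otimes>\<^bsub>G\<^esub> y) xs \<one>\<^bsub>G\<^esub>"
  using assms one_neq_zero mult_nonzero theta_mult_G by (induction xs) (auto simp: one_G)

lemma theta_ordered_prod:
  assumes "\<And>i. i \<in> {1..r} \<Longrightarrow> x i \<in> carrier R - {\<zero>}"
  shows "ordered_prod R r x \<in> carrier R - {\<zero>}"
    "theta R v (ordered_prod R r x) = ordered_prod G r (\<lambda>i. theta R v (x i))"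
proof -
  have "\<And>i. i \<in> set [1..<Suc r] \<Longrightarrow> x i \<in> carrier R - {\<zero>}"
    by (rule assms) auto
  from theta_foldr[of "[1..<Suc r]" x, OF this]
  show "ordered_prod R r x \<in> carrier R - {\<zero>}"
    "theta R v (ordered_prod R r x) = ordered_prod G r (\<lambda>i. theta R v (x i))"
    unfolding ordered_prod_def by blast+
qed

lemma ordered_prod_cong:
  "(\<And>i. i \<in> {1..r} \<Longrightarrow> x i = y i) \<Longrightarrow> ordered_prod G r x = ordered_prod G r y"
  unfolding ordered_prod_def by (intro foldr_cong) auto

lemma conjugate_pow:
  assumes a: "a \<in> carrier R" "a \<noteq> \<zero>" and x: "x \<in> carrier R"
  shows "conjugate a (x [^] (i::nat)) = conjugate a x [^] i"
proof (induction i)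
  case 0
  then show ?case using a inv_props[OF a] by simp
next
  case (Suc i)
  have "conjugate a (x [^] i \<otimes> x) = conjugate a (x [^] i) \<otimes> conjugate a x"
    by (intro conjugate_mult[OF a]) (use x in auto)
  then show ?case using Suc by simp
qed

text \<open>Conjugating by \<open>s\<close> multiplies \<open>b\<close> by a unit of norm one, because \<open>b\<^sup>p\<close> is central.\<close>

lemma conjugate_quotient_norm:
  fixes p :: nat
  assumes b: "b \<in> carrier R" "b \<noteq> \<zero>" "b [^] p \<in> F" and s: "s \<in> carrier R" "s \<noteq> \<zero>"
    and w: "w = s \<otimes> b \<otimes> inv s \<otimes> inv b"
  shows "w \<in> V" "w \<noteq> \<zero>" "v w = 0" "Ef.twisted_norm (theta R v b) (res w) p = \<one>\<^bsub>E\<^esub>"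
proof -
  note ib = inv_props[OF b(1,2)] and js = inv_props[OF s]
  note cb = conjugate_props[OF s b(1)]
  have wR: "w \<in> carrier R" "w \<noteq> \<zero>" unfolding w using b s ib js mult_nonzero by auto
  have vw: "v w = v (conjugate s b) + v (inv b)"
    unfolding w using cb(1) cb(2) b ib by (intro v_mult) auto
  then show v0: "v w = 0" using cb(3) b v_inv by simp
  then show wV: "w \<in> V" and "w \<noteq> \<zero>" using wR by (auto simp: V_iff)
  have wb: "w \<otimes> b = conjugate s b" unfolding w using b s ib js by (simp add: m_assoc)
  \<comment> \<open>\<open>N j\<close> lifts the partial norm of the residue of w and equals (s b
    s^-1)^j b^(-j). At j = p both powers are the same central element, so \<open>N p\<close> is
    one.\<close>
  define N where "N = rec_nat \<one> (\<lambda>_ y. w \<otimes> conjugate b y)"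
  have N: "N 0 = \<one>" "\<And>j. N (Suc j) = w \<otimes> conjugate b (N j)" unfolding N_def by simp_all
  have NV: "N j \<in> V" for j
    by (induction j) (use N wV V_closed(1) conjugate_props(4)[OF b(1,2)] V_carrier in auto)
  have NR: "N j \<in> carrier R" for j using V_carrier[OF NV] .
  have pow: "conjugate s b [^] j = N j \<otimes> b [^] j" for j
  proof (induction j)
    case 0
    then show ?case using N by simp
  next
    case (Suc j)
    have "conjugate s b [^] Suc j = conjugate s b \<otimes> conjugate s b [^] j" using cb(1) by (rule nat_pow_Suc2)
    also have "\<dots> = (w \<otimes> b) \<otimes> (N j \<otimes> b [^] j)" unfolding Suc wb ..
    also have "\<dots> = w \<otimes> (b \<otimes> N j \<otimes> (inv b \<otimes> b)) \<otimes> b [^] j"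
      using wR NR b ib by (simp add: m_assoc)
    also have "\<dots> = N (Suc j) \<otimes> (b \<otimes> b [^] j)"
      unfolding N(2) using wR NR[of j] b ib(1) by (simp add: m_assoc)
    also have "b \<otimes> b [^] j = b [^] Suc j" using nat_pow_Suc2[OF b(1), of j] by simp
    finally show ?case .
  qed
  have "conjugate s (b [^] p) = b [^] p"
    using F_commute[OF b(3) s(1)] b s js by (simp add: m_assoc flip: F_commute[OF b(3) s(1)])
  then have "N p \<otimes> b [^] p = b [^] p" using pow[of p] conjugate_pow[OF s b(1), of p] by simp
  moreover note bp = pow_nonzero[OF b(1,2), of p]
  moreover note ibp = inv_props[OF bp]
  ultimately have "N p \<otimes> (b [^] p \<otimes> inv (b [^] p)) = b [^] p \<otimes> inv (b [^] p)"
    using m_assoc[OF NR[of p] bp(1) ibp(1)] by simp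
  then have Np: "N p = \<one>" using NR[of p] ibp(3) by simp
  have "Ef.twisted_norm (theta R v b) (res w) j = res (N j)" for j
  proof (induction j)
    case 0
    then show ?case using N by simp
  next
    case (Suc j)
    then show ?case
      using N(2)[of j] theta_res[OF b(1,2) NV[of j]] res_mult[OF wV]
        conjugate_props(4)[OF b(1,2) NR[of j] NV[of j]] by simp
  qed
  then show "Ef.twisted_norm (theta R v b) (res w) p = \<one>\<^bsub>E\<^esub>" using Np by simp
qed

lemma strongly_degenerate_if_central_power:
  assumes p: "Factorial_Ring.prime p" and ord: "order G = p ^ k"
    and b: "b \<in> carrier R" "b \<noteq> \<zero>" "b [^] p \<in> F" "v b \<notin> \<Gamma>F"
  shows "strongly_degenerate R F v"
proof -
  obtain r \<sigma> where cyc: "cyclic_decomposition G r \<sigma>"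
    using G.cyclic_decomposition_exists[OF p ord finite_G] by blast
  have \<sigma>: "\<sigma> i \<in> carrier G" if "i \<in> {1..r}" for i
    using cyc that unfolding cyclic_decomposition_def by blast
  have bG: "theta R v b \<in> carrier G" by (rule theta_in_G[OF b(1,2)])
  then have "theta R v b \<in> ordered_prod G r ` carrier (product_group {1..r} (\<lambda>i. subgroup_generated G {\<sigma> i}))"
    using cyc unfolding cyclic_decomposition_def by (auto simp: iso_def bij_betw_def)
  then obtain x where x: "x \<in> carrier (product_group {1..r} (\<lambda>i. subgroup_generated G {\<sigma> i}))"
      "theta R v b = ordered_prod G r x" by blast
  have "\<exists>m::nat. x i = \<sigma> i [^]\<^bsub>G\<^esub> m" if i: "i \<in> {1..r}" for i
  proof -
    have "x i \<in> generate G (carrier G \<inter> {\<sigma> i})"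
      using x(1) i by (auto simp: carrier_subgroup_generated)
    then show ?thesis
      using G.generate_pow_on_finite_carrier[OF finite_G \<sigma>[OF i]] \<sigma>[OF i] by auto
  qed
  then obtain m :: "nat \<Rightarrow> nat" where m: "\<And>i. i \<in> {1..r} \<Longrightarrow> x i = \<sigma> i [^]\<^bsub>G\<^esub> m i" by metis
  define \<sigma>m where "\<sigma>m = ordered_prod G r (\<lambda>i. \<sigma> i [^]\<^bsub>G\<^esub> m i)"
  have \<sigma>m: "\<sigma>m = theta R v b" unfolding \<sigma>m_def x(2) using m by (intro ordered_prod_cong) simp
  have "\<forall>i\<in>{1..r}. \<exists>a. a \<in> carrier R - {\<zero>} \<and> theta R v a = \<sigma> i" using G_theta[OF \<sigma>] by force
  then obtain \<pi> where \<pi>: "\<And>i. i \<in> {1..r} \<Longrightarrow> \<pi> i \<in> carrier R - {\<zero>}"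
      "\<And>i. i \<in> {1..r} \<Longrightarrow> theta R v (\<pi> i) = \<sigma> i" by metis
  define \<pi>m where "\<pi>m = ordered_prod R r (\<lambda>i. \<pi> i [^] m i)"
  have \<pi>p: "\<pi> i [^] m i \<in> carrier R - {\<zero>}" if "i \<in> {1..r}" for i
    using \<pi>(1)[OF that] pow_nonzero[of "\<pi> i" "m i"] by blast
  have \<pi>m: "\<pi>m \<in> carrier R" "\<pi>m \<noteq> \<zero>" using theta_ordered_prod(1)[OF \<pi>p] unfolding \<pi>m_def by auto
  have "theta R v \<pi>m = ordered_prod G r (\<lambda>i. theta R v (\<pi> i [^] m i))"
    unfolding \<pi>m_def by (rule theta_ordered_prod(2)[OF \<pi>p])
  also have "\<dots> = \<sigma>m" unfolding \<sigma>m_def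
    using \<pi> theta_pow by (intro ordered_prod_cong) auto
  finally have t\<pi>m: "theta R v \<pi>m = theta R v b" using \<sigma>m by simp
  \<comment> \<open>Injectivity of \<theta> puts the difference of values into \<Gamma>_F. The
    central factor f gives b the value of \<pi>^m and affects neither \<theta>(b) nor the centrality
    of the p-th power.\<close>
  obtain f where f: "f \<in> F" "f \<noteq> \<zero>" "v \<pi>m - v b = v f"
    using theta_inj[OF \<pi>m b(1,2) t\<pi>m] unfolding \<Gamma>F_def by auto
  have fR: "f \<in> carrier R" by (rule F_carrier[OF f(1)])
  define b' where "b' = f \<otimes> b"
  have b': "b' \<in> carrier R" "b' \<noteq> \<zero>" unfolding b'_def using fR f(2) b mult_nonzero by auto
  have "b' [^] p = f [^] p \<otimes> b [^] p"
    unfolding b'_def using pow_mult_distrib[OF F_commute[OF f(1) b(1)] fR b(1)] .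
  moreover have "f [^] p \<in> F" using F_closed(3,6) f(1) by (induction p) auto
  ultimately have b'p: "b' [^] p \<in> F" using b(3) F_closed(6) by simp
  have tb': "theta R v b' = \<sigma>m"
    unfolding b'_def using theta_mult_G[OF fR f(2) b(1,2)] theta_F[OF f(1,2)] bG \<sigma>m by simp
  note i\<pi> = inv_props[OF \<pi>m]
  define u0 where "u0 = b' \<otimes> inv \<pi>m"
  have u0: "u0 \<in> carrier R" "u0 \<noteq> \<zero>" "v u0 = 0"
  proof -
    show "u0 \<in> carrier R" "u0 \<noteq> \<zero>" unfolding u0_def using b' i\<pi> mult_nonzero by auto
    have "v u0 = v b' + v (inv \<pi>m)" unfolding u0_def using b' i\<pi> by (intro v_mult) auto
    also have "v b' = v f + v b" unfolding b'_def using fR f(2) b by (intro v_mult) auto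
    also have "v (inv \<pi>m) = - v \<pi>m" by (rule v_inv[OF \<pi>m])
    finally show "v u0 = 0" using f(3) by (simp add: algebra_simps)
  qed
  have b'_eq: "b' = u0 \<otimes> \<pi>m" unfolding u0_def using b' i\<pi> \<pi>m by (simp add: m_assoc)
  note U = unit_V[OF u0]
  note iu = inv_props[OF u0(1,2)]
  define l where "l = res u0"
  have l: "l \<in> carrier E - {\<zero>\<^bsub>E\<^esub>}"
    unfolding l_def using U(1,3) by simp
  define u where "u i = res (\<pi> i \<otimes> \<pi>m \<otimes> inv (\<pi> i) \<otimes> inv \<pi>m)" for i
  \<comment> \<open>Centrality of b^p makes the order divide p. It is not one, since v(b) lies
    outside \<Gamma>_F and \<theta> is injective modulo \<Gamma>_F.\<close>
  have ord_\<sigma>m: "G.ord \<sigma>m = p"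
  proof -
    have bp0: "b [^] p \<noteq> \<zero>" by (rule pow_nonzero(2)[OF b(1,2)])
    have "theta R v b [^]\<^bsub>G\<^esub> p = \<one>\<^bsub>G\<^esub>"
      using theta_pow[OF b(1,2), of p] theta_F[OF b(3) bp0] by simp
    then have "G.ord \<sigma>m dvd p" unfolding \<sigma>m using G.pow_eq_id[OF bG] by simp
    moreover have "\<sigma>m \<noteq> \<one>\<^bsub>G\<^esub>"
      unfolding \<sigma>m one_G using theta_inj[OF b(1,2) one_closed one_neq_zero] b(4) by auto
    then have "G.ord \<sigma>m \<noteq> 1" using G.ord_eq_1[of \<sigma>m] bG \<sigma>m by simp
    ultimately show ?thesis using p by (metis prime_nat_iff)
  qed
  have per: "(\<sigma>m ^^ p) y = y" if y: "y \<in> carrier E" for y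
  proof -
    have "(\<sigma>m ^^ p) y = theta R v (b [^] p) y" unfolding \<sigma>m using theta_pow_funpow[OF b(1,2) y] by simp
    then show ?thesis
      using theta_F[OF b(3) pow_nonzero(2)[OF b(1,2)]] one_G theta_one y by simp
  qed
  have dist: "\<exists>y\<in>carrier E. (\<sigma>m ^^ i) y \<noteq> (\<sigma>m ^^ j) y" if ij: "i < j" "j < p" for i j
  proof (rule ccontr)
    assume "\<not> ?thesis"
    then have "theta R v (b [^] j) y = theta R v (b [^] i) y" if "y \<in> carrier E" for y
      using that theta_pow_funpow[OF b(1,2) that] \<sigma>m by auto
    then have "theta R v (b [^] j) = theta R v (b [^] i)"
      by (rule extensionalityI[OF theta_ext theta_ext])
    then have "\<sigma>m [^]\<^bsub>G\<^esub> j = \<sigma>m [^]\<^bsub>G\<^esub> i" unfolding \<sigma>m theta_pow[OF b(1,2)] .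
    then have "\<sigma>m [^]\<^bsub>G\<^esub> (j - i) = \<one>\<^bsub>G\<^esub>" using G.pow_eq_div2 bG \<sigma>m by simp
    then have "p dvd j - i" using G.pow_eq_id[of \<sigma>m] bG \<sigma>m ord_\<sigma>m by simp
    then show False using ij by (auto dest: dvd_imp_le)
  qed
  have main: "\<exists>y\<in>carrier E - {\<zero>\<^bsub>E\<^esub>}. u i = (\<sigma>m y \<otimes>\<^bsub>E\<^esub> inv\<^bsub>E\<^esub> y) \<otimes>\<^bsub>E\<^esub> (l \<otimes>\<^bsub>E\<^esub> inv\<^bsub>E\<^esub> (\<sigma> i l))"
    if i: "i \<in> {1..r}" for i
  proof -
    define s where "s = \<pi> i"
    have s: "s \<in> carrier R" "s \<noteq> \<zero>" using \<pi>(1)[OF i] unfolding s_def by auto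
    note js = inv_props[OF s]
    define w where "w = s \<otimes> b' \<otimes> inv s \<otimes> inv b'"
    note W = conjugate_quotient_norm[OF b' b'p s w_def, unfolded tb']
    have "\<sigma>m \<in> ring_hom E E" unfolding \<sigma>m by (rule theta_hom[OF b(1,2)])
    then obtain y where y: "y \<in> carrier E - {\<zero>\<^bsub>E\<^esub>}" "res w = \<sigma>m y \<otimes>\<^bsub>E\<^esub> inv\<^bsub>E\<^esub> y"
      using Ef.hilbert_90_quotient[OF _ res_closed[OF W(1)] prime_gt_0_nat[OF p] per dist W(4)] by blast
    define q where "q = s \<otimes> \<pi>m \<otimes> inv s \<otimes> inv \<pi>m"
    have qR: "q \<in> carrier R" unfolding q_def using s js \<pi>m i\<pi> by simp
    have cu: "conjugate s u0 \<in> carrier R" "conjugate s u0 \<noteq> \<zero>" "v (conjugate s u0) = 0"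
      using conjugate_props[OF s u0(1)] u0 by auto
    note CU = unit_V[OF cu]
    note ic = inv_props[OF cu(1,2)]
    \<comment> \<open>Substituting b' = u0 \<pi>^m into w and solving for the commutator q places w
      between two units.\<close>
    have q_eq: "q = inv (conjugate s u0) \<otimes> w \<otimes> u0"
    proof -
      have ib': "inv b' = inv \<pi>m \<otimes> inv u0" unfolding b'_eq by (rule inv_mult[OF u0(1,2) \<pi>m])
      have "conjugate s b' = conjugate s u0 \<otimes> conjugate s \<pi>m" unfolding b'_eq by (rule conjugate_mult[OF s u0(1) \<pi>m(1)])
      then have "w = conjugate s u0 \<otimes> q \<otimes> inv u0"
        unfolding w_def ib' q_def using conjugate_props(1)[OF s \<pi>m(1)] cu i\<pi> iu by (simp add: m_assoc)
      then have "inv (conjugate s u0) \<otimes> w \<otimes> u0 = (inv (conjugate s u0) \<otimes> conjugate s u0) \<otimes> q \<otimes> (inv u0 \<otimes> u0)"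
        using ic(1) cu(1) qR iu(1) u0(1) by (simp add: m_assoc)
      then show ?thesis using ic iu qR by simp
    qed
    have "\<sigma> i l = res (conjugate s u0)"
      unfolding l_def s_def using \<pi>(2)[OF i] theta_res[OF s U(1)] s_def by simp
    moreover have "inv\<^bsub>E\<^esub> (res (conjugate s u0)) = res (inv (conjugate s u0))"
      using CU by (intro E.inv_char) auto
    ultimately have isl: "inv\<^bsub>E\<^esub> (\<sigma> i l) = res (inv (conjugate s u0))" by simp
    have "u i = res (inv (conjugate s u0)) \<otimes>\<^bsub>E\<^esub> res w \<otimes>\<^bsub>E\<^esub> res u0"
      unfolding u_def s_def[symmetric] q_def[symmetric] q_eq
      using CU(2) W(1) U(1) V_closed(1) by (simp add: res_mult)
    also have "\<dots> = res w \<otimes>\<^bsub>E\<^esub> (l \<otimes>\<^bsub>E\<^esub> inv\<^bsub>E\<^esub> (\<sigma> i l))"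
      unfolding isl unfolding l_def using CU(2) W(1) U(1) by (simp add: Ef.m_ac)
    finally show ?thesis using y by auto
  qed
  then obtain y where y: "\<And>i. i \<in> {1..r} \<Longrightarrow> y i \<in> carrier E - {\<zero>\<^bsub>E\<^esub>}"
      "\<And>i. i \<in> {1..r} \<Longrightarrow> u i = (\<sigma>m (y i) \<otimes>\<^bsub>E\<^esub> inv\<^bsub>E\<^esub> (y i)) \<otimes>\<^bsub>E\<^esub> (l \<otimes>\<^bsub>E\<^esub> inv\<^bsub>E\<^esub> (\<sigma> i l))"
    by metis
  have "Factorial_Ring.prime (G.ord \<sigma>m)" using ord_\<sigma>m p by simp
  then show ?thesis
    unfolding strongly_degenerate_def Let_def
  proof (intro exI[of _ r] exI[of _ \<sigma>] exI[of _ \<pi>] conjI exI[of _ m] bexI[of _ l] bexI[of _ y] ballI)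
    fix i assume i: "i \<in> {1..r}"
    show "residue R v (\<pi> i \<otimes> ordered_prod R r (\<lambda>i. \<pi> i [^] m i) \<otimes> inv \<pi> i \<otimes>
        inv ordered_prod R r (\<lambda>i. \<pi> i [^] m i)) =
      ordered_prod G r (\<lambda>i. \<sigma> i [^]\<^bsub>G\<^esub> m i) (y i) \<otimes>\<^bsub>E\<^esub> inv\<^bsub>E\<^esub> y i \<otimes>\<^bsub>E\<^esub> (l \<otimes>\<^bsub>E\<^esub> inv\<^bsub>E\<^esub> \<sigma> i l)"
      using y(2)[OF i] unfolding u_def \<pi>m_def \<sigma>m_def .
  qed (use cyc \<pi> l y(1) in \<open>auto simp: \<sigma>m_def\<close>)
qed

lemma residue_characteristic:
  fixes p :: nat
  assumes "add_pow R p \<one> = \<zero>"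
  shows "add_pow E p \<one>\<^bsub>E\<^esub> = \<zero>\<^bsub>E\<^esub>"
proof -
  have "add_pow R i \<one> \<in> V \<and> res (add_pow R i \<one>) = add_pow E i \<one>\<^bsub>E\<^esub>" for i :: nat
    by (induction i) (auto simp: V_closed res_add)
  from this[of p] show ?thesis using assms by simp
qed

theorem central_power_imp_central:
  fixes p :: nat
  assumes p: "Factorial_Ring.prime p" and char: "add_pow R p \<one> = \<zero>" and ord: "order G = p ^ k"
    and nd: "\<not> strongly_degenerate R F v" and a: "a \<in> carrier R" "a [^] p \<in> F"
  shows "a \<in> F"
proof -
  obtain f where f: "f \<in> F" and approx: "a \<ominus> f = \<zero> \<or> v (a \<ominus> f) \<notin> \<Gamma>F \<or>
     (\<exists>c\<in>F - {\<zero>}. (a \<ominus> f) \<otimes> inv c \<in> V \<and> res ((a \<ominus> f) \<otimes> inv c) \<notin> K)"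
    using best_central_approximation[OF a(1)] by blast
  have fR: "f \<in> carrier R" by (rule F_carrier[OF f])
  define b where "b = a \<ominus> f"
  have bR: "b \<in> carrier R" and ab: "a = b \<oplus> f" unfolding b_def using a(1) fR by (simp_all add: minus_eq a_assoc l_neg)
  have F_pow: "z [^] p \<in> F" if "z \<in> F" for z using that F_closed(3,6) by (induction p) auto
  have bp: "b [^] p \<in> F"
  proof -
    have "a [^] p = b [^] p \<oplus> f [^] p"
      unfolding ab using F_commute[OF f bR] by (intro freshmans_dream[OF p char bR fR]) simp
    then have "b [^] p = a [^] p \<oplus> \<ominus> (f [^] p)" using bR fR by (simp add: a_assoc r_neg)
    then show ?thesis using a(2) F_pow[OF f] F_closed(5,7) by simp
  qed
  consider "b = \<zero>" | "b \<noteq> \<zero>" "v b \<notin> \<Gamma>F"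
    | c where "b \<noteq> \<zero>" "c \<in> F" "c \<noteq> \<zero>" "b \<otimes> inv c \<in> V" "res (b \<otimes> inv c) \<notin> K"
    using approx unfolding b_def[symmetric] by blast
  then show ?thesis
  proof cases
    case 1
    then show ?thesis using ab f fR by simp
  next
    case 2
    then show ?thesis using strongly_degenerate_if_central_power[OF p ord bR _ bp] nd by blast
  next
    case 3
    define y where "y = b \<otimes> inv c"
    define x where "x = res y"
    have cR: "c \<in> carrier R" by (rule F_carrier[OF 3(2)])
    note ic = inv_props[OF cR 3(3)] and icF = F_inv[OF 3(2,3)]
    have y: "y \<in> V" and x: "x \<in> carrier E" unfolding x_def y_def using 3(4) by auto
    have "y [^] p = b [^] p \<otimes> inv c [^] p"
      unfolding y_def using F_commute[OF icF bR] bR ic by (intro pow_mult_distrib) auto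
    then have yF: "y [^] p \<in> F" using bp F_pow[OF icF] F_closed(6) by simp
    have yp: "y [^] i \<in> V \<and> res (y [^] i) = x [^]\<^bsub>E\<^esub> i" for i :: nat
      using y unfolding x_def by (induction i) (auto simp: V_closed res_mult)
    have xp: "x [^]\<^bsub>E\<^esub> p \<in> K" using yF yp[of p] unfolding K_iff by (intro bexI[of _ "y [^] p"]) auto
    \<comment> \<open>\<theta>(d) fixes x^p, which lies in K, and the p-th power is additive and
      without nonzero roots of zero on the residue field, so x itself is fixed. Separability then
      enters through the determination of the fixed field.\<close>
    have "theta R v d x = x" if d: "d \<in> carrier R" "d \<noteq> \<zero>" for d
    proof -
      define z where "z = theta R v d x"
      have z: "z \<in> carrier E" unfolding z_def by (rule theta_closed[OF d x])
      have "theta R v d (x [^]\<^bsub>E\<^esub> i) = z [^]\<^bsub>E\<^esub> i" for i :: nat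
        using ring_hom_mult[OF theta_hom[OF d]] ring_hom_one[OF theta_hom[OF d]] x
        unfolding z_def by (induction i) auto
      then have zp: "z [^]\<^bsub>E\<^esub> p = x [^]\<^bsub>E\<^esub> p" using theta_K[OF d xp] by simp
      define e where "e = z \<ominus>\<^bsub>E\<^esub> x"
      have e: "e \<in> carrier E" "z = e \<oplus>\<^bsub>E\<^esub> x"
        unfolding e_def using z x by (simp_all add: E.minus_eq E.a_assoc E.l_neg)
      have "z [^]\<^bsub>E\<^esub> p = e [^]\<^bsub>E\<^esub> p \<oplus>\<^bsub>E\<^esub> x [^]\<^bsub>E\<^esub> p"
        unfolding e(2) using e(1) x Ef.m_comm
        by (intro E.freshmans_dream[OF p residue_characteristic[OF char]]) auto
      then have "e [^]\<^bsub>E\<^esub> p = \<zero>\<^bsub>E\<^esub>"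
        using zp e(1) x by simp
      moreover have "e [^]\<^bsub>E\<^esub> i \<noteq> \<zero>\<^bsub>E\<^esub>" if "e \<noteq> \<zero>\<^bsub>E\<^esub>" for i :: nat
        using that e(1) Ef.integral by (induction i) auto
      ultimately have "e = \<zero>\<^bsub>E\<^esub>" by blast
      then show ?thesis using e z x unfolding z_def by simp
    qed
    then have "x \<in> K" by (rule theta_fixed_imp_mem_K[OF x])
    then show ?thesis using 3(5) unfolding x_def y_def by simp
  qed
qed

end

theorem corollary2p11:
  fixes D :: "('a, 'b) ring_scheme" and F :: "'a set"
    and v :: "'a \<Rightarrow> 'g::linordered_ab_group_add" and p :: nat
  assumes "Factorial_Ring.prime p"
    and "has_characteristic (D\<lparr>carrier := F\<rparr>) p"
    and "valued_division_algebra D F v"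
    and "semi_ramified D F v"
    and "separable_extension (residue_ring D v) (residue_subfield D v F)"
    and "\<not> cyclic_group (residue_galois_group D F v)"
    and "\<exists>k::nat. order (residue_galois_group D F v) = p ^ k"
    and "\<not> strongly_degenerate D F v"
  shows "\<forall>a\<in>carrier D. a [^]\<^bsub>D\<^esub> p \<in> F \<longrightarrow> a \<in> F"
proof -
  interpret semi_ramified_division_ring D F v
    using assms(3-5)
    unfolding semi_ramified_division_ring_def semi_ramified_division_ring_axioms_def
      valued_division_ring_def valued_division_ring_axioms_def division_ring_def division_ring_axioms_def
      valued_division_algebra_def division_algebra_def by blast
  \<comment> \<open>The characteristic is given for F as a ring of its own, whose unit and addition
    are those of \<open>D\<close>.\<close>
  have "add_pow D p \<one>\<^bsub>D\<^esub> = \<zero>\<^bsub>D\<^esub>"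
    using assms(2) unfolding has_characteristic_def by (auto simp: add_pow_def nat_pow_def)
  then show ?thesis using central_power_imp_central assms(1,7,8) by blast
qed

end
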